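(* Let $\mathfrak{H}$ be a complex separable Hilbert space of infinite dimension. Suppose that $S$ is a self-adjoint operator on $\mathfrak{H}$ of finite rank $N\in\mathbb{N}$ and that $T$ is a bounded from below self-adjoint operator on $\mathfrak{H}$ with a purely discrete spectrum. Then $D(\lambda)=E_{(-\infty,\lambda)}(T+S)-E_{(-\infty,\lambda)}(T)$ is unitarily equivalent to a finite rank self-adjoint block-Hankel operator of order $N$ for all $\lambda\in\mathbb{R}$.
   Context: $E_\Omega(X)$ denotes the spectral projection of a self-adjoint operator $X$ associated with the Borel set $\Omega\subset\mathbb{R}$. Purely discrete spectrum means that the essential spectrum is empty. A (bounded, self-adjoint) block-Hankel operator of order $N$ is a bounded self-adjoint operator on $\ell^2(\mathbb{N}_0;\mathbb{C}^N)$ given by a block matrix $(a_{j+k})_{j,k\in\mathbb{N}_0}$, where each $a_j$ is an $N\times N$ complex matrix. *)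

theory Defs
  imports "HOL-Analysis.Analysis"
begin

section \<open>Complex Hilbert spaces\<close>

text \<open>
  The inner product is conjugate-linear in its first argument.  Norm, metric and topology are
  those of the underlying real inner product space, whose inner product is the real part of
  the complex one.
\<close>

class complex_inner = real_inner +
  fixes scaleC :: "complex \<Rightarrow> 'a \<Rightarrow> 'a"  (infixr \<open>*\<^sub>C\<close> 75)
    and cinner :: "'a \<Rightarrow> 'a \<Rightarrow> complex"
  assumes scaleC_add_right: "c *\<^sub>C (x + y) = c *\<^sub>C x + c *\<^sub>C y"
    and scaleC_add_left: "(c + d) *\<^sub>C x = c *\<^sub>C x + d *\<^sub>C x"
    and scaleC_scaleC: "c *\<^sub>C d *\<^sub>C x = (c * d) *\<^sub>C x"
    and scaleR_scaleC: "scaleR r x = complex_of_real r *\<^sub>C x"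
    and cinner_commute: "cinner x y = cnj (cinner y x)"
    and cinner_add_left: "cinner (x + y) z = cinner x z + cinner y z"
    and cinner_scaleC_left: "cinner (c *\<^sub>C x) y = cnj c * cinner x y"
    and inner_eq_Re_cinner: "inner x y = Re (cinner x y)"

class chilbert_space = complex_inner + complete_space

global_interpretation cvec: vector_space "scaleC :: complex \<Rightarrow> 'a \<Rightarrow> 'a::complex_inner"
  defines csubspace = cvec.subspace
    and cspan = cvec.span
    and cdim = cvec.dim
proof
  fix x :: 'a
  show "1 *\<^sub>C x = x"
    using scaleR_scaleC[of 1 x] by simp
qed (simp_all add: scaleC_add_right scaleC_add_left scaleC_scaleC)

abbreviation clinear :: "('a::complex_inner \<Rightarrow> 'b::complex_inner) \<Rightarrow> bool"
  where "clinear \<equiv> Vector_Spaces.linear scaleC scaleC"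

text \<open>Needed because \<^const>\<open>cdim\<close> is \<open>0\<close> on infinite-dimensional spaces.\<close>

definition cfinite_dim :: "'a::complex_inner set \<Rightarrow> bool"
  where "cfinite_dim V \<longleftrightarrow> (\<exists>B. finite B \<and> V \<subseteq> cspan B)"

lemma cinner_add_right: "cinner x (y + z) = cinner x y + cinner x (z :: 'a::complex_inner)"
  using cinner_commute[of x "y + z"] cinner_commute[of x y] cinner_commute[of x z]
  by (simp add: cinner_add_left)

lemma cinner_scaleC_right: "cinner x (c *\<^sub>C y) = c * cinner x (y :: 'a::complex_inner)"
  using cinner_commute[of x "c *\<^sub>C y"] cinner_commute[of x y]
  by (simp add: cinner_scaleC_left)

lemma cinner_self: "cinner x x = complex_of_real ((norm (x :: 'a::complex_inner))\<^sup>2)"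
proof -
  have "Im (cinner x x) = 0"
    using arg_cong[OF cinner_commute[of x x], of Im] by simp
  then show ?thesis
    by (simp add: complex_eq_iff inner_eq_Re_cinner[symmetric] power2_norm_eq_inner)
qed

lemma norm_scaleC: "norm (c *\<^sub>C x) = cmod c * norm (x :: 'a::complex_inner)"
proof -
  have "complex_of_real ((norm (c *\<^sub>C x))\<^sup>2) = complex_of_real ((cmod c * norm x)\<^sup>2)"
  proof -
    have "complex_of_real ((norm (c *\<^sub>C x))\<^sup>2) = (c * cnj c) * cinner x x"
      unfolding cinner_self[symmetric]
      by (simp add: cinner_scaleC_left cinner_scaleC_right mult_ac)
    also have "\<dots> = complex_of_real ((cmod c * norm x)\<^sup>2)"
      by (simp only: cinner_self power_mult_distrib of_real_mult complex_norm_square)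
    finally show ?thesis .
  qed
  then show ?thesis
    by (simp only: of_real_eq_iff power2_eq_iff_nonneg norm_ge_zero mult_nonneg_nonneg)
qed

lemma cmod_cinner_le: "cmod (cinner x y) \<le> norm x * norm (y :: 'a::complex_inner)"
proof (cases "cinner x y = 0")
  case False
  define c where "c = cnj (sgn (cinner x y))"
  have "cmod (cinner x y) = Re (cinner x (c *\<^sub>C y))"
  proof -
    have "cinner x (c *\<^sub>C y) = cnj (sgn (cinner x y)) * cinner x y"
      by (simp add: c_def cinner_scaleC_right)
    also have "\<dots> = complex_of_real (inverse (cmod (cinner x y)) * (cmod (cinner x y))\<^sup>2)"
      by (simp only: sgn_div_norm scaleR_conv_of_real complex_cnj_mult complex_cnj_complex_of_real
          of_real_mult complex_norm_square mult_ac)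
    also have "\<dots> = complex_of_real (cmod (cinner x y))"
      using False by (simp add: power2_eq_square)
    finally show ?thesis by simp
  qed
  also have "\<dots> = inner x (c *\<^sub>C y)"
    by (simp add: inner_eq_Re_cinner)
  also have "\<dots> \<le> norm x * norm (c *\<^sub>C y)"
    by (rule norm_cauchy_schwarz)
  also have "norm (c *\<^sub>C y) = norm y"
    using False by (simp add: norm_scaleC c_def norm_sgn)
  finally show ?thesis .
qed simp

instantiation complex :: chilbert_space
begin
definition "scaleC_complex (c::complex) (x::complex) = c * x"
definition "cinner_complex (x::complex) (y::complex) = cnj x * y"
instance
  by standard (simp_all add: scaleC_complex_def cinner_complex_def algebra_simps
      scaleR_conv_of_real inner_complex_def)
end

instantiation vec :: (complex_inner, finite) complex_inner
begin
definition "scaleC_vec c (x :: 'a ^ 'b) = (\<chi> i. c *\<^sub>C x $ i)"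
definition "cinner_vec (x :: 'a ^ 'b) y = (\<Sum>i\<in>UNIV. cinner (x $ i) (y $ i))"
instance
proof
  fix x y z :: "'a ^ 'b" and c :: complex
  show "cinner x y = cnj (cinner y x)"
    unfolding cinner_vec_def cnj_sum by (rule sum.cong[OF refl]) (rule cinner_commute)
qed (simp_all add: scaleC_vec_def cinner_vec_def vec_eq_iff scaleC_add_right scaleC_add_left
      scaleC_scaleC scaleR_scaleC cinner_add_left cinner_scaleC_left sum.distrib
      sum_distrib_left inner_vec_def inner_eq_Re_cinner)
end

instance vec :: (chilbert_space, finite) chilbert_space ..


section \<open>The space of square-summable sequences\<close>

typedef (overloaded) ('h::complex_inner) ell2 = "{x :: nat \<Rightarrow> 'h. summable (\<lambda>n. (norm (x n))\<^sup>2)}"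
  morphisms ell2_nth Abs_ell2
  by (rule exI[of _ "\<lambda>_. 0"]) simp

setup_lifting type_definition_ell2

lemma ell2_eqI: "(\<And>n. ell2_nth x n = ell2_nth y n) \<Longrightarrow> x = y"
  by (simp add: ell2_nth_inject[symmetric] fun_eq_iff)

lemma summable_ell2_add:
  fixes x y :: "nat \<Rightarrow> 'h::complex_inner"
  assumes "summable (\<lambda>n. (norm (x n))\<^sup>2)" "summable (\<lambda>n. (norm (y n))\<^sup>2)"
  shows "summable (\<lambda>n. (norm (x n + y n))\<^sup>2)"
proof (rule summable_comparison_test')
  show "summable (\<lambda>n. 2 * (norm (x n))\<^sup>2 + 2 * (norm (y n))\<^sup>2)"
    by (intro summable_add summable_mult assms)
next
  fix n
  have "(norm (x n + y n))\<^sup>2 \<le> (norm (x n) + norm (y n))\<^sup>2"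
    by (intro power_mono norm_triangle_ineq) simp
  also have "\<dots> \<le> 2 * (norm (x n))\<^sup>2 + 2 * (norm (y n))\<^sup>2"
    using zero_le_power2[of "norm (x n) - norm (y n)"]
    unfolding power2_diff power2_sum by linarith
  finally show "norm ((norm (x n + y n))\<^sup>2) \<le> 2 * (norm (x n))\<^sup>2 + 2 * (norm (y n))\<^sup>2"
    by simp
qed

lemma summable_ell2_cinner:
  fixes x y :: "nat \<Rightarrow> 'h::complex_inner"
  assumes "summable (\<lambda>n. (norm (x n))\<^sup>2)" "summable (\<lambda>n. (norm (y n))\<^sup>2)"
  shows "summable (\<lambda>n. cinner (x n) (y n))"
proof (rule summable_comparison_test')
  show "summable (\<lambda>n. (norm (x n))\<^sup>2 + (norm (y n))\<^sup>2)"
    by (intro summable_add assms)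
next
  fix n
  have "cmod (cinner (x n) (y n)) \<le> norm (x n) * norm (y n)"
    by (rule cmod_cinner_le)
  also have "\<dots> \<le> (norm (x n))\<^sup>2 + (norm (y n))\<^sup>2"
    using zero_le_power2[of "norm (x n) - norm (y n)"] zero_le_power2[of "norm (x n)"]
      zero_le_power2[of "norm (y n)"]
    unfolding power2_diff by linarith
  finally show "norm (cinner (x n) (y n)) \<le> (norm (x n))\<^sup>2 + (norm (y n))\<^sup>2" .
qed

lemma summable_ell2_scaleC:
  fixes x :: "nat \<Rightarrow> 'h::complex_inner"
  assumes "summable (\<lambda>n. (norm (x n))\<^sup>2)"
  shows "summable (\<lambda>n. (norm (c *\<^sub>C x n))\<^sup>2)"
  by (simp add: norm_scaleC power_mult_distrib summable_mult assms)

instantiation ell2 :: (complex_inner) complex_inner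
begin

lift_definition zero_ell2 :: "'a ell2" is "\<lambda>_. 0" by simp

lift_definition plus_ell2 :: "'a ell2 \<Rightarrow> 'a ell2 \<Rightarrow> 'a ell2" is "\<lambda>x y n. x n + y n"
  by (rule summable_ell2_add)

lift_definition uminus_ell2 :: "'a ell2 \<Rightarrow> 'a ell2" is "\<lambda>x n. - x n" by simp

lift_definition minus_ell2 :: "'a ell2 \<Rightarrow> 'a ell2 \<Rightarrow> 'a ell2" is "\<lambda>x y n. x n - y n"
  using summable_ell2_add[of x "\<lambda>n. - y n" for x y] by simp

lift_definition scaleR_ell2 :: "real \<Rightarrow> 'a ell2 \<Rightarrow> 'a ell2" is "\<lambda>r x n. r *\<^sub>R x n"
  by (simp add: power_mult_distrib summable_mult)

lift_definition scaleC_ell2 :: "complex \<Rightarrow> 'a ell2 \<Rightarrow> 'a ell2" is "\<lambda>c x n. c *\<^sub>C x n"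
  by (rule summable_ell2_scaleC)

definition cinner_ell2 :: "'a ell2 \<Rightarrow> 'a ell2 \<Rightarrow> complex"
  where "cinner_ell2 x y = (\<Sum>n. cinner (ell2_nth x n) (ell2_nth y n))"

definition inner_ell2 :: "'a ell2 \<Rightarrow> 'a ell2 \<Rightarrow> real"
  where "inner_ell2 x y = Re (cinner x y)"

definition norm_ell2 :: "'a ell2 \<Rightarrow> real"
  where "norm_ell2 x = sqrt (inner x x)"

definition dist_ell2 :: "'a ell2 \<Rightarrow> 'a ell2 \<Rightarrow> real"
  where "dist_ell2 x y = norm (x - y)"

definition sgn_ell2 :: "'a ell2 \<Rightarrow> 'a ell2"
  where "sgn_ell2 x = scaleR (inverse (norm x)) x"

definition uniformity_ell2 :: "('a ell2 \<times> 'a ell2) filter"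
  where "uniformity_ell2 = (INF e\<in>{0<..}. principal {(x, y). dist x y < e})"

definition open_ell2 :: "'a ell2 set \<Rightarrow> bool"
  where "open_ell2 U = (\<forall>x\<in>U. \<forall>\<^sub>F (x', y) in uniformity. x' = x \<longrightarrow> y \<in> U)"

lemma ell2_summable: "summable (\<lambda>n. (norm (ell2_nth (x :: 'a ell2) n))\<^sup>2)"
  using ell2_nth[of x] by simp

lemma ell2_inner_sums:
  "(\<lambda>n. inner (ell2_nth x n) (ell2_nth y n)) sums inner (x :: 'a ell2) y"
  unfolding inner_ell2_def cinner_ell2_def inner_eq_Re_cinner
  by (intro sums_Re summable_sums summable_ell2_cinner ell2_summable)

lemma ell2_inner_self: "inner x (x :: 'a ell2) = (\<Sum>n. (norm (ell2_nth x n))\<^sup>2)"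
  using sums_unique[OF ell2_inner_sums[of x x]] by (simp add: power2_norm_eq_inner)

instance
proof
  fix x y z :: "'a ell2" and c d :: complex and r s :: real
  show "x + y + z = x + (y + z)" by transfer (simp add: add.assoc)
  show "x + y = y + x" by transfer (simp add: add.commute)
  show "0 + x = x" by transfer simp
  show "- x + x = 0" by transfer simp
  show "x - y = x + - y" by transfer simp
  show "r *\<^sub>R (x + y) = r *\<^sub>R x + r *\<^sub>R y" by transfer (simp add: scaleR_add_right)
  show "(r + s) *\<^sub>R x = r *\<^sub>R x + s *\<^sub>R x" by transfer (simp add: scaleR_add_left)
  show "r *\<^sub>R s *\<^sub>R x = (r * s) *\<^sub>R x" by transfer simp
  show "1 *\<^sub>R x = x" by transfer simp
  show "sgn x = scaleR (inverse (norm x)) x" by (rule sgn_ell2_def)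
  show "dist x y = norm (x - y)" by (rule dist_ell2_def)
  show "(uniformity :: ('a ell2 \<times> 'a ell2) filter)
      = (INF e\<in>{0<..}. principal {(x, y). dist x y < e})" by (rule uniformity_ell2_def)
  show "open U = (\<forall>x\<in>U. \<forall>\<^sub>F (x', y) in uniformity. x' = x \<longrightarrow> y \<in> U)" for U :: "'a ell2 set"
    by (rule open_ell2_def)
  show "norm x = sqrt (inner x x)" by (rule norm_ell2_def)
  show "c *\<^sub>C (x + y) = c *\<^sub>C x + c *\<^sub>C y" by transfer (simp add: scaleC_add_right)
  show "(c + d) *\<^sub>C x = c *\<^sub>C x + d *\<^sub>C x" by transfer (simp add: scaleC_add_left)
  show "c *\<^sub>C d *\<^sub>C x = (c * d) *\<^sub>C x" by transfer (simp add: scaleC_scaleC)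
  show "r *\<^sub>R x = complex_of_real r *\<^sub>C x" by transfer (simp add: scaleR_scaleC)
  note sm = summable_ell2_cinner[OF ell2_summable ell2_summable]
  show com: "cinner x y = cnj (cinner y x)" for x y :: "'a ell2"
  proof -
    have "(\<lambda>n. cnj (cinner (ell2_nth y n) (ell2_nth x n))) sums cnj (cinner y x)"
      unfolding cinner_ell2_def sums_cnj by (rule summable_sums[OF sm])
    then show ?thesis
      unfolding cinner_commute[of "ell2_nth x n" for n, symmetric]
      by (simp add: cinner_ell2_def sums_iff)
  qed
  show add: "cinner (x + y) z = cinner x z + cinner y z"
    unfolding cinner_ell2_def plus_ell2.rep_eq cinner_add_left
    by (rule suminf_add[symmetric]) (rule sm)+
  show scal: "cinner (c *\<^sub>C x) y = cnj c * cinner x y" for c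
    unfolding cinner_ell2_def scaleC_ell2.rep_eq cinner_scaleC_left
    by (rule suminf_mult) (rule sm)
  show "inner x y = Re (cinner x y)" by (rule inner_ell2_def)
  show "inner x y = inner y x"
    unfolding inner_ell2_def by (subst com) simp
  show "inner (x + y) z = inner x z + inner y z"
    unfolding inner_ell2_def by (simp add: add)
  show "inner (r *\<^sub>R x) y = r * inner x y"
  proof -
    have "r *\<^sub>R x = complex_of_real r *\<^sub>C x" by transfer (simp add: scaleR_scaleC)
    then show ?thesis unfolding inner_ell2_def by (simp add: scal)
  qed
  show "0 \<le> inner x x"
    unfolding ell2_inner_self by (intro suminf_nonneg ell2_summable) simp
  show "inner x x = 0 \<longleftrightarrow> x = 0"
    unfolding ell2_inner_self
    by (subst suminf_eq_zero_iff[OF ell2_summable])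
      (auto simp: zero_ell2.rep_eq intro: ell2_eqI)
qed

end

lemma ell2_norm_square: "(norm x)\<^sup>2 = (\<Sum>n. (norm (ell2_nth x n))\<^sup>2)"
  by (simp add: power2_norm_eq_inner ell2_inner_self)

lemma ell2_sum_le: "(\<Sum>n<m. (norm (ell2_nth x n))\<^sup>2) \<le> (norm x)\<^sup>2"
  unfolding ell2_norm_square by (rule sum_le_suminf[OF ell2_summable]) auto

lemma ell2_nth_le: "norm (ell2_nth x n) \<le> norm x"
proof -
  have "(norm (ell2_nth x n))\<^sup>2 \<le> (\<Sum>k<Suc n. (norm (ell2_nth x k))\<^sup>2)"
    by (simp add: sum_nonneg)
  also have "\<dots> \<le> (norm x)\<^sup>2" by (rule ell2_sum_le)
  finally show ?thesis by (rule power2_le_imp_le) simp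
qed

instance ell2 :: (chilbert_space) chilbert_space
proof
  fix X :: "nat \<Rightarrow> 'a ell2"
  assume X: "Cauchy X"
  have "Cauchy (\<lambda>i. ell2_nth (X i) n)" for n
  proof (rule CauchyI)
    fix e :: real assume "0 < e"
    then obtain M where M: "\<And>i j. i \<ge> M \<Longrightarrow> j \<ge> M \<Longrightarrow> norm (X i - X j) < e"
      using CauchyD[OF X] by blast
    have "norm (ell2_nth (X i) n - ell2_nth (X j) n) < e" if "i \<ge> M" "j \<ge> M" for i j
      using ell2_nth_le[of "X i - X j" n] M[OF that] by (simp add: minus_ell2.rep_eq)
    then show "\<exists>M. \<forall>i\<ge>M. \<forall>j\<ge>M. norm (ell2_nth (X i) n - ell2_nth (X j) n) < e" by blast
  qed
  then have "\<exists>l. \<forall>n. (\<lambda>i. ell2_nth (X i) n) \<longlonglongrightarrow> l n"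
    by (intro choice allI) (simp add: Cauchy_convergent_iff convergent_def)
  then obtain l where l: "\<And>n. (\<lambda>i. ell2_nth (X i) n) \<longlonglongrightarrow> l n" by blast
  have tail: "(\<Sum>n<m. (norm (ell2_nth (X i) n - l n))\<^sup>2) \<le> e\<^sup>2"
    if M: "\<And>i j. i \<ge> M \<Longrightarrow> j \<ge> M \<Longrightarrow> norm (X i - X j) < e" and i: "i \<ge> M" for e M i m
  proof (rule LIMSEQ_le_const2)
    show "(\<lambda>j. \<Sum>n<m. (norm (ell2_nth (X i) n - ell2_nth (X j) n))\<^sup>2)
        \<longlonglongrightarrow> (\<Sum>n<m. (norm (ell2_nth (X i) n - l n))\<^sup>2)"
      by (intro tendsto_intros l)
    have "(\<Sum>n<m. (norm (ell2_nth (X i) n - ell2_nth (X j) n))\<^sup>2) \<le> e\<^sup>2" if "j \<ge> M" for j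
    proof -
      have "(\<Sum>n<m. (norm (ell2_nth (X i) n - ell2_nth (X j) n))\<^sup>2) \<le> (norm (X i - X j))\<^sup>2"
        using ell2_sum_le[of "X i - X j" m] by (simp add: minus_ell2.rep_eq)
      also have "\<dots> \<le> e\<^sup>2"
        using M[OF i that] by (intro power_mono) auto
      finally show ?thesis .
    qed
    then show "\<exists>N. \<forall>j\<ge>N. (\<Sum>n<m. (norm (ell2_nth (X i) n - ell2_nth (X j) n))\<^sup>2) \<le> e\<^sup>2"
      by blast
  qed
  have tail': "summable (\<lambda>n. (norm (ell2_nth (X i) n - l n))\<^sup>2)"
      "(\<Sum>n. (norm (ell2_nth (X i) n - l n))\<^sup>2) \<le> e\<^sup>2"
    if M: "\<And>i j. i \<ge> M \<Longrightarrow> j \<ge> M \<Longrightarrow> norm (X i - X j) < e" and i: "i \<ge> M" for e M i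
  proof -
    show *: "summable (\<lambda>n. (norm (ell2_nth (X i) n - l n))\<^sup>2)"
      by (rule summableI_nonneg_bounded[OF _ tail[OF that]]) auto
    show "(\<Sum>n. (norm (ell2_nth (X i) n - l n))\<^sup>2) \<le> e\<^sup>2"
      by (rule suminf_le_const[OF * tail[OF that]])
  qed
  obtain M0 where M0: "\<And>i j. i \<ge> M0 \<Longrightarrow> j \<ge> M0 \<Longrightarrow> norm (X i - X j) < 1"
    using CauchyD[OF X, of 1] by auto
  have "summable (\<lambda>n. (norm (ell2_nth (X M0) n + - (ell2_nth (X M0) n - l n)))\<^sup>2)"
    using tail'(1)[OF M0, of M0]
    by (intro summable_ell2_add ell2_summable) (simp_all only: norm_minus_cancel order_refl)
  then have ls: "summable (\<lambda>n. (norm (l n))\<^sup>2)" by simp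
  define L where "L = Abs_ell2 l"
  have L: "ell2_nth L = l"
    unfolding L_def by (rule Abs_ell2_inverse) (simp add: ls)
  have "X \<longlonglongrightarrow> L"
  proof (rule LIMSEQ_I)
    fix r :: real assume r: "0 < r"
    then obtain M where M: "\<And>i j. i \<ge> M \<Longrightarrow> j \<ge> M \<Longrightarrow> norm (X i - X j) < r / 2"
      using CauchyD[OF X, of "r / 2"] by auto
    have "norm (X i - L) < r" if "i \<ge> M" for i
    proof -
      have "(norm (X i - L))\<^sup>2 \<le> (r / 2)\<^sup>2"
        using tail'(2)[OF M that] by (simp add: ell2_norm_square minus_ell2.rep_eq L)
      then have "norm (X i - L) \<le> r / 2"
        by (rule power2_le_imp_le) (use r in simp)
      then show ?thesis using r by simp
    qed
    then show "\<exists>M. \<forall>i\<ge>M. norm (X i - L) < r" by blast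
  qed
  then show "convergent X" by (auto simp: convergent_def)
qed


section \<open>Operators\<close>

text \<open>
  A possibly unbounded operator is given by its domain \<open>D\<close> and a function \<open>T\<close>, of which only
  the values on \<open>D\<close> matter; an everywhere defined operator has domain \<^term>\<open>UNIV\<close>.
\<close>

definition adjoint_graph ::
    "'a::complex_inner set \<Rightarrow> ('a \<Rightarrow> 'a) \<Rightarrow> ('a \<times> 'a) set"
  where "adjoint_graph D T = {(y, z). \<forall>x\<in>D. cinner y (T x) = cinner z x}"

definition selfadjoint :: "'a::complex_inner set \<Rightarrow> ('a \<Rightarrow> 'a) \<Rightarrow> bool"
  where "selfadjoint D T \<longleftrightarrow>
    csubspace D \<and> closure D = UNIV \<and>
    (\<forall>x\<in>D. \<forall>y\<in>D. T (x + y) = T x + T y) \<and> (\<forall>c. \<forall>x\<in>D. T (c *\<^sub>C x) = c *\<^sub>C T x) \<and>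
    adjoint_graph D T = (\<lambda>x. (x, T x)) ` D"

definition bounded_from_below :: "'a::complex_inner set \<Rightarrow> ('a \<Rightarrow> 'a) \<Rightarrow> bool"
  where "bounded_from_below D T \<longleftrightarrow> (\<exists>c::real. \<forall>x\<in>D. c * (norm x)\<^sup>2 \<le> Re (cinner x (T x)))"

definition bounded_clinear :: "('a::complex_inner \<Rightarrow> 'b::complex_inner) \<Rightarrow> bool"
  where "bounded_clinear A \<longleftrightarrow> clinear A \<and> (\<exists>K. \<forall>x. norm (A x) \<le> K * norm x)"

definition finite_rank :: "('a::complex_inner \<Rightarrow> 'b::complex_inner) \<Rightarrow> bool"
  where "finite_rank A \<longleftrightarrow> cfinite_dim (range A)"

definition unitarily_equivalent ::
    "('a::complex_inner \<Rightarrow> 'a) \<Rightarrow> ('b::complex_inner \<Rightarrow> 'b) \<Rightarrow> bool"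
  where "unitarily_equivalent A B \<longleftrightarrow>
    (\<exists>U. clinear U \<and> bij U \<and> (\<forall>x y. cinner (U x) (U y) = cinner x y) \<and> (\<forall>x. U (A x) = B (U x)))"


subsection \<open>Spectrum\<close>

definition resolvent_set :: "'a::complex_inner set \<Rightarrow> ('a \<Rightarrow> 'a) \<Rightarrow> complex set"
  where "resolvent_set D T = {z. \<exists>R. bounded_clinear R \<and>
    (\<forall>y. R y \<in> D \<and> T (R y) - z *\<^sub>C R y = y) \<and> (\<forall>x\<in>D. R (T x - z *\<^sub>C x) = x)}"

definition spectrum :: "'a::complex_inner set \<Rightarrow> ('a \<Rightarrow> 'a) \<Rightarrow> complex set"
  where "spectrum D T = - resolvent_set D T"

definition eigenspace :: "'a::complex_inner set \<Rightarrow> ('a \<Rightarrow> 'a) \<Rightarrow> complex \<Rightarrow> 'a set"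
  where "eigenspace D T z = {x\<in>D. T x = z *\<^sub>C x}"

definition discrete_spectrum :: "'a::complex_inner set \<Rightarrow> ('a \<Rightarrow> 'a) \<Rightarrow> complex set"
  where "discrete_spectrum D T = {z. z isolated_in spectrum D T \<and>
    eigenspace D T z \<noteq> {0} \<and> cfinite_dim (eigenspace D T z)}"

definition essential_spectrum :: "'a::complex_inner set \<Rightarrow> ('a \<Rightarrow> 'a) \<Rightarrow> complex set"
  where "essential_spectrum D T = spectrum D T - discrete_spectrum D T"

definition purely_discrete_spectrum :: "'a::complex_inner set \<Rightarrow> ('a \<Rightarrow> 'a) \<Rightarrow> bool"
  where "purely_discrete_spectrum D T \<longleftrightarrow> essential_spectrum D T = {}"


subsection \<open>Spectral projections\<close>

definition orth_projection :: "('a::complex_inner \<Rightarrow> 'a) \<Rightarrow> bool"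
  where "orth_projection P \<longleftrightarrow>
    clinear P \<and> (\<forall>x. P (P x) = P x) \<and> (\<forall>x y. cinner (P x) y = cinner x (P y))"

definition projection_valued_measure :: "(real set \<Rightarrow> 'a::complex_inner \<Rightarrow> 'a) \<Rightarrow> bool"
  where "projection_valued_measure E \<longleftrightarrow>
    (\<forall>\<Omega>\<in>sets borel. orth_projection (E \<Omega>)) \<and> E UNIV = id \<and>
    (\<forall>A :: nat \<Rightarrow> real set. range A \<subseteq> sets borel \<longrightarrow> disjoint_family A \<longrightarrow>
      (\<forall>x. (\<lambda>n. E (A n) x) sums E (\<Union>n. A n) x))"

text \<open>The scalar measure \<open>\<Omega> \<mapsto> \<langle>x, E(\<Omega>) x\<rangle>\<close>.\<close>

definition scalar_measure ::
    "(real set \<Rightarrow> 'a::complex_inner \<Rightarrow> 'a) \<Rightarrow> 'a \<Rightarrow> real measure"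
  where "scalar_measure E x = measure_of UNIV (sets borel) (\<lambda>\<Omega>. ennreal (Re (cinner x (E \<Omega> x))))"

text \<open>
  \<open>T = \<integral> t dE(t)\<close>, domain included.  The quadratic form determines \<open>T\<close> by polarization.
\<close>

definition is_spectral_measure ::
    "'a::complex_inner set \<Rightarrow> ('a \<Rightarrow> 'a) \<Rightarrow> (real set \<Rightarrow> 'a \<Rightarrow> 'a) \<Rightarrow> bool"
  where "is_spectral_measure D T E \<longleftrightarrow>
    projection_valued_measure E \<and>
    D = {x. integrable (scalar_measure E x) (\<lambda>t. t\<^sup>2)} \<and>
    (\<forall>x\<in>D. cinner x (T x) = complex_of_real (\<integral>t. t \<partial>scalar_measure E x))"

text \<open>
  By the spectral theorem the description is proper when \<open>T\<close> is self-adjoint and \<open>\<Omega>\<close> is Borel: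
  the spectral measure exists and is unique on Borel sets.
\<close>

definition spectral_projection ::
    "'a::complex_inner set \<Rightarrow> ('a \<Rightarrow> 'a) \<Rightarrow> real set \<Rightarrow> 'a \<Rightarrow> 'a"
  where "spectral_projection D T \<Omega> = (THE P. \<exists>E. is_spectral_measure D T E \<and> P = E \<Omega>)"


subsection \<open>Block-Hankel operators\<close>

text \<open>The order of the block-Hankel operator is \<open>CARD('n)\<close>.\<close>

definition block_hankel :: "((complex ^ 'n::finite) ell2 \<Rightarrow> (complex ^ 'n) ell2) \<Rightarrow> bool"
  where "block_hankel \<Gamma> \<longleftrightarrow> bounded_clinear \<Gamma> \<and> selfadjoint UNIV \<Gamma> \<and>
    (\<exists>a :: nat \<Rightarrow> complex ^ 'n ^ 'n.
      \<forall>x j. (\<lambda>k. a (j + k) *v ell2_nth x k) sums ell2_nth (\<Gamma> x) j)"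

end

(*
  Both T and T + S have a basis of eigenvectors with finitely many eigenvalues below each level,
  so the operator is a difference P - Q of finite rank projections.  As 1 - P - Q anticommutes
  with P - Q and (P - Q)^2 + (1 - P - Q)^2 = 1, its eigenvalues in (0, 1) and (-1, 0) pair off
  with equal multiplicities, and by comparing quadratic forms on the kernel of S, the eigenvalues 1
  and -1 have multiplicity at most N.

  Given a self-adjoint J on a finite-dimensional space R, a contraction A on R with
  1 - A* A = C* C, C of rank at most N, A J = J A* and no unimodular eigenvalue, the map
  V x = (C A^j x)_j is isometric and V J V* is the block-Hankel operator with entries
  C A^(j+k) J C*.  Its restriction to the range of V is J.  Writing A = K J^{-1}, one needs a
  self-adjoint K with J^2 - K^2 = C'* C' for some C' of rank at most N such that no nonzero
  subspace of the kernel of C' is invariant under J and K.  On a space spanned by chains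
  e_0, ..., e_{m-1} with J e_j = s e_{m-1-j}, take K e_j = s e_{m-j} for j > 0, and
  on the span of the heads e_0 take for K the square root of a small rank-N perturbation of J^2.
*)

theory Submission
  imports Defs
begin

section \<open>Complex inner product spaces\<close>

text \<open>Two obstacles shape the proof. Discreteness is given through the spectrum of
  \<open>T\<close> alone and has to reach T + S without a spectral theorem. It is turned into a
  bound on the quadratic form off finitely many vectors, which a finite rank symmetric term cannot
  disturb. The key fact is that an isolated spectral point without eigenvectors in a reducing
  subspace cannot be the bottom of the form there. The other obstacle is that only N output channels
  are available, while eigenvalues of P - Q inside (-1, 1) may have any finite multiplicity. A chain
  of length 2k carries s and -s with multiplicity k each but needs one channel, because K J^{-1}
  shifts along it and \<open>C'\<close> sees only the heads. Eigenvectors for 1 and -1 have no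
  partner, so each is a chain of its own; this is where the bound N on their number is used. Chains
  that share a channel are told apart by their scales through a Vandermonde argument, and the
  perturbation of J^2 is small so that its square root exists.\<close>

lemma cinner_zero_left [simp]: "cinner 0 y = 0"
  using cinner_add_left[of 0 0 y] by simp

lemma cinner_zero_right [simp]: "cinner y 0 = 0"
  using cinner_add_right[of y 0 0] by simp

lemma cinner_minus_right: "cinner x (- y) = - cinner x y"
  by (rule minus_unique[symmetric]) (simp flip: cinner_add_right)

lemma cinner_diff_left: "cinner (x - y) z = cinner x z - cinner y z"
  using cinner_add_left[of "x - y" y z] by simp

lemma cinner_diff_right: "cinner x (y - z) = cinner x y - cinner x z"
  using cinner_add_right[of x "y - z" z] by simp

lemma cnj_cinner: "cnj (cinner x y) = cinner y x"
  by (rule cinner_commute[symmetric])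

lemma scaleC_zero_left [simp]: "0 *\<^sub>C x = 0"
  by (rule cvec.scale_zero_left)

lemma scaleC_zero_right [simp]: "c *\<^sub>C 0 = 0"
  by (rule cvec.scale_zero_right)

lemma scaleC_one [simp]: "1 *\<^sub>C x = x"
  by (rule cvec.scale_one)

lemma scaleC_eq_0_iff: "c *\<^sub>C x = 0 \<longleftrightarrow> c = 0 \<or> x = 0"
  by (rule cvec.scale_eq_0_iff)

lemma cinner_self_eq_0_iff: "cinner x x = 0 \<longleftrightarrow> x = 0"
  by (simp add: cinner_self)

lemma Re_cinner_commute: "Re (cinner x y) = Re (cinner y x)"
  by (subst cinner_commute) simp

lemma norm_add_cinner: "(norm (x + y))\<^sup>2 = (norm x)\<^sup>2 + 2 * Re (cinner x y) + (norm y)\<^sup>2"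
  by (simp add: power2_norm_eq_inner inner_eq_Re_cinner cinner_add_left cinner_add_right
      Re_cinner_commute[of y x])

lemma norm_diff_cinner: "(norm (x - y))\<^sup>2 = (norm x)\<^sup>2 - 2 * Re (cinner x y) + (norm y)\<^sup>2"
  by (simp add: power2_norm_eq_inner inner_eq_Re_cinner cinner_diff_left cinner_diff_right
      Re_cinner_commute[of y x])

lemma Re_cinner_self: "Re (cinner x x) = (norm x)\<^sup>2"
  by (simp add: cinner_self)

lemma cinner_sum_left: "cinner (\<Sum>i\<in>I. f i) y = (\<Sum>i\<in>I. cinner (f i) (y :: 'a::complex_inner))"
  by (induction I rule: infinite_finite_induct) (simp_all add: cinner_add_left)

lemma cinner_sum_right: "cinner y (\<Sum>i\<in>I. f i) = (\<Sum>i\<in>I. cinner (y :: 'a::complex_inner) (f i))"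
  by (induction I rule: infinite_finite_induct) (simp_all add: cinner_add_right)

lemma cinner_ext:
  fixes x y :: "'a::complex_inner"
  assumes "\<And>z. cinner z x = cinner z y"
  shows "x = y"
proof -
  have "cinner (x - y) (x - y) = 0"
    using assms[of "x - y"] by (simp add: cinner_diff_right)
  then show ?thesis
    by (simp add: cinner_self_eq_0_iff)
qed

lemma bounded_bilinear_cinner: "bounded_bilinear (cinner :: 'a::complex_inner \<Rightarrow> 'a \<Rightarrow> complex)"
proof
  show "\<exists>K. \<forall>a b::'a. norm (cinner a b) \<le> norm a * norm b * K"
    by (rule exI[of _ 1]) (simp add: cmod_cinner_le)
qed (simp_all add: cinner_add_left cinner_add_right scaleR_scaleC cinner_scaleC_left
    cinner_scaleC_right scaleC_complex_def)

lemmas tendsto_cinner [tendsto_intros] = bounded_bilinear.tendsto[OF bounded_bilinear_cinner]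
lemmas cinner_sums_right = bounded_linear.sums[OF
    bounded_bilinear.bounded_linear_right[OF bounded_bilinear_cinner]]
lemma bounded_bilinear_scaleC:
  "bounded_bilinear (scaleC :: complex \<Rightarrow> 'a::complex_inner \<Rightarrow> 'a)"
proof
  show "\<exists>K. \<forall>a (b::'a). norm (a *\<^sub>C b) \<le> norm a * norm b * K"
    by (rule exI[of _ 1]) (simp add: norm_scaleC)
qed (simp_all add: scaleC_add_left scaleC_add_right scaleR_scaleC scaleC_scaleC
    scaleC_complex_def mult.commute)

lemmas tendsto_scaleC [tendsto_intros] = bounded_bilinear.tendsto[OF bounded_bilinear_scaleC]

section \<open>Subspaces, linear maps and everywhere defined symmetric operators\<close>

lemma csubspaceD:
  assumes "csubspace W"
  shows "0 \<in> W" "\<And>x y. x \<in> W \<Longrightarrow> y \<in> W \<Longrightarrow> x + y \<in> W"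
    "\<And>x y. x \<in> W \<Longrightarrow> y \<in> W \<Longrightarrow> x - y \<in> W" "\<And>c x. x \<in> W \<Longrightarrow> c *\<^sub>C x \<in> W"
    "\<And>r x. x \<in> W \<Longrightarrow> r *\<^sub>R x \<in> W"
  using cvec.subspace_0[OF assms] cvec.subspace_add[OF assms] cvec.subspace_diff[OF assms]
    cvec.subspace_scale[OF assms] by (auto simp: scaleR_scaleC)

lemma clinearI:
  assumes "\<And>x y. f (x + y) = f x + f y" "\<And>c x. f (c *\<^sub>C x) = c *\<^sub>C f x"
  shows "clinear f"
  by unfold_locales (use assms in auto)

lemma clinearD:
  assumes "clinear f"
  shows "f (x + y) = f x + f y" "f (c *\<^sub>C x) = c *\<^sub>C f x" "f 0 = 0" "f (x - y) = f x - f y"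
    "f (- x) = - f x" "f (sum g I) = (\<Sum>i\<in>I. f (g i))" "f (r *\<^sub>R x) = r *\<^sub>R f x"
proof -
  interpret Vector_Spaces.linear scaleC scaleC f by (rule assms)
  show "f (x + y) = f x + f y" "f (c *\<^sub>C x) = c *\<^sub>C f x" "f 0 = 0" "f (x - y) = f x - f y"
    "f (- x) = - f x" "f (sum g I) = (\<Sum>i\<in>I. f (g i))" "f (r *\<^sub>R x) = r *\<^sub>R f x"
    by (simp_all add: add scale diff neg sum zero scaleR_scaleC)
qed

lemma bounded_clinear_bounded_linear:
  assumes "bounded_clinear A"
  shows "bounded_linear A"
proof -
  obtain K where K: "\<And>x. norm (A x) \<le> K * norm x" and A: "clinear A"
    using assms by (auto simp: bounded_clinear_def)
  show ?thesis
    by (rule bounded_linear_intro[where K = K])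
      (simp_all add: clinearD[OF A] K mult.commute[of _ K])
qed

definition csym :: "('a::complex_inner \<Rightarrow> 'a) \<Rightarrow> bool"
  where "csym A \<longleftrightarrow> (\<forall>x y. cinner (A x) y = cinner x (A y))"

lemma csymD: "csym A \<Longrightarrow> cinner (A x) y = cinner x (A y)"
  by (simp add: csym_def)

text \<open>Testing against any vector moves \<open>A\<close> off its argument, where additivity and
  homogeneity are those of \<open>cinner\<close>. Symmetry is then the one property to check for
  operators built later.\<close>

lemma csym_clinear:
  assumes "csym A"
  shows "clinear A"
  by (rule clinearI; rule cinner_ext)
    (simp_all add: csymD[OF assms, symmetric] cinner_add_right cinner_scaleC_right)

lemma selfadjoint_UNIV_iff: "selfadjoint UNIV A \<longleftrightarrow> csym A"
proof
  assume "selfadjoint UNIV A"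
  then have g: "adjoint_graph UNIV A = (\<lambda>x. (x, A x)) ` UNIV"
    by (simp add: selfadjoint_def)
  show "csym A"
    unfolding csym_def
  proof (intro allI)
    fix x y
    have "(x, A x) \<in> adjoint_graph UNIV A" by (simp add: g)
    then show "cinner (A x) y = cinner x (A y)" by (simp add: adjoint_graph_def)
  qed
next
  assume s: "csym A"
  have "z = A y" if "\<forall>x. cinner y (A x) = cinner z x" for y z
  proof (rule cinner_ext)
    fix x
    have "cinner z x = cinner (A y) x" using that s by (simp add: csym_def)
    then show "cinner x z = cinner x (A y)" using cnj_cinner by metis
  qed
  then have "adjoint_graph UNIV A = (\<lambda>x. (x, A x)) ` UNIV"
    using s by (auto simp: adjoint_graph_def csym_def)
  then show "selfadjoint UNIV A"
    using clinearD[OF csym_clinear[OF s]] by (simp add: selfadjoint_def cvec.subspace_UNIV)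
qed


section \<open>Orthogonal projection onto a closed subspace\<close>

lemma parallelogram:
  "(norm (x - y))\<^sup>2 = 2 * (norm x)\<^sup>2 + 2 * (norm y)\<^sup>2 - (norm (x + y :: 'a::complex_inner))\<^sup>2"
  by (simp add: norm_add_cinner norm_diff_cinner)

text \<open>Subtracting the multiple of \<open>y\<close> with the projection coefficient c = <y, r>
  / |y|^2 lowers the squared norm by |c|^2 |y|^2, so minimality forces c = 0.\<close>

lemma minimal_vector_orthogonal:
  fixes r y :: "'a::complex_inner"
  assumes "\<And>c. norm r \<le> norm (r - c *\<^sub>C y)"
  shows "cinner y r = 0"
proof (cases "y = 0")
  case False
  define c where "c = cinner y r / (norm y)\<^sup>2"
  have c: "cinner y r = (norm y)\<^sup>2 * c" using False by (simp add: c_def)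
  have "(norm r)\<^sup>2 \<le> (norm (r - c *\<^sub>C y))\<^sup>2"
    by (rule power_mono[OF assms]) simp
  also have "\<dots> = (norm r)\<^sup>2 - 2 * Re (cnj (cinner y r) * c) + (cmod c * norm y)\<^sup>2"
    by (simp add: norm_diff_cinner cinner_scaleC_right norm_scaleC cnj_cinner mult.commute)
  also have "Re (cnj (cinner y r) * c) = (norm y)\<^sup>2 * (cmod c)\<^sup>2"
    unfolding c cmod_power2 by (simp add: power2_eq_square algebra_simps)
  finally have "(norm y)\<^sup>2 * (cmod c)\<^sup>2 \<le> 0"
    by (simp add: power_mult_distrib mult.commute)
  then have "c = 0" using False
    by (simp add: mult_le_0_iff)
  then show ?thesis by (simp add: c)
qed simp

text \<open>The projection theorem: a minimising sequence for the distance from \<open>x\<close> to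
  \<open>L\<close> is Cauchy by the parallelogram law, and minimality makes the residual at its
  limit orthogonal to \<open>L\<close>.\<close>

lemma orthogonal_decomposition:
  fixes L :: "'a::chilbert_space set"
  assumes L: "csubspace L" and cl: "closed L"
  obtains p where "p \<in> L" "\<And>y. y \<in> L \<Longrightarrow> cinner y (x - p) = 0"
proof -
  define d where "d = (INF y\<in>L. (norm (x - y))\<^sup>2)"
  have bdd: "bdd_below ((\<lambda>y. (norm (x - y))\<^sup>2) ` L)"
    by (rule bdd_belowI[of _ 0]) auto
  have ne: "L \<noteq> {}" using csubspaceD(1)[OF L] by auto
  have d_le: "d \<le> (norm (x - y))\<^sup>2" if "y \<in> L" for y
    unfolding d_def by (rule cINF_lower[OF bdd that])
  have "\<exists>y\<in>L. (norm (x - y))\<^sup>2 < d + 1 / Suc n" for n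
    using cINF_less_iff[OF ne bdd, of "d + 1 / Suc n"] by (simp add: d_def)
  then obtain p where pL: "\<And>n. p n \<in> L" and p: "\<And>n. (norm (x - p n))\<^sup>2 < d + 1 / Suc n"
    by metis
  have dist: "(norm (p n - p m))\<^sup>2 \<le> 2 / Suc n + 2 / Suc m" for n m
  proof -
    \<comment> \<open>The midpoint of two members of the sequence lies in \<open>L\<close>, which
      bounds |2x - p n - p m| from below and hence |p n - p m| from above.\<close>
    have "d \<le> (norm (x - (1/2) *\<^sub>R (p n + p m)))\<^sup>2"
      by (intro d_le csubspaceD[OF L] pL)
    also have "\<dots> = (norm ((1/2) *\<^sub>R ((x - p n) + (x - p m))))\<^sup>2"
      by (simp add: algebra_simps scaleR_2[symmetric] flip: scaleR_add_left)
    also have "\<dots> = (norm ((x - p n) + (x - p m)))\<^sup>2 / 4"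
      by (simp only: norm_scaleR power_mult_distrib) (simp add: power2_eq_square)
    finally have "4 * d \<le> (norm ((x - p n) + (x - p m)))\<^sup>2" by simp
    moreover have "(norm (p n - p m))\<^sup>2 = (norm ((x - p m) - (x - p n)))\<^sup>2"
      by simp
    ultimately show ?thesis
      using p[of n] p[of m] unfolding parallelogram[of "x - p m" "x - p n"]
      by (simp add: add.commute)
  qed
  have "Cauchy p"
  proof (rule CauchyI)
    fix e :: real assume e: "0 < e"
    obtain M where M: "1 / Suc M < e\<^sup>2 / 4"
      using reals_Archimedean[of "e\<^sup>2 / 4"] e by (auto simp: inverse_eq_divide)
    have "norm (p n - p m) < e" if "n \<ge> M" "m \<ge> M" for n m
    proof -
      have "2 / Suc n \<le> 2 / Suc M" "2 / Suc m \<le> 2 / Suc M"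
        using that by (auto intro!: divide_left_mono)
      then have "(norm (p n - p m))\<^sup>2 < e\<^sup>2"
        using dist[of n m] M by simp
      then show ?thesis using e by (simp add: power2_less_imp_less)
    qed
    then show "\<exists>M. \<forall>m\<ge>M. \<forall>n\<ge>M. norm (p m - p n) < e" by blast
  qed
  then obtain q where q: "p \<longlonglongrightarrow> q"
    by (auto simp: Cauchy_convergent_iff convergent_def)
  have qL: "q \<in> L"
    by (rule closed_sequentially[OF cl pL q])
  have "(norm (x - q))\<^sup>2 \<le> d"
  proof (rule LIMSEQ_le)
    show "(\<lambda>n. (norm (x - p n))\<^sup>2) \<longlonglongrightarrow> (norm (x - q))\<^sup>2"
      by (intro tendsto_intros q)
    have "(\<lambda>n. d + 1 / Suc n) \<longlonglongrightarrow> d + 0"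
      by (intro tendsto_add tendsto_const LIMSEQ_Suc[OF lim_1_over_n])
    then show "(\<lambda>n. d + 1 / Suc n) \<longlonglongrightarrow> d" by simp
    show "\<exists>N. \<forall>n\<ge>N. (norm (x - p n))\<^sup>2 \<le> d + 1 / Suc n"
      using p less_imp_le by blast
  qed
  then have min: "norm (x - q) \<le> norm (x - y)" if "y \<in> L" for y
    by (rule power2_le_imp_le[OF order_trans[OF _ d_le[OF that]] norm_ge_zero])
  have "cinner y (x - q) = 0" if "y \<in> L" for y
  proof (rule minimal_vector_orthogonal)
    fix c
    have "q + c *\<^sub>C y \<in> L" by (intro csubspaceD[OF L] qL that)
    from min[OF this] show "norm (x - q) \<le> norm (x - q - c *\<^sub>C y)"
      by (simp add: diff_diff_eq)
  qed
  then show ?thesis using that qL by blast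
qed


section \<open>Orthonormal families\<close>

definition orthonormal :: "'i set \<Rightarrow> ('i \<Rightarrow> 'a::complex_inner) \<Rightarrow> bool"
  where "orthonormal I b \<longleftrightarrow> (\<forall>i\<in>I. \<forall>j\<in>I. cinner (b i) (b j) = (if i = j then 1 else 0))"

lemma orthonormalD:
  "orthonormal I b \<Longrightarrow> i \<in> I \<Longrightarrow> j \<in> I \<Longrightarrow> cinner (b i) (b j) = (if i = j then 1 else 0)"
  by (simp add: orthonormal_def)

lemma orthonormal_subset: "orthonormal I b \<Longrightarrow> J \<subseteq> I \<Longrightarrow> orthonormal J b"
  unfolding orthonormal_def by blast

lemma orthonormal_norm:
  assumes "orthonormal I b" "i \<in> I"
  shows "norm (b i) = 1"
proof -
  have "(norm (b i))\<^sup>2 = 1"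
    using orthonormalD[OF assms assms(2)] by (simp flip: Re_cinner_self)
  then show ?thesis
    using norm_ge_zero[of "b i"] power2_eq_1_iff[of "norm (b i)"] by linarith
qed

lemma orthonormal_inj_on:
  assumes "orthonormal I b"
  shows "inj_on b I"
proof (rule inj_onI)
  fix i j assume "i \<in> I" "j \<in> I" "b i = b j"
  then show "i = j"
    using orthonormalD[OF assms, of i j] orthonormalD[OF assms, of i i] by (auto split: if_splits)
qed

lemma orthonormal_image: "orthonormal I b \<Longrightarrow> orthonormal (b ` I) (\<lambda>x. x)"
  unfolding orthonormal_def by (metis (no_types, lifting) imageE zero_neq_one)

lemma orthonormal_compose:
  "orthonormal (f ` I) b \<Longrightarrow> inj_on f I \<Longrightarrow> orthonormal I (\<lambda>i. b (f i))"
  by (auto simp: orthonormal_def inj_on_def)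

lemma cinner_unique_sum:
  assumes "orthonormal I b" "finite I" "j \<in> I"
  shows "cinner (b j) (\<Sum>i\<in>I. a i *\<^sub>C b i) = a j"
proof -
  have "cinner (b j) (\<Sum>i\<in>I. a i *\<^sub>C b i) = (\<Sum>i\<in>I. if i = j then a i else 0)"
    unfolding cinner_sum_right
    by (rule sum.cong) (use assms in \<open>auto simp: cinner_scaleC_right orthonormalD\<close>)
  then show ?thesis using assms by simp
qed

lemma norm_orthonormal_sum:
  assumes "orthonormal I b" "finite I"
  shows "(norm (\<Sum>i\<in>I. a i *\<^sub>C b i))\<^sup>2 = (\<Sum>i\<in>I. (cmod (a i))\<^sup>2)"
proof -
  let ?x = "\<Sum>i\<in>I. a i *\<^sub>C b i"
  have "complex_of_real ((norm ?x)\<^sup>2) = (\<Sum>i\<in>I. cnj (a i) * cinner (b i) ?x)"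
    unfolding cinner_self[symmetric]
    by (subst cinner_sum_left) (simp add: cinner_scaleC_left)
  also have "\<dots> = (\<Sum>i\<in>I. complex_of_real ((cmod (a i))\<^sup>2))"
    by (rule sum.cong) (simp_all only: cinner_unique_sum[OF assms] complex_norm_square mult.commute)
  finally show ?thesis
    unfolding of_real_sum[symmetric] of_real_eq_iff .
qed

lemma orthonormal_residual:
  assumes "orthonormal I b" "finite I" "j \<in> I"
  shows "cinner (b j) (x - (\<Sum>i\<in>I. cinner (b i) x *\<^sub>C b i)) = 0"
  by (simp add: cinner_diff_right cinner_unique_sum[OF assms])

lemma norm_orthonormal_residual:
  assumes "orthonormal I b" "finite I"
  shows "(norm (x - (\<Sum>i\<in>I. cinner (b i) x *\<^sub>C b i)))\<^sup>2
    = (norm x)\<^sup>2 - (\<Sum>i\<in>I. (cmod (cinner (b i) x))\<^sup>2)"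
proof -
  let ?p = "\<Sum>i\<in>I. cinner (b i) x *\<^sub>C b i"
  have "cinner ?p (x - ?p) = 0"
    by (subst cinner_sum_left) (simp add: cinner_scaleC_left orthonormal_residual[OF assms])
  then have "(norm (?p + (x - ?p)))\<^sup>2 = (norm ?p)\<^sup>2 + (norm (x - ?p))\<^sup>2"
    by (simp only: norm_add_cinner) simp
  then show ?thesis
    by (simp add: norm_orthonormal_sum[OF assms])
qed

lemma bessel:
  assumes "orthonormal I b" "finite I"
  shows "(\<Sum>i\<in>I. (cmod (cinner (b i) x))\<^sup>2) \<le> (norm x)\<^sup>2"
  using norm_orthonormal_residual[OF assms, of x]
    zero_le_power2[of "norm (x - (\<Sum>i\<in>I. cinner (b i) x *\<^sub>C b i))"] by linarith

lemma orthonormal_independent: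
  assumes "orthonormal I b"
  shows "cvec.independent (b ` I)"
  unfolding cvec.independent_explicit_module
proof (intro allI impI)
  fix t u v assume t: "finite t" "t \<subseteq> b ` I" "(\<Sum>v\<in>t. u v *\<^sub>C v) = 0" "v \<in> t"
  have "orthonormal t (\<lambda>x. x)"
    using orthonormal_subset[OF orthonormal_image[OF assms] t(2)] .
  from cinner_unique_sum[OF this t(1) t(4), of u] show "u v = 0"
    by (simp add: t(3))
qed

instance chilbert_space \<subseteq> banach ..

lemma cinner_span_eq_0:
  assumes "x \<in> cspan F" "\<And>f. f \<in> F \<Longrightarrow> cinner f y = 0"
  shows "cinner x y = 0"
  using assms(1)
  by (induction rule: cvec.span_induct_alt)
    (simp_all add: cinner_add_left cinner_scaleC_left assms(2))

text \<open>Gram-Schmidt, one vector at a time: the residual \<open>r\<close> of the new vector is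
  normalised and added unless it vanishes. The basis is a set indexed by itself, hence the identity
  as family.\<close>

lemma finite_orthonormal_basis:
  assumes "finite B"
  obtains F where "finite F" "orthonormal F (\<lambda>x. x)" "B \<subseteq> cspan F" "F \<subseteq> cspan B"
  using assms
proof (induction B arbitrary: thesis rule: finite_induct)
  case empty
  then show ?case using empty[of "{}"] by (simp add: orthonormal_def)
next
  case (insert b B)
  obtain F where F: "finite F" "orthonormal F (\<lambda>x. x)" "B \<subseteq> cspan F" "F \<subseteq> cspan B"
    using insert.IH by blast
  define p where "p = (\<Sum>f\<in>F. cinner f b *\<^sub>C f)"
  define r where "r = b - p"
  have pF: "p \<in> cspan F"
    unfolding p_def by (intro cvec.span_sum cvec.span_scale cvec.span_base)
  have sub: "cspan F \<subseteq> cspan (insert b B)"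
    using cvec.span_mono[of F "cspan (insert b B)"] F(4) cvec.span_mono[of B "insert b B"]
    by (auto simp: cvec.span_span)
  have rb: "r \<in> cspan (insert b B)"
    unfolding r_def using pF sub by (intro cvec.span_diff cvec.span_base[of b]) auto
  have orth: "cinner f r = 0" if "f \<in> F" for f
    unfolding r_def p_def using orthonormal_residual[OF F(2,1) that] by simp
  show ?case
  proof (cases "r = 0")
    case True
    then have "b \<in> cspan F" using pF by (simp add: r_def)
    then show ?thesis
      using insert.prems[OF F(1,2)] F(3,4) cvec.span_mono[of B "insert b B"] by blast
  next
    case False
    define u where "u = complex_of_real (inverse (norm r)) *\<^sub>C r"
    have r_u: "r = complex_of_real (norm r) *\<^sub>C u"
      using False by (simp add: u_def scaleC_scaleC)
    have "norm u = 1"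
      using False by (simp add: u_def norm_scaleC norm_inverse)
    then have uu: "cinner u u = 1"
      by (simp add: cinner_self)
    have uF: "cinner f u = 0" "cinner u f = 0" if "f \<in> F" for f
      using orth[OF that] cinner_commute[of r f]
      by (simp_all add: u_def cinner_scaleC_right cinner_scaleC_left)
    have "orthonormal (insert u F) (\<lambda>x. x)"
      unfolding orthonormal_def
    proof (intro ballI)
      fix i j assume "i \<in> insert u F" "j \<in> insert u F"
      then show "cinner i j = (if i = j then 1 else 0)"
        using uu uF orthonormalD[OF F(2)] by (metis insertE)
    qed
    moreover have "insert b B \<subseteq> cspan (insert u F)"
    proof -
      have "p \<in> cspan (insert u F)" using pF cvec.span_mono[of F "insert u F"] by blast
      moreover have "r \<in> cspan (insert u F)"
        by (subst r_u) (intro cvec.span_scale cvec.span_base, simp)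
      ultimately have "b \<in> cspan (insert u F)"
        using cvec.span_add[of p _ r] by (simp add: r_def)
      then show ?thesis using F(3) cvec.span_mono[of F "insert u F"] by blast
    qed
    moreover have "insert u F \<subseteq> cspan (insert b B)"
      using sub cvec.span_superset[of F] rb cvec.span_scale[OF rb] by (auto simp: u_def)
    ultimately show ?thesis using insert.prems[of "insert u F"] F(1) by simp
  qed
qed

lemma span_expansion:
  assumes "finite I" "orthonormal I b" "x \<in> cspan (b ` I)"
  shows "x = (\<Sum>i\<in>I. cinner (b i) x *\<^sub>C b i)"
proof -
  let ?r = "x - (\<Sum>i\<in>I. cinner (b i) x *\<^sub>C b i)"
  have "?r \<in> cspan (b ` I)"
    by (intro cvec.span_diff assms cvec.span_sum cvec.span_scale cvec.span_base imageI)
  then have "cinner ?r ?r = 0"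
    by (rule cinner_span_eq_0) (use orthonormal_residual[OF assms(2,1)] in blast)
  then show ?thesis by (simp add: cinner_self_eq_0_iff)
qed

lemma orthonormal_card_le:
  assumes "finite B" "orthonormal I b" "b ` I \<subseteq> cspan B"
  shows "finite I \<and> card I \<le> card B"
  using cvec.independent_span_bound[OF assms(1) orthonormal_independent[OF assms(2)] assms(3)]
    orthonormal_inj_on[OF assms(2)] by (simp add: card_image finite_image_iff)

text \<open>\<open>S\<close> has trivial kernel on the span, so the images of the \<open>b i\<close>
  are independent in its range. Finiteness is part of the conclusion because \<open>card\<close> is
  0 on infinite sets. The lemma serves both for the multiplicities of 1 and -1 and for counting
  eigenvalues below a level.\<close>

lemma orthonormal_card_le_rank:
  fixes S :: "'a::complex_inner \<Rightarrow> 'b::complex_inner"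
  assumes S: "clinear S" "finite_rank S" and b: "orthonormal I b"
    and inj: "\<And>x. x \<in> cspan (b ` I) \<Longrightarrow> S x = 0 \<Longrightarrow> x = 0"
  shows "finite I \<and> card I \<le> cdim (range S)"
proof -
  interpret S: Vector_Spaces.linear scaleC scaleC S by (rule S(1))
  obtain B0 where B0: "finite B0" "range S \<subseteq> cspan B0"
    using S(2) by (auto simp: finite_rank_def cfinite_dim_def)
  obtain B where B: "B \<subseteq> range S" "cvec.independent B" "range S \<subseteq> cspan B"
      "card B = cdim (range S)"
    by (rule cvec.basis_exists)
  have finB: "finite B"
    using cvec.independent_span_bound[OF B0(1) B(2)] B(1) B0(2) by blast
  have inj_on: "inj_on S (cspan (b ` I))"
  proof (rule inj_onI)
    fix x y assume "x \<in> cspan (b ` I)" "y \<in> cspan (b ` I)" "S x = S y"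
    then show "x = y"
      using inj[of "x - y"] by (simp add: cvec.span_diff S.diff)
  qed
  have ind: "cvec.independent (S ` b ` I)"
    by (rule S.independent_injective_image[folded cspan_def, OF orthonormal_independent[OF b] inj_on])
  have "finite (S ` b ` I) \<and> card (S ` b ` I) \<le> card B"
    by (rule cvec.independent_span_bound[OF finB ind]) (use B(3) in auto)
  moreover have "inj_on (\<lambda>i. S (b i)) I"
    using comp_inj_on[OF orthonormal_inj_on[OF b] inj_on_subset[OF inj_on cvec.span_superset]]
    by (simp add: o_def)
  ultimately show ?thesis
    using B(4) by (simp add: image_image card_image finite_image_iff)
qed

text \<open>Zorn's lemma on the orthonormal subsets of \<open>X\<close> that contain
  \<open>M0\<close>. \<open>X\<close> is any set, since it often collects eigenvectors for many
  eigenvalues at once; maximality is tested on the unit vectors of \<open>X\<close>.\<close>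

lemma orthonormal_maximal:
  assumes "orthonormal M0 (\<lambda>x. x)" "M0 \<subseteq> X"
  obtains M where "M0 \<subseteq> M" "M \<subseteq> X" "orthonormal M (\<lambda>x. x)"
    "\<forall>x\<in>X. norm x = 1 \<longrightarrow> (\<exists>m\<in>M. cinner m x \<noteq> 0)"
proof -
  define \<A> where "\<A> = {M. M0 \<subseteq> M \<and> M \<subseteq> X \<and> orthonormal M (\<lambda>x. x)}"
  have "\<exists>M\<in>\<A>. \<forall>Y\<in>\<A>. M \<subseteq> Y \<longrightarrow> Y = M"
  proof (rule subset_Zorn_nonempty)
    show "\<A> \<noteq> {}" using assms by (auto simp: \<A>_def)
  next
    fix \<C> assume ne: "\<C> \<noteq> {}" and ch: "subset.chain \<A> \<C>"
    have sub: "\<C> \<subseteq> \<A>" and lin: "\<And>A B. A \<in> \<C> \<Longrightarrow> B \<in> \<C> \<Longrightarrow> A \<subseteq> B \<or> B \<subseteq> A"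
      using ch by (auto simp: subset_chain_def)
    have "orthonormal (\<Union>\<C>) (\<lambda>x. x)"
      unfolding orthonormal_def
    proof (intro ballI)
      fix x y assume "x \<in> \<Union>\<C>" "y \<in> \<Union>\<C>"
      then obtain A where "A \<in> \<C>" "x \<in> A" "y \<in> A" using lin by blast
      then show "cinner x y = (if x = y then 1 else 0)"
        using sub by (auto simp: \<A>_def orthonormal_def)
    qed
    then show "\<Union>\<C> \<in> \<A>" using ne sub by (auto simp: \<A>_def)
  qed
  then obtain M where M: "M \<in> \<A>" and max: "\<And>Y. Y \<in> \<A> \<Longrightarrow> M \<subseteq> Y \<Longrightarrow> Y = M" by blast
  have "False" if x: "x \<in> X" "norm x = 1" "\<And>m. m \<in> M \<Longrightarrow> cinner m x = 0" for x
  proof -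
    have xx: "cinner x x = 1" by (simp add: cinner_self x(2))
    have "cinner x m = 0" if "m \<in> M" for m
      using x(3)[OF that] cinner_commute[of x m] by simp
    then have "orthonormal (insert x M) (\<lambda>x. x)"
      using M xx x(3) unfolding \<A>_def orthonormal_def by auto
    then have "insert x M = M"
      using M x(1) by (intro max) (auto simp: \<A>_def)
    then show False using x(3)[of x] xx by auto
  qed
  then have "\<forall>x\<in>X. norm x = 1 \<longrightarrow> (\<exists>m\<in>M. cinner m x \<noteq> 0)" by blast
  then show ?thesis using that[of M] M by (simp add: \<A>_def)
qed

text \<open>Totality stands in for a dense span. A countable total set is the form in which
  separability is used.\<close>

definition ctotal :: "'a::complex_inner set \<Rightarrow> bool"
  where "ctotal S \<longleftrightarrow> (\<forall>x. (\<forall>s\<in>S. cinner s x = 0) \<longrightarrow> x = 0)"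

text \<open>By Bessel, only finitely many members of \<open>M\<close> have a coefficient of squared
  size above 1 / \<open>Suc k\<close> against a given \<open>s\<close>; totality of \<open>S\<close>
  puts every member into one of these countably many finite sets.\<close>

lemma orthonormal_countable:
  fixes S M :: "'a::complex_inner set"
  assumes S: "countable S" "ctotal S"
    and M: "orthonormal M (\<lambda>x. x)"
  shows "countable M"
proof -
  define N where "N s k = {m \<in> M. (cmod (cinner m s))\<^sup>2 > 1 / Suc k}" for s k
  have fin: "finite (N s k)" for s k
  proof -
    have "card G \<le> nat \<lceil>real (Suc k) * (norm s)\<^sup>2\<rceil>" if G: "finite G" "G \<subseteq> N s k" for G
    proof -
      have "real (card G) * (1 / Suc k) \<le> (\<Sum>m\<in>G. (cmod (cinner m s))\<^sup>2)"
        using G(2) by (intro sum_bounded_below) (auto simp: N_def intro: less_imp_le)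
      also have "\<dots> \<le> (norm s)\<^sup>2"
        using G by (intro bessel orthonormal_subset[OF M]) (auto simp: N_def)
      finally have "real (card G) \<le> real (Suc k) * (norm s)\<^sup>2"
        by (simp add: field_simps)
      then show ?thesis by linarith
    qed
    then show ?thesis
      using finite_if_finite_subsets_card_bdd[of "N s k" "nat \<lceil>real (Suc k) * (norm s)\<^sup>2\<rceil>"] by blast
  qed
  have "M \<subseteq> (\<Union>s\<in>S. \<Union>k. N s k)"
  proof
    fix m assume m: "m \<in> M"
    have "m \<noteq> 0" using orthonormal_norm[OF M m] by auto
    then obtain s where s: "s \<in> S" "cinner s m \<noteq> 0"
      using S(2) by (auto simp: ctotal_def)
    then have "0 < (cmod (cinner m s))\<^sup>2" using cinner_commute[of m s] by simp
    then obtain k where "1 / Suc k < (cmod (cinner m s))\<^sup>2"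
      using reals_Archimedean by (metis inverse_eq_divide)
    then show "m \<in> (\<Union>s\<in>S. \<Union>k. N s k)" using s m by (auto simp: N_def)
  qed
  then show ?thesis
    using fin S(1) by (meson countable_SIGMA countable_UN countable_finite countable_subset
        countableI_type)
qed


section \<open>Orthonormal bases\<close>

definition onb :: "(nat \<Rightarrow> 'a::complex_inner) \<Rightarrow> bool"
  where "onb e \<longleftrightarrow> orthonormal UNIV e \<and> (\<forall>x. (\<forall>n. cinner (e n) x = 0) \<longrightarrow> x = 0)"

lemma onb_orthonormal: "onb e \<Longrightarrow> orthonormal UNIV e"
  by (simp add: onb_def)

lemma onb_total: "onb e \<Longrightarrow> (\<And>n. cinner (e n) x = 0) \<Longrightarrow> x = 0"
  by (simp add: onb_def)

lemma onb_eqI: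
  assumes "onb e" "\<And>n. cinner (e n) x = cinner (e n) y"
  shows "x = y"
  using onb_total[OF assms(1), of "x - y"] assms(2) by (simp add: cinner_diff_right)

lemma summable_orthonormal_coeff:
  assumes "orthonormal UNIV e"
  shows "summable (\<lambda>n::nat. (cmod (cinner (e n) x))\<^sup>2)"
  by (rule summableI_nonneg_bounded[where x = "(norm x)\<^sup>2"])
    (use bessel[OF orthonormal_subset[OF assms]] in auto)

lemma riesz_fischer:
  fixes e :: "nat \<Rightarrow> 'a::chilbert_space"
  assumes e: "orthonormal UNIV e" and a: "summable (\<lambda>n. (cmod (a n))\<^sup>2)"
  obtains x where "(\<lambda>n. a n *\<^sub>C e n) sums x" "\<And>n. cinner (e n) x = a n"
proof -
  have "summable (\<lambda>n. a n *\<^sub>C e n)"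
    unfolding summable_Cauchy
  proof (intro allI impI)
    fix r :: real assume r: "0 < r"
    then obtain N where N: "\<And>m n. m \<ge> N \<Longrightarrow> norm (\<Sum>k=m..<n. (cmod (a k))\<^sup>2) < r\<^sup>2"
      using a unfolding summable_Cauchy by (metis zero_less_power)
    have "norm (\<Sum>k=m..<n. a k *\<^sub>C e k) < r" if "m \<ge> N" for m n
    proof -
      have "(norm (\<Sum>k=m..<n. a k *\<^sub>C e k))\<^sup>2 < r\<^sup>2"
        using N[OF that, of n]
        by (subst norm_orthonormal_sum[OF orthonormal_subset[OF e]]) (auto simp: sum_nonneg)
      then show ?thesis using r by (simp add: power2_less_imp_less)
    qed
    then show "\<exists>N. \<forall>m\<ge>N. \<forall>n. norm (\<Sum>k=m..<n. a k *\<^sub>C e k) < r" by blast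
  qed
  then have s: "(\<lambda>n. a n *\<^sub>C e n) sums (\<Sum>n. a n *\<^sub>C e n)"
    by (rule summable_sums)
  have "cinner (e m) (\<Sum>n. a n *\<^sub>C e n) = a m" for m
  proof -
    have "(\<lambda>n. cinner (e m) (a n *\<^sub>C e n)) sums cinner (e m) (\<Sum>n. a n *\<^sub>C e n)"
      by (rule cinner_sums_right[OF s])
    moreover have "(\<lambda>n. cinner (e m) (a n *\<^sub>C e n)) = (\<lambda>n. if n = m then a n else 0)"
      by (auto simp: cinner_scaleC_right orthonormalD[OF e])
    ultimately show ?thesis
      using sums_single[of m a] sums_unique2 by fastforce
  qed
  then show ?thesis using that s by blast
qed

lemma onb_expansion:
  fixes e :: "nat \<Rightarrow> 'a::chilbert_space"
  assumes "onb e"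
  shows "(\<lambda>n. cinner (e n) x *\<^sub>C e n) sums x"
proof -
  obtain y where y: "(\<lambda>n. cinner (e n) x *\<^sub>C e n) sums y" "\<And>n. cinner (e n) y = cinner (e n) x"
    using riesz_fischer[OF onb_orthonormal[OF assms]
        summable_orthonormal_coeff[OF onb_orthonormal[OF assms]]] by blast
  then have "y = x" by (intro onb_eqI[OF assms])
  then show ?thesis using y by simp
qed

lemma onb_parseval:
  fixes e :: "nat \<Rightarrow> 'a::chilbert_space"
  assumes "onb e"
  shows "(\<lambda>n. cinner x (e n) * cinner (e n) y) sums cinner x y"
  using cinner_sums_right[OF onb_expansion[OF assms, of y], of x]
  by (simp add: cinner_scaleC_right mult.commute)

lemma onb_parseval_norm:
  fixes e :: "nat \<Rightarrow> 'a::chilbert_space"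
  assumes "onb e"
  shows "(\<lambda>n. (cmod (cinner (e n) x))\<^sup>2) sums (norm x)\<^sup>2"
proof -
  have "cinner x (e n) * cinner (e n) x = complex_of_real ((cmod (cinner (e n) x))\<^sup>2)" for n
    using complex_norm_square[of "cinner (e n) x"] by (simp add: cnj_cinner mult.commute)
  then show ?thesis
    using onb_parseval[OF assms, of x x] by (simp only: cinner_self sums_of_real_iff)
qed

lemma finite_total_cfinite_dim:
  fixes M :: "'a::complex_inner set"
  assumes "finite M" "orthonormal M (\<lambda>x. x)" "ctotal M"
  shows "cfinite_dim (UNIV :: 'a set)"
proof -
  have "x \<in> cspan M" for x :: 'a
  proof -
    have "x - (\<Sum>m\<in>M. cinner m x *\<^sub>C m) = 0"
      using orthonormal_residual[OF assms(2,1)] assms(3) unfolding ctotal_def by blast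
    then have "x = (\<Sum>m\<in>M. cinner m x *\<^sub>C m)" by simp
    also have "\<dots> \<in> cspan M" by (intro cvec.span_sum cvec.span_scale cvec.span_base)
    finally show ?thesis .
  qed
  then show ?thesis using assms(1) by (auto simp: cfinite_dim_def)
qed

text \<open>The prescribed vectors come first and the rest \<open>R\<close> of \<open>M\<close> is
  enumerated behind them, shifted by \<open>n\<close>. Infinite dimension makes \<open>R\<close>
  infinite, so that its enumeration is a bijection.\<close>

lemma total_set_extend_onb:
  fixes M :: "'a::complex_inner set"
  assumes inf: "\<not> cfinite_dim (UNIV :: 'a set)"
    and M: "countable M" "orthonormal M (\<lambda>x. x)" "ctotal M"
    and b: "orthonormal {..<n} b" "b ` {..<n} \<subseteq> M"
  obtains e where "onb e" "range e = M" "\<And>i. i < n \<Longrightarrow> e i = b i"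
proof -
  have infM: "infinite M"
    using finite_total_cfinite_dim[OF _ M(2,3)] inf by blast
  define R where "R = M - b ` {..<n}"
  have R: "infinite R" "countable R"
    using infM M(1) by (auto simp: R_def)
  define e where "e i = (if i < n then b i else from_nat_into R (i - n))" for i
  have bij: "bij_betw (from_nat_into R) UNIV R"
    using R by (rule bij_betw_from_nat_into[rotated])
  have range: "range e = M"
  proof -
    have "UNIV = {..<n} \<union> {n..}" by auto
    then have "range e = e ` {..<n} \<union> e ` {n..}" by (metis image_Un)
    also have "e ` {..<n} = b ` {..<n}" by (auto simp: e_def)
    also have "e ` {n..} = from_nat_into R ` ((\<lambda>i. i - n) ` {n..})"
      by (auto simp: e_def image_iff)
    also have "(\<lambda>i. i - n) ` {n..} = UNIV"
      by (auto simp: image_iff intro!: bexI[of _ "_ + n"])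
    also have "from_nat_into R ` UNIV = R" using bij by (simp add: bij_betw_def)
    also have "b ` {..<n} \<union> R = M" using b(2) by (auto simp: R_def)
    finally show ?thesis .
  qed
  have inj: "inj e"
  proof (rule injI)
    fix i j assume eq: "e i = e j"
    have e1: "e k \<in> b ` {..<n}" if "k < n" for k using that by (auto simp: e_def)
    have e2: "e k \<in> R" if "\<not> k < n" for k
      using that bij by (auto simp: e_def bij_betw_def)
    show "i = j"
    proof (cases "i < n")
      case True
      then have "j < n" using eq e1[of i] e2[of j] by (auto simp: R_def)
      then show ?thesis using True eq orthonormal_inj_on[OF b(1)] by (auto simp: e_def inj_on_def)
    next
      case False
      then have "\<not> j < n" using eq e1[of j] e2[of i] by (auto simp: R_def)
      then have "i - n = j - n"
        using False eq bij by (auto simp: e_def bij_betw_def inj_on_def)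
      then show ?thesis using False \<open>\<not> j < n\<close> by simp
    qed
  qed
  have "orthonormal UNIV e"
    using orthonormal_compose[of e UNIV "\<lambda>x. x"] M(2) inj by (simp add: range)
  moreover have "x = 0" if "\<forall>n. cinner (e n) x = 0" for x
    using that range M(3) unfolding ctotal_def by (metis imageE)
  ultimately have "onb e" by (auto simp: onb_def)
  then show ?thesis using that range by (auto simp: e_def)
qed

text \<open>Bases with a prescribed beginning allow an isometry between finite-dimensional subspaces
  to be extended to a unitary.\<close>

lemma onb_extend:
  fixes b :: "nat \<Rightarrow> 'a::chilbert_space"
  assumes inf: "\<not> cfinite_dim (UNIV :: 'a set)"
    and S: "countable S" "ctotal (S :: 'a set)"
    and b: "orthonormal {..<n} b"
  obtains e where "onb e" "\<And>i. i < n \<Longrightarrow> e i = b i"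
proof -
  obtain M where M: "b ` {..<n} \<subseteq> M" "M \<subseteq> UNIV" "orthonormal M (\<lambda>x. x)"
      "\<forall>x\<in>UNIV. norm x = 1 \<longrightarrow> (\<exists>m\<in>M. cinner m x \<noteq> 0)"
    by (rule orthonormal_maximal[OF orthonormal_image[OF b] subset_UNIV])
  have "x = 0" if "\<forall>m\<in>M. cinner m x = 0" for x
  proof (rule ccontr)
    assume "x \<noteq> 0"
    define u where "u = complex_of_real (inverse (norm x)) *\<^sub>C x"
    have "norm u = 1" using \<open>x \<noteq> 0\<close> by (simp add: u_def norm_scaleC norm_inverse)
    then obtain m where "m \<in> M" "cinner m u \<noteq> 0" using M(4) by blast
    then show False using that by (simp add: u_def cinner_scaleC_right)
  qed
  then have "ctotal M" by (simp add: ctotal_def)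
  from total_set_extend_onb[OF inf orthonormal_countable[OF S M(3)] M(3) this b M(1)]
  show ?thesis using that by metis
qed

lemma separable_countable_total:
  assumes "separable_space (euclidean :: 'a::complex_inner topology)"
  obtains S where "countable S" "ctotal (S :: 'a set)"
proof -
  obtain S :: "'a set" where S: "countable S" "closure S = UNIV"
    using assms by (auto simp: separable_space_def)
  have "x = 0" if x: "\<forall>s\<in>S. cinner s x = 0" for x
  proof -
    have "x \<in> closure S" using S by simp
    then obtain f where f: "\<And>n. f n \<in> S" "f \<longlonglongrightarrow> x"
      unfolding closure_sequential by blast
    have "(\<lambda>n. cinner (f n) x) \<longlonglongrightarrow> cinner x x"
      by (intro tendsto_intros f)
    then have "cinner x x = 0"
      by (simp add: x f LIMSEQ_const_iff)
    then show ?thesis by (simp add: cinner_self_eq_0_iff)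
  qed
  then show ?thesis using that S by (auto simp: ctotal_def)
qed

lemma Cauchy_null_bound:
  fixes y :: "nat \<Rightarrow> 'a::real_normed_vector"
  assumes "\<And>i j. norm (y i - y j) \<le> h i + h j" "h \<longlonglongrightarrow> 0"
  shows "Cauchy y"
proof (rule CauchyI)
  fix e :: real assume "0 < e"
  then obtain N where N: "\<And>n. n \<ge> N \<Longrightarrow> \<bar>h n\<bar> < e / 2"
    using LIMSEQ_D[OF assms(2), of "e / 2"] by auto
  have "norm (y m - y n) < e" if "m \<ge> N" "n \<ge> N" for m n
    using assms(1)[of m n] N[OF that(1)] N[OF that(2)] by linarith
  then show "\<exists>M. \<forall>m\<ge>M. \<forall>n\<ge>M. norm (y m - y n) < e" by blast
qed

lemma unit_multiple:
  assumes "x \<noteq> 0"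
  obtains c where "norm (c *\<^sub>C x) = 1" "c \<noteq> 0"
  using that[of "complex_of_real (inverse (norm x))"] assms by (simp add: norm_scaleC norm_inverse)

definition ocomp :: "'a::complex_inner set \<Rightarrow> 'a set"
  where "ocomp M = {x. \<forall>m\<in>M. cinner m x = 0}"

lemma csubspace_ocomp: "csubspace (ocomp M)"
  by (auto simp: ocomp_def intro!: cvec.subspaceI simp: cinner_add_right cinner_scaleC_right)

lemma closed_ocomp: "closed (ocomp M)"
  unfolding closed_sequential_limits
proof (intro allI impI)
  fix f l assume f: "(\<forall>n. f n \<in> ocomp M) \<and> f \<longlonglongrightarrow> l"
  have "cinner m l = 0" if "m \<in> M" for m
  proof -
    have "(\<lambda>n. cinner m (f n)) \<longlonglongrightarrow> cinner m l"
      using f by (intro tendsto_intros) auto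
    moreover have "(\<lambda>n. cinner m (f n)) = (\<lambda>n. 0)"
      using f that by (auto simp: ocomp_def)
    ultimately show ?thesis by (simp add: LIMSEQ_const_iff)
  qed
  then show "l \<in> ocomp M" by (simp add: ocomp_def)
qed

lemma coordinates_convergent_subseq:
  assumes "finite F" "\<And>n. norm (x n) \<le> C"
  shows "\<exists>r::nat \<Rightarrow> nat. strict_mono r \<and> (\<forall>f\<in>F. convergent (\<lambda>n. cinner f (x (r n))))"
  using assms(1)
proof (induction F)
  case empty
  then show ?case using strict_mono_id by blast
next
  case (insert f F)
  then obtain r :: "nat \<Rightarrow> nat" where r: "strict_mono r" "\<And>f. f \<in> F \<Longrightarrow> convergent (\<lambda>n. cinner f (x (r n)))"
    by blast
  have "cmod (cinner f (x (r n))) \<le> norm f * C" for n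
    using cmod_cinner_le[of f "x (r n)"] mult_left_mono[OF assms(2)[of "r n"], of "norm f"] by simp
  then have "bounded (range (\<lambda>n. cinner f (x (r n))))"
    by (auto simp: bounded_iff)
  then obtain l and s :: "nat \<Rightarrow> nat" where s: "strict_mono s" "((\<lambda>n. cinner f (x (r n))) \<circ> s) \<longlonglongrightarrow> l"
    using bounded_imp_convergent_subsequence by blast
  have "convergent (\<lambda>n. cinner g (x ((r \<circ> s) n)))" if "g \<in> insert f F" for g
  proof (cases "g = f")
    case True
    then show ?thesis using s(2) by (auto simp: convergent_def o_def)
  next
    case False
    then have "convergent (\<lambda>n. cinner g (x (r n)))" using r that by blast
    then show ?thesis
      using convergent_subseq_convergent[OF _ s(1)] by (fastforce simp: o_def)
  qed
  moreover have "strict_mono (r \<circ> s)" by (rule strict_mono_o[OF r(1) s(1)])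
  ultimately show ?case by blast
qed

section \<open>Compact self-adjoint operators\<close>

text \<open>For bounded operators on a Hilbert space this is compactness, phrased through subspaces
  of finite codimension. Min-max discreteness of \<open>T\<close> turns directly into this property
  of its resolvent.\<close>

definition compact_like :: "('a::complex_inner \<Rightarrow> 'a) \<Rightarrow> bool"
  where "compact_like G \<longleftrightarrow>
    (\<forall>e>0. \<exists>F. finite F \<and> (\<forall>y\<in>ocomp F. norm (G y) \<le> e * norm y))"

text \<open>Splitting \<open>y\<close> into its projection on the span of \<open>F\<close> and the
  rest turns smallness on a complement into an estimate for every \<open>y\<close>, at the price of
  finitely many coordinates.\<close>

lemma compact_like_approx:
  assumes G: "clinear G" and K: "\<And>x. norm (G x) \<le> K * norm x" "0 \<le> K"
    and c: "compact_like G" "0 < e"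
  obtains F M where "finite F" "0 \<le> M"
    "\<And>y. norm (G y) \<le> e * norm y + M * (\<Sum>f\<in>F. cmod (cinner f y))"
proof -
  obtain F0 where F0: "finite F0" "\<forall>y\<in>ocomp F0. norm (G y) \<le> e * norm y"
    using c unfolding compact_like_def by blast
  obtain F where F: "finite F" "orthonormal F (\<lambda>x. x)" "F0 \<subseteq> cspan F"
    using finite_orthonormal_basis[OF F0(1)] by metis
  have "norm (G y) \<le> e * norm y + K * (\<Sum>f\<in>F. cmod (cinner f y))" for y
  proof -
    define p where "p = (\<Sum>f\<in>F. cinner f y *\<^sub>C f)"
    have orth: "cinner f (y - p) = 0" if "f \<in> F" for f
      using orthonormal_residual[OF F(2,1) that] by (simp add: p_def)
    have "y - p \<in> ocomp F0"
      using cinner_span_eq_0[of _ F "y - p"] F(3) orth by (auto simp: ocomp_def)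
    then have "norm (G (y - p)) \<le> e * norm (y - p)" using F0(2) by blast
    also have "norm (y - p) \<le> norm y"
    proof (rule power2_le_imp_le)
      show "(norm (y - p))\<^sup>2 \<le> (norm y)\<^sup>2"
        using norm_orthonormal_residual[OF F(2,1), of y] by (simp add: p_def sum_nonneg)
    qed simp
    finally have 1: "norm (G (y - p)) \<le> e * norm y" using c(2) by simp
    have "norm p \<le> (\<Sum>f\<in>F. cmod (cinner f y))"
      unfolding p_def
      by (rule sum_norm_le) (simp add: norm_scaleC orthonormal_norm[OF F(2)])
    then have 2: "norm (G p) \<le> K * (\<Sum>f\<in>F. cmod (cinner f y))"
      using K(1)[of p] mult_left_mono[OF _ K(2)] order_trans by blast
    have "G y = G (y - p) + G p" by (simp add: clinearD(4)[OF G])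
    then show ?thesis using 1 2 norm_triangle_ineq[of "G (y - p)" "G p"] by simp
  qed
  then show ?thesis using that[OF F(1) K(2)] by blast
qed

lemma csym_bounded_linear:
  assumes "csym G" "\<And>x. norm (G x) \<le> K * norm x"
  shows "bounded_linear G"
  using assms csym_clinear bounded_clinear_bounded_linear unfolding bounded_clinear_def by blast

text \<open>Unit vectors of \<open>W\<close> that maximise |G x| in the limit satisfy G^2 x - m^2 x
  -> 0, and compactness makes a subsequence converge to some z with G^2 z = m^2 z. The invariant
  subspace \<open>W\<close> is there so that eigenvectors already found can be split off.\<close>

lemma compact_csym_eigenvector:
  fixes G :: "'a::chilbert_space \<Rightarrow> 'a"
  assumes G: "csym G" and K: "\<And>x. norm (G x) \<le> K * norm x" "0 \<le> K" and comp: "compact_like G"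
    and W: "csubspace W" "closed W" "\<And>x. x \<in> W \<Longrightarrow> G x \<in> W"
    and x0: "x0 \<in> W" "G x0 \<noteq> 0"
  obtains x \<mu> where "x \<in> W" "norm x = 1" "\<mu> \<noteq> 0" "G x = complex_of_real \<mu> *\<^sub>C x"
proof -
  note lin = clinearD[OF csym_clinear[OF G]]
  note sub = csubspaceD[OF W(1)]
  define U where "U = {x\<in>W. norm x = 1}"
  have bdd: "bdd_above ((\<lambda>x. norm (G x)) ` U)"
  proof (rule bdd_aboveI2)
    fix x assume "x \<in> U"
    then show "norm (G x) \<le> K" using K(1)[of x] by (simp add: U_def)
  qed
  define m where "m = (SUP x\<in>U. norm (G x))"
  have leU: "norm (G x) \<le> m" if "x \<in> U" for x
    unfolding m_def by (rule cSUP_upper[OF that bdd])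
  have lem: "norm (G x) \<le> m * norm x" if "x \<in> W" for x
  proof (cases "x = 0")
    case False
    then obtain c where c: "norm (c *\<^sub>C x) = 1" "c \<noteq> 0" by (rule unit_multiple)
    then have "norm (G (c *\<^sub>C x)) \<le> m" using that sub by (intro leU) (simp add: U_def)
    then have "cmod c * norm (G x) \<le> m * (cmod c * norm x)"
      using c by (simp add: lin norm_scaleC)
    then show ?thesis using c(2) by (simp add: mult.left_commute)
  qed (simp add: lin)
  have "x0 \<noteq> 0" using x0(2) lin(3) by auto
  then obtain c where c: "norm (c *\<^sub>C x0) = 1" "c \<noteq> 0" by (rule unit_multiple)
  have c0: "c *\<^sub>C x0 \<in> U" using c sub x0 by (simp add: U_def)
  then have ne: "U \<noteq> {}" by auto
  have "0 < norm (G (c *\<^sub>C x0))" using c x0(2) by (simp add: lin scaleC_eq_0_iff)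
  then have m: "0 < m" using leU[OF c0] by linarith
  have "\<exists>x\<in>U. m - 1 / Suc n < norm (G x)" for n
    using less_cSUP_iff[OF ne bdd, of "m - 1 / Suc n"] by (simp add: m_def)
  then obtain x where xU: "\<And>n. x n \<in> U" and x: "\<And>n. m - 1 / Suc n < norm (G (x n))" by metis
  have xW: "x n \<in> W" and x1: "norm (x n) = 1" for n using xU[of n] by (auto simp: U_def)
  have lim: "(\<lambda>n. norm (G (x n))) \<longlonglongrightarrow> m"
  proof (rule tendsto_sandwich)
    show "(\<lambda>n. m - 1 / Suc n) \<longlonglongrightarrow> m"
      using tendsto_diff[OF tendsto_const LIMSEQ_Suc[OF lim_1_over_n], of m] by simp
    show "\<forall>\<^sub>F n in sequentially. m - 1 / Suc n \<le> norm (G (x n))"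
      using x less_imp_le by (intro always_eventually) blast
    show "\<forall>\<^sub>F n in sequentially. norm (G (x n)) \<le> m"
      using leU[OF xU] by simp
  qed simp
  define D where "D n = G (G (x n)) - complex_of_real (m\<^sup>2) *\<^sub>C x n" for n
  \<comment> \<open>In the expanded square the mixed term is -2 m^2 |G x|^2, and |G G x| is at most
    m |G x| since \<open>W\<close> is invariant.\<close>
  have D_le: "(norm (D n))\<^sup>2 \<le> m\<^sup>2 * (m\<^sup>2 - (norm (G (x n)))\<^sup>2)" for n
  proof -
    have "(norm (G (G (x n))))\<^sup>2 \<le> (m * norm (G (x n)))\<^sup>2"
      by (intro power_mono lem W(3) xW) simp
    moreover have "Re (cinner (G (G (x n))) (complex_of_real (m\<^sup>2) *\<^sub>C x n))
        = m\<^sup>2 * (norm (G (x n)))\<^sup>2"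
      using csymD[OF G, of "G (x n)" "x n"] by (simp add: cinner_scaleC_right cinner_self)
    ultimately show ?thesis
      unfolding D_def norm_diff_cinner
      by (simp add: norm_scaleC x1 power_mult_distrib norm_power algebra_simps)
  qed
  have D0: "D \<longlonglongrightarrow> 0"
  proof -
    have "(\<lambda>n. m\<^sup>2 * (m\<^sup>2 - (norm (G (x n)))\<^sup>2)) \<longlonglongrightarrow> m\<^sup>2 * (m\<^sup>2 - m\<^sup>2)"
      by (intro tendsto_intros lim)
    then have lim0: "(\<lambda>n. m\<^sup>2 * (m\<^sup>2 - (norm (G (x n)))\<^sup>2)) \<longlonglongrightarrow> 0"
      by (simp only: diff_self mult_zero_right)
    have "(\<lambda>n. (norm (D n))\<^sup>2) \<longlonglongrightarrow> 0"
    proof (rule tendsto_sandwich)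
      show "\<forall>\<^sub>F n in sequentially. 0 \<le> (norm (D n))\<^sup>2" by simp
      show "\<forall>\<^sub>F n in sequentially. (norm (D n))\<^sup>2 \<le> m\<^sup>2 * (m\<^sup>2 - (norm (G (x n)))\<^sup>2)"
        by (rule always_eventually, rule allI, rule D_le)
    qed (rule tendsto_const, rule lim0)
    then have "(\<lambda>n. sqrt ((norm (D n))\<^sup>2)) \<longlonglongrightarrow> sqrt 0"
      by (intro tendsto_intros)
    then show ?thesis by (simp add: tendsto_norm_zero_iff)
  qed
  \<comment> \<open>The tolerance m/2 contributes m^2/2 |d| for a difference d of two sequence
    members, which the left side m^2 |d| absorbs; the factor 2 / m^2 in \<open>h\<close> comes from
    this.\<close>
  obtain F M where F: "finite F" and M: "0 \<le> M"
    and FM: "\<And>y. norm (G y) \<le> m / 2 * norm y + M * (\<Sum>f\<in>F. cmod (cinner f y))"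
    using compact_like_approx[OF csym_clinear[OF G] K comp, of "m / 2"] m by auto
  obtain r where r: "strict_mono r" "\<And>f. f \<in> F \<Longrightarrow> convergent (\<lambda>n. cinner f (x (r n)))"
    using coordinates_convergent_subseq[OF F, of x 1] x1 by auto
  define l where "l f = lim (\<lambda>n. cinner f (x (r n)))" for f
  have l: "(\<lambda>n. cinner f (x (r n))) \<longlonglongrightarrow> l f" if "f \<in> F" for f
    using r(2)[OF that] by (simp add: l_def convergent_LIMSEQ_iff)
  define h where "h n = (2 / m\<^sup>2) *
    (m * M * (\<Sum>f\<in>F. cmod (cinner f (x (r n)) - l f)) + norm (D (r n)))" for n
  have "h \<longlonglongrightarrow> (2 / m\<^sup>2) * (m * M * (\<Sum>f\<in>F. cmod (l f - l f)) + norm (0::'a))"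
    unfolding h_def by (intro tendsto_intros l LIMSEQ_subseq_LIMSEQ[OF D0 r(1), unfolded o_def])
  then have h0: "h \<longlonglongrightarrow> 0" by simp
  have h_eq: "m\<^sup>2 / 2 * h n
      = m * M * (\<Sum>f\<in>F. cmod (cinner f (x (r n)) - l f)) + norm (D (r n))" for n
    using m by (simp add: h_def)
  have "norm (x (r i) - x (r j)) \<le> h i + h j" for i j
  proof -
    define d where "d = x (r i) - x (r j)"
    have dW: "d \<in> W" unfolding d_def by (intro sub xW)
    have "complex_of_real (m\<^sup>2) *\<^sub>C d = G (G d) - (D (r i) - D (r j))"
      unfolding d_def D_def lin by (simp add: cvec.scale_right_diff_distrib)
    then have "m\<^sup>2 * norm d = norm (G (G d) - (D (r i) - D (r j)))"
      using norm_scaleC[of "complex_of_real (m\<^sup>2)" d] by (simp add: norm_power)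
    also have "\<dots> \<le> norm (G (G d)) + (norm (D (r i)) + norm (D (r j)))"
      by (intro order_trans[OF norm_triangle_ineq4] add_left_mono norm_triangle_ineq4)
    also have "norm (G (G d)) \<le> m * norm (G d)"
      by (intro lem W(3) dW)
    also have "m * norm (G d) \<le> m * (m / 2 * norm d + M * (\<Sum>f\<in>F. cmod (cinner f d)))"
      by (intro mult_left_mono FM) (use m in simp)
    also have "(\<Sum>f\<in>F. cmod (cinner f d))
        \<le> (\<Sum>f\<in>F. cmod (cinner f (x (r i)) - l f) + cmod (cinner f (x (r j)) - l f))"
    proof (rule sum_mono)
      fix f assume "f \<in> F"
      have "cinner f d = (cinner f (x (r i)) - l f) - (cinner f (x (r j)) - l f)"
        by (simp add: d_def cinner_diff_right)
      then show "cmod (cinner f d)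
          \<le> cmod (cinner f (x (r i)) - l f) + cmod (cinner f (x (r j)) - l f)"
        by (metis norm_triangle_ineq4)
    qed
    finally have "m\<^sup>2 * norm d \<le> m * (m / 2 * norm d + M * (\<Sum>f\<in>F.
        cmod (cinner f (x (r i)) - l f) + cmod (cinner f (x (r j)) - l f)))
        + (norm (D (r i)) + norm (D (r j)))"
      using m M by (simp add: mult_left_mono)
    then have "m\<^sup>2 / 2 * norm d \<le> m\<^sup>2 / 2 * (h i + h j)"
      unfolding distrib_left h_eq sum.distrib by (simp add: power2_eq_square algebra_simps)
    then show ?thesis using m by (simp add: d_def)
  qed
  then have "Cauchy (\<lambda>n. x (r n))" using h0 by (rule Cauchy_null_bound)
  then obtain z where z: "(\<lambda>n. x (r n)) \<longlonglongrightarrow> z"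
    by (auto simp: Cauchy_convergent_iff convergent_def)
  have bl: "bounded_linear G" by (rule csym_bounded_linear[OF G K(1)])
  have zW: "z \<in> W" by (rule closed_sequentially[OF W(2) xW z])
  have "(\<lambda>n. norm (x (r n))) \<longlonglongrightarrow> norm z" by (intro tendsto_intros z)
  then have z1: "norm z = 1" by (simp add: x1 LIMSEQ_const_iff)
  have "(\<lambda>n. D (r n)) \<longlonglongrightarrow> G (G z) - complex_of_real (m\<^sup>2) *\<^sub>C z"
    unfolding D_def by (intro tendsto_intros bounded_linear.tendsto[OF bl] z)
  then have "G (G z) - complex_of_real (m\<^sup>2) *\<^sub>C z = 0"
    using LIMSEQ_unique LIMSEQ_subseq_LIMSEQ[OF D0 r(1), unfolded o_def] by blast
  then have GG: "G (G z) = complex_of_real (m\<^sup>2) *\<^sub>C z" by simp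
  \<comment> \<open>Since G^2 - m^2 = (G - m)(G + m), either (G + m) z = 0 and z belongs to -m, or
    (G + m) z is an eigenvector for m.\<close>
  show ?thesis
  proof (cases "G z + complex_of_real m *\<^sub>C z = 0")
    case True
    then have "G z = complex_of_real (- m) *\<^sub>C z"
      by (simp add: add_eq_0_iff2)
    then show ?thesis using that[OF zW z1, of "- m"] m by simp
  next
    case False
    define u where "u = G z + complex_of_real m *\<^sub>C z"
    have "G u = complex_of_real m *\<^sub>C u"
      unfolding u_def by (simp add: lin GG scaleC_add_right scaleC_scaleC power2_eq_square add.commute)
    moreover obtain c where c: "norm (c *\<^sub>C u) = 1" using False unit_multiple u_def by metis
    moreover have "c *\<^sub>C u \<in> W" unfolding u_def by (intro sub W(3) zW)
    ultimately show ?thesis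
      using that[of "c *\<^sub>C u" m] m by (simp add: lin scaleC_scaleC mult.commute)
  qed
qed

text \<open>By symmetry the coefficient of \<open>A x\<close> along a basis vector \<open>f\<close>
  of the range is \<open>cinner (A f) x\<close>. This yields at once a norm bound and the vanishing
  of \<open>A\<close> on vectors orthogonal to the finitely many \<open>A f\<close>.\<close>

lemma finite_rank_csym_bound:
  assumes A: "csym A" "finite_rank A"
  obtains F K where "finite F" "orthonormal F (\<lambda>x. x)" "range A \<subseteq> cspan F" "0 \<le> K"
    "\<And>x. norm (A x) \<le> K * norm x" "\<And>y. y \<in> ocomp (A ` F) \<Longrightarrow> A y = 0"
proof -
  obtain B where B: "finite B" "range A \<subseteq> cspan B"
    using A(2) by (auto simp: finite_rank_def cfinite_dim_def)
  obtain F where F: "finite F" "orthonormal F (\<lambda>x. x)" "B \<subseteq> cspan F"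
    using finite_orthonormal_basis[OF B(1)] by metis
  have sub: "range A \<subseteq> cspan F"
    using B(2) cvec.span_mono[OF F(3)] by (simp add: cvec.span_span)
  have exp: "A x = (\<Sum>f\<in>F. cinner (A f) x *\<^sub>C f)" for x
    using span_expansion[OF F(1,2), of "A x"] sub by (auto simp: csymD[OF A(1)])
  have 1: "norm (A x) \<le> (\<Sum>f\<in>F. norm (A f)) * norm x" for x
    unfolding sum_distrib_right
  proof (subst exp, rule sum_norm_le)
    fix f assume "f \<in> F"
    then show "norm (cinner (A f) x *\<^sub>C f) \<le> norm (A f) * norm x"
      using cmod_cinner_le[of "A f" x] by (simp add: norm_scaleC orthonormal_norm[OF F(2)])
  qed
  have 2: "A y = 0" if "y \<in> ocomp (A ` F)" for y
    using that by (subst exp) (simp add: ocomp_def)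
  show ?thesis
    by (rule that[OF F(1,2) sub _ 1 2]) (simp_all add: sum_nonneg)
qed

text \<open>Take a maximal orthonormal set \<open>M\<close> of eigenvectors with nonzero eigenvalue.
  Its complement is invariant, so if \<open>A\<close> did not vanish there, it would contain another
  such eigenvector.\<close>

lemma finite_rank_csym_diagonal:
  fixes A :: "'a::chilbert_space \<Rightarrow> 'a"
  assumes A: "csym A" "finite_rank A"
  obtains M \<mu> where "finite M" "orthonormal M (\<lambda>x. x)" "M \<subseteq> range A"
    "\<And>m. m \<in> M \<Longrightarrow> \<mu> m \<noteq> (0::real)" "\<And>m. m \<in> M \<Longrightarrow> A m = complex_of_real (\<mu> m) *\<^sub>C m"
    "\<And>x. A x = (\<Sum>m\<in>M. (complex_of_real (\<mu> m) * cinner m x) *\<^sub>C m)"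
proof -
  note lin = clinearD[OF csym_clinear[OF A(1)]]
  obtain F K where F: "finite F" "orthonormal F (\<lambda>x. x)" "range A \<subseteq> cspan F" "0 \<le> K"
    "\<And>x. norm (A x) \<le> K * norm x" "\<And>y. y \<in> ocomp (A ` F) \<Longrightarrow> A y = 0"
    using finite_rank_csym_bound[OF A] by metis
  have comp: "compact_like A"
    unfolding compact_like_def using F(1,6) by (metis finite_imageI mult_nonneg_nonneg
        norm_ge_zero norm_zero order_less_imp_le)
  define X where "X = {x. \<exists>\<mu>::real. \<mu> \<noteq> 0 \<and> A x = complex_of_real \<mu> *\<^sub>C x}"
  obtain M where M: "{} \<subseteq> M" "M \<subseteq> X" "orthonormal M (\<lambda>x. x)"
      "\<forall>x\<in>X. norm x = 1 \<longrightarrow> (\<exists>m\<in>M. cinner m x \<noteq> 0)"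
    by (rule orthonormal_maximal[of "{}" X]) (auto simp: orthonormal_def)
  have "\<forall>m\<in>M. \<exists>\<nu>::real. \<nu> \<noteq> 0 \<and> A m = complex_of_real \<nu> *\<^sub>C m"
    using M(2) by (auto simp: X_def)
  from bchoice[OF this] obtain \<mu> :: "'a \<Rightarrow> real"
    where \<mu>: "\<forall>m\<in>M. \<mu> m \<noteq> 0 \<and> A m = complex_of_real (\<mu> m) *\<^sub>C m" by blast
  have range: "M \<subseteq> range A"
  proof
    fix m assume m: "m \<in> M"
    then have "A (complex_of_real (inverse (\<mu> m)) *\<^sub>C m) = m"
      using \<mu> m by (simp add: lin scaleC_scaleC)
    then show "m \<in> range A" by (metis rangeI)
  qed
  have finM: "finite M"
    using orthonormal_card_le[OF F(1) M(3)] range F(3) by auto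
  have zero: "A x = 0" if x: "x \<in> ocomp M" for x
  proof (rule ccontr)
    assume "A x \<noteq> 0"
    have inv: "A y \<in> ocomp M" if "y \<in> ocomp M" for y
      unfolding ocomp_def
    proof (intro CollectI ballI)
      fix m assume m: "m \<in> M"
      have "cinner m (A y) = cinner (A m) y" by (simp add: csymD[OF A(1)])
      also have "\<dots> = 0" using that m \<mu> by (simp add: cinner_scaleC_left ocomp_def)
      finally show "cinner m (A y) = 0" .
    qed
    obtain u \<nu> where u: "u \<in> ocomp M" "norm u = 1" "\<nu> \<noteq> 0" "A u = complex_of_real \<nu> *\<^sub>C u"
      by (rule compact_csym_eigenvector[OF A(1) F(5,4) comp csubspace_ocomp closed_ocomp inv x
            \<open>A x \<noteq> 0\<close>])
    then have "u \<in> X" by (auto simp: X_def)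
    then show False using M(4) u(1,2) by (auto simp: ocomp_def)
  qed
  have "A x = (\<Sum>m\<in>M. (complex_of_real (\<mu> m) * cinner m x) *\<^sub>C m)" for x
  proof -
    let ?p = "\<Sum>m\<in>M. cinner m x *\<^sub>C m"
    have "x - ?p \<in> ocomp M"
      using orthonormal_residual[OF M(3) finM] by (auto simp: ocomp_def)
    then have "A x = A ?p" using zero[of "x - ?p"] by (simp add: lin)
    also have "\<dots> = (\<Sum>m\<in>M. (complex_of_real (\<mu> m) * cinner m x) *\<^sub>C m)"
      unfolding lin by (rule sum.cong) (simp_all add: \<mu> scaleC_scaleC mult.commute)
    finally show ?thesis .
  qed
  then show ?thesis using that[OF finM M(3) range, of \<mu>] \<mu> by blast
qed

section \<open>Quadratic forms and spectral gaps of bounded symmetric operators\<close>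

lemma csym_quadratic:
  assumes "csym A"
  shows "Re (cinner (x - t *\<^sub>R y) (A (x - t *\<^sub>R y)))
    = Re (cinner x (A x)) - 2 * t * Re (cinner y (A x)) + t\<^sup>2 * Re (cinner y (A y))"
proof -
  have "Re (cinner x (A y)) = Re (cinner y (A x))"
    using csymD[OF assms, of x y] Re_cinner_commute[of "A x" y] by simp
  then show ?thesis
    by (simp add: clinearD[OF csym_clinear[OF assms]] cinner_diff_left cinner_diff_right
        scaleR_scaleC cinner_scaleC_left cinner_scaleC_right power2_eq_square algebra_simps)
qed

lemma Re_cinner_le: "Re (cinner x y) \<le> norm x * norm y"
  using cmod_cinner_le[of x y] complex_Re_le_cmod[of "cinner x y"] by linarith

text \<open>Positivity of the form at x - Y x / K, with the last term estimated by |Y| \<le> K,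
  gives Y^2 \<le> K Y on \<open>W\<close>.\<close>

lemma csym_nonneg_norm_le:
  assumes Y: "csym Y" and pos: "\<And>w. w \<in> W \<Longrightarrow> 0 \<le> Re (cinner w (Y w))"
    and W: "csubspace W" "\<And>w. w \<in> W \<Longrightarrow> Y w \<in> W"
    and K: "0 < K" "\<And>w. norm (Y w) \<le> K * norm w" and x: "x \<in> W"
  shows "(norm (Y x))\<^sup>2 \<le> K * Re (cinner x (Y x))"
proof -
  have "x - (1/K) *\<^sub>R Y x \<in> W"
    by (intro csubspaceD[OF W(1)] W(2) x)
  from pos[OF this] have "0 \<le> Re (cinner x (Y x)) - 2 * (1/K) * (norm (Y x))\<^sup>2
      + (1/K)\<^sup>2 * Re (cinner (Y x) (Y (Y x)))"
    unfolding csym_quadratic[OF Y] Re_cinner_self .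
  also have "Re (cinner (Y x) (Y (Y x))) \<le> norm (Y x) * (K * norm (Y x))"
    by (intro order_trans[OF Re_cinner_le] mult_left_mono K) simp
  finally have "0 \<le> Re (cinner x (Y x)) - 2 * (1/K) * (norm (Y x))\<^sup>2
      + (1/K)\<^sup>2 * (norm (Y x) * (K * norm (Y x)))"
    by (simp add: mult_left_mono)
  also have "(1/K)\<^sup>2 * (norm (Y x) * (K * norm (Y x))) = (1/K) * (norm (Y x))\<^sup>2"
    using K(1) by (simp add: power2_eq_square)
  finally have "(1/K) * (norm (Y x))\<^sup>2 \<le> Re (cinner x (Y x))" by simp
  then show ?thesis using K(1) by (simp add: field_simps)
qed

text \<open>
  The infimum \<open>- b\<close> of the form of the inverse of \<open>Y - c\<close> on \<open>W\<close> makes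
  \<open>c - 1/b\<close> an approximate eigenvalue of \<open>Y\<close> on \<open>W\<close>; hence a spectral gap gives
  \<open>Y\<^sup>2 \<ge> c Y\<close> on \<open>W\<close>.
\<close>

lemma gap_form_le:
  fixes Y :: "'a::complex_inner \<Rightarrow> 'a"
  assumes Y: "csym Y" and K: "0 \<le> K" "\<And>w. norm (Y w) \<le> K * norm w"
    and W: "csubspace W" "\<And>w. w \<in> W \<Longrightarrow> Y w \<in> W"
    and c: "0 < c" "\<And>s. 0 < s \<Longrightarrow> s \<le> c \<Longrightarrow> \<exists>d>0. \<forall>x\<in>W. d * norm x \<le> norm (Y x - s *\<^sub>R x)"
    and x: "x \<in> W"
  shows "c * Re (cinner x (Y x)) \<le> (norm (Y x))\<^sup>2"
proof (rule ccontr)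
  assume neg: "\<not> ?thesis"
  note lin = clinearD[OF csym_clinear[OF Y]]
  note sub = csubspaceD[OF W(1)]
  define Z where "Z w = Y w - c *\<^sub>R w" for w
  have Zc: "csym Z"
    by (auto simp: csym_def Z_def cinner_diff_left cinner_diff_right scaleR_scaleC
        cinner_scaleC_left cinner_scaleC_right csymD[OF Y])
  note Zlin = clinearD[OF csym_clinear[OF Zc]]
  have ZW: "Z w \<in> W" if "w \<in> W" for w unfolding Z_def by (intro sub W(2) that)
  obtain d where d: "0 < d" "\<forall>w\<in>W. d * norm w \<le> norm (Z w)"
    using c(2)[OF c(1) order_refl] by (auto simp: Z_def)
  \<comment> \<open>With v = Z w, the quantity maximised is the form of the inverse of -Z at unit
    vectors v; working with w avoids inverting \<open>Z\<close>.\<close>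
  define V where "V = {w\<in>W. norm (Z w) = 1}"
  define b where "b = (SUP w\<in>V. - Re (cinner w (Z w)))"
  have "- Re (cinner w (Z w)) \<le> 1 / d" if "w \<in> V" for w
  proof -
    have "d * norm w \<le> 1" using that d by (auto simp: V_def)
    then have "norm w \<le> 1 / d" using d(1) by (simp add: field_simps)
    moreover have "- Re (cinner w (Z w)) \<le> norm w * norm (Z w)"
      using cmod_cinner_le[of w "Z w"] abs_Re_le_cmod[of "cinner w (Z w)"] by linarith
    ultimately show ?thesis using that by (simp add: V_def)
  qed
  then have bdd: "bdd_above ((\<lambda>w. - Re (cinner w (Z w))) ` V)"
    by (rule bdd_aboveI2)
  have le_b: "- Re (cinner w (Z w)) \<le> b" if "w \<in> V" for w
    unfolding b_def by (rule cSUP_upper[OF that bdd])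
  have le_b': "- Re (cinner w (Z w)) \<le> b * (norm (Z w))\<^sup>2" if w: "w \<in> W" for w
  proof (cases "Z w = 0")
    case False
    define r where "r = norm (Z w)"
    have r: "r > 0" using False by (simp add: r_def)
    have "(1/r) *\<^sub>R w \<in> V"
      using w r by (simp add: V_def sub Zlin) (simp add: r_def)
    from le_b[OF this] have "- Re (cinner w (Z w)) / r\<^sup>2 \<le> b"
      by (simp add: Zlin scaleR_scaleC cinner_scaleC_left cinner_scaleC_right power2_eq_square)
    then show ?thesis using r by (simp add: r_def field_simps)
  qed simp
  have Zx: "(norm (Z x))\<^sup>2 + c * Re (cinner x (Z x)) < 0"
  proof -
    have "(norm (Z x))\<^sup>2 + c * Re (cinner x (Z x)) = (norm (Y x))\<^sup>2 - c * Re (cinner x (Y x))"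
      unfolding Z_def norm_diff_cinner
      by (simp add: scaleR_scaleC cinner_scaleC_right cinner_diff_right Re_cinner_self
          Re_cinner_commute[of "Y x" x] power_mult_distrib norm_scaleC power2_eq_square
          algebra_simps)
    then show ?thesis using neg by simp
  qed
  then have xpos: "0 < - Re (cinner x (Z x))"
    using c(1) zero_le_power2[of "norm (Z x)"] by (smt (verit) mult_nonneg_nonneg)
  then have "Z x \<noteq> 0" by auto
  then have Zx0: "0 < (norm (Z x))\<^sup>2" by simp
  have "(norm (Z x))\<^sup>2 < c * (b * (norm (Z x))\<^sup>2)"
    using Zx mult_left_mono[OF le_b'[OF x], of c] c(1) by simp
  then have cb: "1 < c * b" using Zx0 by simp
  then have b: "0 < b" using c(1) by (smt (verit) mult_nonneg_nonpos)
  \<comment> \<open>The bound 1 < c b places s in the gap (0, c].\<close>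
  define s where "s = c - 1 / b"
  have s: "0 < s" "s \<le> c" using cb b by (auto simp: s_def field_simps)
  obtain d' where d': "0 < d'" "\<forall>w\<in>W. d' * norm w \<le> norm (Y w - s *\<^sub>R w)"
    using c(2)[OF s] by auto
  \<comment> \<open>\<open>X\<close> is nonnegative on \<open>W\<close> by the choice of
    \<open>b\<close>, and it factors as b (Y - s) Z because Z + 1/b = Y - s.\<close>
  define X where "X w = b *\<^sub>R Z (Z w) + Z w" for w
  have Xc: "csym X"
    by (auto simp: csym_def X_def cinner_add_left cinner_add_right scaleR_scaleC
        cinner_scaleC_left cinner_scaleC_right csymD[OF Zc])
  have XW: "X w \<in> W" if "w \<in> W" for w unfolding X_def by (intro sub ZW that)
  have Xpos: "0 \<le> Re (cinner w (X w))" if "w \<in> W" for w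
  proof -
    have "Re (cinner w (X w)) = b * (norm (Z w))\<^sup>2 + Re (cinner w (Z w))"
      by (simp add: X_def cinner_add_right scaleR_scaleC cinner_scaleC_right
          csymD[OF Zc, symmetric] cinner_self)
    then show ?thesis using le_b'[OF that] by simp
  qed
  define KZ where "KZ = K + c"
  have KZ: "norm (Z w) \<le> KZ * norm w" for w
    using norm_triangle_ineq4[of "Y w" "c *\<^sub>R w"] K(2)[of w] c(1)
    by (simp add: Z_def KZ_def distrib_right)
  have KZ0: "0 \<le> KZ" using K c by (simp add: KZ_def)
  define KX where "KX = b * (KZ * KZ) + KZ + 1"
  have KX0: "0 < KX" using b KZ0 by (simp add: KX_def add_nonneg_pos)
  have KX: "norm (X w) \<le> KX * norm w" for w
  proof -
    have "norm (X w) \<le> b * norm (Z (Z w)) + norm (Z w)"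
      unfolding X_def using norm_triangle_ineq[of "b *\<^sub>R Z (Z w)" "Z w"] b by simp
    also have "\<dots> \<le> b * (KZ * (KZ * norm w)) + KZ * norm w"
      by (intro add_mono mult_left_mono order_trans[OF KZ[of "Z w"]] KZ) (use b KZ0 in auto)
    also have "\<dots> \<le> KX * norm w" by (simp add: KX_def algebra_simps)
    finally show ?thesis .
  qed
  have low: "(b * d')\<^sup>2 \<le> KX * Re (cinner w (X w))" if w: "w \<in> V" for w
  proof -
    have wW: "w \<in> W" and Zw: "norm (Z w) = 1" using w by (auto simp: V_def)
    have "X w = b *\<^sub>R (Y (Z w) - s *\<^sub>R Z w)"
      using b unfolding X_def Z_def[of "Z w"] s_def by (simp add: algebra_simps)
    then have "norm (X w) = b * norm (Y (Z w) - s *\<^sub>R Z w)" using b by simp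
    moreover have "d' \<le> norm (Y (Z w) - s *\<^sub>R Z w)"
      using d'(2) ZW[OF wW] Zw by force
    ultimately have "b * d' \<le> norm (X w)" using b by simp
    then have "(b * d')\<^sup>2 \<le> (norm (X w))\<^sup>2"
      using b d'(1) by (intro power_mono) auto
    also have "\<dots> \<le> KX * Re (cinner w (X w))"
      by (rule csym_nonneg_norm_le[OF Xc Xpos W(1) XW KX0 KX wW])
    finally show ?thesis .
  qed
  \<comment> \<open>The gap at \<open>s\<close> keeps the form of \<open>X\<close> at or above
    \<epsilon> on \<open>V\<close>, whereas a \<open>w\<close> within \<epsilon> of the supremum
    \<open>b\<close> makes it smaller.\<close>
  define \<epsilon> where "\<epsilon> = (b * d')\<^sup>2 / KX"
  have e: "0 < \<epsilon>" using b d'(1) KX0 by (simp add: \<epsilon>_def)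
  have "(1 / norm (Z x)) *\<^sub>R x \<in> V"
    using x \<open>Z x \<noteq> 0\<close> by (simp add: V_def sub Zlin)
  then have ne: "V \<noteq> {}" by auto
  obtain w where w: "w \<in> V" "b - \<epsilon> < - Re (cinner w (Z w))"
    using less_cSUP_iff[OF ne bdd, of "b - \<epsilon>"] e by (auto simp: b_def)
  have "Re (cinner w (X w)) = b * (norm (Z w))\<^sup>2 + Re (cinner w (Z w))"
    by (simp add: X_def cinner_add_right scaleR_scaleC cinner_scaleC_right
        csymD[OF Zc, symmetric] cinner_self)
  then have "Re (cinner w (X w)) < \<epsilon>" using w by (simp add: V_def)
  then have "KX * Re (cinner w (X w)) < (b * d')\<^sup>2"
    using KX0 by (simp add: \<epsilon>_def field_simps)
  then show False using low[OF w(1)] by simp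
qed

text \<open>On the range of \<open>Y\<close> the bound comes from positivity at w - Y w / c together
  with \<open>gap_form_le\<close>. The range is dense in \<open>W\<close>, since a vector of
  \<open>W\<close> orthogonal to it is killed by \<open>Y\<close> and hence zero; continuity does
  the rest.\<close>

lemma gap_bounded_below:
  fixes Y :: "'a::chilbert_space \<Rightarrow> 'a"
  assumes Y: "csym Y" and K: "0 \<le> K" "\<And>w. norm (Y w) \<le> K * norm w"
    and W: "csubspace W" "closed W" "\<And>w. w \<in> W \<Longrightarrow> Y w \<in> W"
    and pos: "\<And>w. w \<in> W \<Longrightarrow> 0 \<le> Re (cinner w (Y w))"
    and ker: "\<And>w. w \<in> W \<Longrightarrow> Y w = 0 \<Longrightarrow> w = 0"
    and c: "0 < c" "\<And>s. 0 < s \<Longrightarrow> s \<le> c \<Longrightarrow> \<exists>d>0. \<forall>x\<in>W. d * norm x \<le> norm (Y x - s *\<^sub>R x)"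
    and x: "x \<in> W"
  shows "c * (norm x)\<^sup>2 \<le> Re (cinner x (Y x))"
proof -
  note lin = clinearD[OF csym_clinear[OF Y]]
  note sub = csubspaceD[OF W(1)]
  have range: "c * (norm (Y w))\<^sup>2 \<le> Re (cinner (Y w) (Y (Y w)))" if w: "w \<in> W" for w
  proof -
    have "w - (1/c) *\<^sub>R Y w \<in> W" by (intro sub W(3) w)
    from pos[OF this] have "0 \<le> Re (cinner w (Y w)) - 2 * (1/c) * (norm (Y w))\<^sup>2
        + (1/c)\<^sup>2 * Re (cinner (Y w) (Y (Y w)))"
      unfolding csym_quadratic[OF Y] Re_cinner_self .
    moreover have "Re (cinner w (Y w)) \<le> (1/c) * (norm (Y w))\<^sup>2"
      using gap_form_le[OF Y K W(1,3) c w] c(1) by (simp add: field_simps)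
    ultimately have "(1/c) * (norm (Y w))\<^sup>2 \<le> (1/c)\<^sup>2 * Re (cinner (Y w) (Y (Y w)))"
      by simp
    then show ?thesis using c(1) by (simp add: power2_eq_square field_simps)
  qed
  define L where "L = closure (Y ` W)"
  have YW: "csubspace (Y ` W)"
  proof (rule cvec.subspaceI)
    show "0 \<in> Y ` W" using sub(1) lin(3) by force
    show "a + b \<in> Y ` W" if "a \<in> Y ` W" "b \<in> Y ` W" for a b
      using that sub(2) lin(1) by (metis (no_types, lifting) image_iff)
    show "k *\<^sub>C a \<in> Y ` W" if "a \<in> Y ` W" for k a
      using that sub(4) lin(2) by (metis (no_types, lifting) image_iff)
  qed
  have cL: "csubspace L"
  proof (rule cvec.subspaceI)
    show "0 \<in> L" unfolding L_def using csubspaceD(1)[OF YW] closure_subset by (rule rev_subsetD)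
    show "a + b \<in> L" if ab: "a \<in> L" "b \<in> L" for a b
    proof -
      obtain f g where "\<forall>n. f n \<in> Y ` W" "f \<longlonglongrightarrow> a" "\<forall>n. g n \<in> Y ` W" "g \<longlonglongrightarrow> b"
        using ab unfolding L_def closure_sequential by blast
      then show ?thesis
        unfolding L_def closure_sequential
        by (intro exI[of _ "\<lambda>n. f n + g n"]) (auto intro!: csubspaceD(2)[OF YW] tendsto_add)
    qed
    show "k *\<^sub>C a \<in> L" if ab: "a \<in> L" for k a
    proof -
      obtain f where "\<forall>n. f n \<in> Y ` W" "f \<longlonglongrightarrow> a"
        using ab unfolding L_def closure_sequential by blast
      then show ?thesis
        unfolding L_def closure_sequential
        by (intro exI[of _ "\<lambda>n. k *\<^sub>C f n"])
          (auto intro!: csubspaceD(4)[OF YW] tendsto_intros)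
    qed
  qed
  obtain p where p: "p \<in> L" "\<And>y. y \<in> L \<Longrightarrow> cinner y (x - p) = 0"
    using orthogonal_decomposition[OF cL, of x] by (auto simp: L_def)
  have "L \<subseteq> W" unfolding L_def using W(2,3) by (intro closure_minimal) auto
  then have xp: "x - p \<in> W" using p(1) x sub(3) by blast
  have "Y (Y (x - p)) \<in> L"
    using W(3)[OF xp] closure_subset[of "Y ` W"] by (auto simp: L_def)
  then have "cinner (Y (x - p)) (Y (x - p)) = 0"
    using p(2) csymD[OF Y, of "Y (x - p)" "x - p"] by simp
  then have "x = p" using ker[OF xp] by (simp add: cinner_self_eq_0_iff)
  then have xL: "x \<in> closure (Y ` W)" using p(1) by (simp add: L_def)
  obtain f where f: "\<forall>n. f n \<in> Y ` W" "f \<longlonglongrightarrow> x"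
    using xL unfolding closure_sequential by blast
  have bl: "bounded_linear Y" by (rule csym_bounded_linear[OF Y K(2)])
  show ?thesis
  proof (rule LIMSEQ_le)
    show "(\<lambda>n. c * (norm (f n))\<^sup>2) \<longlonglongrightarrow> c * (norm x)\<^sup>2"
      by (intro tendsto_intros f)
    show "(\<lambda>n. Re (cinner (f n) (Y (f n)))) \<longlonglongrightarrow> Re (cinner x (Y x))"
      by (intro tendsto_intros bounded_linear.tendsto[OF bl] f)
    have "c * (norm (f n))\<^sup>2 \<le> Re (cinner (f n) (Y (f n)))" for n
    proof -
      obtain w where "w \<in> W" "f n = Y w" using f(1) by blast
      then show ?thesis using range[of w] by simp
    qed
    then show "\<exists>N. \<forall>n\<ge>N. c * (norm (f n))\<^sup>2 \<le> Re (cinner (f n) (Y (f n)))" by blast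
  qed
qed

section \<open>Unbounded self-adjoint operators\<close>

lemma selfadjointD:
  assumes "selfadjoint D T"
  shows "csubspace D" "closure D = UNIV"
    "\<And>x y. x \<in> D \<Longrightarrow> y \<in> D \<Longrightarrow> T (x + y) = T x + T y"
    "\<And>c x. x \<in> D \<Longrightarrow> T (c *\<^sub>C x) = c *\<^sub>C T x"
    "\<And>x y. x \<in> D \<Longrightarrow> y \<in> D \<Longrightarrow> cinner (T x) y = cinner x (T y)"
    "\<And>x y. x \<in> D \<Longrightarrow> y \<in> D \<Longrightarrow> T (x - y) = T x - T y" "T 0 = 0"
proof -
  note d = assms[unfolded selfadjoint_def]
  show c: "csubspace D" and "closure D = UNIV"
    and add: "\<And>x y. x \<in> D \<Longrightarrow> y \<in> D \<Longrightarrow> T (x + y) = T x + T y"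
    and scal: "\<And>c x. x \<in> D \<Longrightarrow> T (c *\<^sub>C x) = c *\<^sub>C T x"
    using d by blast+
  show "cinner (T x) y = cinner x (T y)" if "x \<in> D" "y \<in> D" for x y
  proof -
    have "(x, T x) \<in> adjoint_graph D T" using d that by blast
    then show ?thesis using that by (simp add: adjoint_graph_def)
  qed
  show "T (x - y) = T x - T y" if "x \<in> D" "y \<in> D" for x y
    using add[of "x - y" y] that csubspaceD(3)[OF c] by simp
  show "T 0 = 0"
    using scal[of 0 0] csubspaceD(1)[OF c] by simp
qed

text \<open>Self-adjointness beyond symmetry enters through this rule: limits and solutions of weak
  equations are shown to lie in \<open>D\<close> by it.\<close>

lemma selfadjoint_maximal:
  assumes "selfadjoint D T" "\<And>x. x \<in> D \<Longrightarrow> cinner y (T x) = cinner z x"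
  shows "y \<in> D" "T y = z"
proof -
  have "(y, z) \<in> adjoint_graph D T" using assms(2) by (simp add: adjoint_graph_def)
  then have "(y, z) \<in> (\<lambda>x. (x, T x)) ` D" using assms(1) by (simp add: selfadjoint_def)
  then show "y \<in> D" "T y = z" by auto
qed

text \<open>In the adjoint identity for the sum, \<open>S\<close> moves across the inner product,
  which leaves the identity for \<open>T\<close> with the value \<open>z - S y\<close>.\<close>

lemma selfadjoint_add_csym:
  assumes T: "selfadjoint D T" and S: "csym S"
  shows "selfadjoint D (\<lambda>x. T x + S x)"
proof -
  note lin = clinearD[OF csym_clinear[OF S]]
  note d = selfadjointD[OF T]
  have "adjoint_graph D (\<lambda>x. T x + S x) = (\<lambda>x. (x, T x + S x)) ` D"
  proof (intro equalityI subsetI)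
    fix p assume "p \<in> adjoint_graph D (\<lambda>x. T x + S x)"
    then obtain y z where p: "p = (y, z)" "\<forall>x\<in>D. cinner y (T x + S x) = cinner z x"
      by (auto simp: adjoint_graph_def)
    have "cinner y (T x) = cinner (z - S y) x" if "x \<in> D" for x
      using p(2) that by (simp add: cinner_add_right cinner_diff_left csymD[OF S] eq_diff_eq)
    from selfadjoint_maximal[OF T this] show "p \<in> (\<lambda>x. (x, T x + S x)) ` D"
      by (simp add: p(1) image_iff)
  next
    fix p assume "p \<in> (\<lambda>x. (x, T x + S x)) ` D"
    then show "p \<in> adjoint_graph D (\<lambda>x. T x + S x)"
      by (auto simp: adjoint_graph_def cinner_add_left cinner_add_right d(5) csymD[OF S])
  qed
  then show ?thesis
    unfolding selfadjoint_def using d lin by (simp add: scaleC_add_right)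
qed

text \<open>The lower bound makes T - z injective and, as \<open>T\<close> is closed, gives it a
  closed range. A vector orthogonal to the range lies in \<open>D\<close> and in the kernel of T -
  z, so it vanishes and the range is everything.\<close>

lemma resolvent_exists:
  fixes T :: "'a::chilbert_space \<Rightarrow> 'a"
  assumes T: "selfadjoint D T"
    and d: "0 < d" "\<And>x. x \<in> D \<Longrightarrow> d * norm x \<le> norm (T x - z *\<^sub>R x)"
  obtains G where "csym G" "\<And>y. G y \<in> D" "\<And>y. T (G y) - z *\<^sub>R G y = y"
    "\<And>x. x \<in> D \<Longrightarrow> G (T x - z *\<^sub>R x) = x" "\<And>y. norm (G y) \<le> (1 / d) * norm y"
proof -
  note t = selfadjointD[OF T]
  note sub = csubspaceD[OF t(1)]
  define Q where "Q x = T x - z *\<^sub>R x" for x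
  have Qadd: "Q (x + y) = Q x + Q y" and Qdiff: "Q (x - y) = Q x - Q y"
    and Qsym: "cinner (Q x) y = cinner x (Q y)" if "x \<in> D" "y \<in> D" for x y
    using that by (simp_all add: Q_def t scaleR_scaleC scaleC_add_right
        cvec.scale_right_diff_distrib cinner_diff_left cinner_diff_right cinner_scaleC_left
        cinner_scaleC_right)
  have Qscal: "Q (k *\<^sub>C x) = k *\<^sub>C Q x" if "x \<in> D" for k x
    using that by (simp add: Q_def t scaleR_scaleC cvec.scale_right_diff_distrib scaleC_scaleC
        mult.commute)
  have Qd: "d * norm x \<le> norm (Q x)" if "x \<in> D" for x
    using d(2)[OF that] by (simp add: Q_def)
  have R: "csubspace (Q ` D)"
  proof (rule cvec.subspaceI)
    show "0 \<in> Q ` D" by (rule image_eqI[of _ _ 0]) (simp_all add: Q_def t sub)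
    show "a + b \<in> Q ` D" if "a \<in> Q ` D" "b \<in> Q ` D" for a b
      using that sub(2) Qadd by (metis (no_types, lifting) image_iff)
    show "k *\<^sub>C a \<in> Q ` D" if "a \<in> Q ` D" for k a
      using that sub(4) Qscal by (metis (no_types, lifting) image_iff)
  qed
  have "closed (Q ` D)"
    unfolding closed_sequential_limits
  proof (intro allI impI)
    fix f l assume f: "(\<forall>n. f n \<in> Q ` D) \<and> f \<longlonglongrightarrow> l"
    have "\<exists>x. x \<in> D \<and> f n = Q x" for n using f by blast
    then obtain x where x: "\<And>n. x n \<in> D" "\<And>n. f n = Q (x n)" by metis
    have "Cauchy x"
    proof (rule CauchyI)
      fix e :: real assume e: "0 < e"
      have "Cauchy f" using f LIMSEQ_imp_Cauchy by blast
      then obtain M where M: "\<And>m n. m \<ge> M \<Longrightarrow> n \<ge> M \<Longrightarrow> norm (f m - f n) < d * e"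
        using CauchyD[of f "d * e"] e d(1) by auto
      have "norm (x m - x n) < e" if "m \<ge> M" "n \<ge> M" for m n
      proof -
        have "d * norm (x m - x n) \<le> norm (f m - f n)"
          using Qd[of "x m - x n"] by (simp add: x Qdiff sub)
        then have "d * norm (x m - x n) < d * e" using M[OF that] by linarith
        then show ?thesis using d(1) by simp
      qed
      then show "\<exists>M. \<forall>m\<ge>M. \<forall>n\<ge>M. norm (x m - x n) < e" by blast
    qed
    then obtain w where w: "x \<longlonglongrightarrow> w" by (auto simp: Cauchy_convergent_iff convergent_def)
    have *: "cinner w (T v) = cinner (l + z *\<^sub>R w) v" if v: "v \<in> D" for v
    proof -
      have "(\<lambda>n. cinner (x n) (T v)) \<longlonglongrightarrow> cinner w (T v)"
        by (intro tendsto_intros w)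
      moreover have "cinner (x n) (T v) = cinner (f n + z *\<^sub>R x n) v" for n
        using t(5)[OF x(1) v, of n] by (simp add: x(2) Q_def)
      moreover have "(\<lambda>n. cinner (f n + z *\<^sub>R x n) v) \<longlonglongrightarrow> cinner (l + z *\<^sub>R w) v"
        using f by (intro tendsto_intros w) auto
      ultimately show ?thesis using LIMSEQ_unique by simp
    qed
    have "w \<in> D" "T w = l + z *\<^sub>R w"
      using selfadjoint_maximal[OF T *] by auto
    then show "l \<in> Q ` D" by (intro image_eqI[of _ _ w]) (simp_all add: Q_def)
  qed
  have surj: "y \<in> Q ` D" for y
  proof -
    obtain p where p: "p \<in> Q ` D" "\<And>q. q \<in> Q ` D \<Longrightarrow> cinner q (y - p) = 0"
      using orthogonal_decomposition[OF R \<open>closed (Q ` D)\<close>, of y] by auto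
    define u where "u = y - p"
    have *: "cinner u (T x) = cinner (z *\<^sub>R u) x" if "x \<in> D" for x
    proof -
      have "cinner (Q x) u = 0" using p(2) that by (simp add: u_def)
      then have "cinner u (Q x) = 0" using cinner_commute[of u "Q x"] by simp
      then show ?thesis
        by (simp add: Q_def cinner_diff_right scaleR_scaleC cinner_scaleC_left cinner_scaleC_right)
    qed
    have u: "u \<in> D" "T u = z *\<^sub>R u"
      using selfadjoint_maximal[OF T *] by auto
    then have "d * norm u \<le> 0" using Qd[OF u(1)] by (simp add: Q_def)
    then have "u = 0" using d(1) by (simp add: mult_le_0_iff)
    then show ?thesis using p(1) by (simp add: u_def)
  qed
  have inj: "inj_on Q D"
  proof (rule inj_onI)
    fix x y assume xy: "x \<in> D" "y \<in> D" "Q x = Q y"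
    then have "d * norm (x - y) \<le> 0" using Qd[of "x - y"] by (simp add: Qdiff sub)
    then show "x = y" using d(1) by (simp add: mult_le_0_iff)
  qed
  define G where "G = inv_into D Q"
  have G1: "G y \<in> D" for y unfolding G_def by (rule inv_into_into[OF surj])
  have G2: "Q (G y) = y" for y unfolding G_def by (rule f_inv_into_f[OF surj])
  have G3: "G (Q x) = x" if "x \<in> D" for x unfolding G_def by (rule inv_into_f_f[OF inj that])
  have "csym G"
    unfolding csym_def
  proof (intro allI)
    fix x y
    show "cinner (G x) y = cinner x (G y)"
      using Qsym[OF G1 G1, of x y] by (simp add: G2)
  qed
  moreover have "norm (G y) \<le> (1 / d) * norm y" for y
    using Qd[OF G1, of y] d(1) by (simp add: G2 field_simps)
  ultimately show ?thesis
    using that[of G] G1 G2 G3 unfolding Q_def by blast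
qed

text \<open>The margin of 1 between \<open>z\<close> and the lower bound of the form is a
  normalisation that makes the resolvent a contraction. Positivity holds because, with y = (T - z) G
  y, the form of \<open>G\<close> at y is at least |G y|^2.\<close>

lemma form_resolvent:
  fixes T :: "'a::chilbert_space \<Rightarrow> 'a"
  assumes T: "selfadjoint D T"
    and form: "\<And>x. x \<in> D \<Longrightarrow> (z + 1) * (norm x)\<^sup>2 \<le> Re (cinner x (T x))"
  obtains G where "csym G" "\<And>y. G y \<in> D" "\<And>y. T (G y) - z *\<^sub>R G y = y"
    "\<And>x. x \<in> D \<Longrightarrow> G (T x - z *\<^sub>R x) = x" "\<And>y. norm (G y) \<le> norm y"
    "\<And>y. 0 \<le> Re (cinner y (G y))"
proof -
  have low: "(norm x)\<^sup>2 \<le> Re (cinner x (T x - z *\<^sub>R x))" if "x \<in> D" for x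
    using form[OF that] by (simp add: cinner_diff_right scaleR_scaleC cinner_scaleC_right
        cinner_self algebra_simps)
  have "1 * norm x \<le> norm (T x - z *\<^sub>R x)" if "x \<in> D" for x
  proof (cases "x = 0")
    case False
    have "norm x * norm x \<le> norm x * norm (T x - z *\<^sub>R x)"
      using low[OF that] Re_cinner_le[of x "T x - z *\<^sub>R x"] by (simp add: power2_eq_square)
    then show ?thesis using False by simp
  qed simp
  from resolvent_exists[OF T zero_less_one this]
  obtain G where G: "csym G" "\<And>y. G y \<in> D" "\<And>y. T (G y) - z *\<^sub>R G y = y"
    "\<And>x. x \<in> D \<Longrightarrow> G (T x - z *\<^sub>R x) = x" "\<And>y. norm (G y) \<le> (1 / 1) * norm y"
    by blast
  have pos: "0 \<le> Re (cinner y (G y))" for y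
    using low[OF G(2), of y] zero_le_power2[of "norm (G y)"] Re_cinner_commute[of y "G y"]
    unfolding G(3) by linarith
  have "norm (G y) \<le> norm y" for y using G(5)[of y] by simp
  then show ?thesis by (intro that[OF G(1-4)] pos)
qed

section \<open>Discreteness in min-max form and bases of eigenvectors\<close>

text \<open>
  Discreteness below every level in min-max form; unlike the spectral definition, it passes to
  finite rank perturbations at once.
\<close>

definition form_discrete :: "'a::complex_inner set \<Rightarrow> ('a \<Rightarrow> 'a) \<Rightarrow> bool"
  where "form_discrete D T \<longleftrightarrow> (\<forall>l::real. \<exists>F. finite F \<and>
    (\<forall>x\<in>D \<inter> ocomp F. l * (norm x)\<^sup>2 \<le> Re (cinner x (T x))))"

text \<open>Adjoining finitely many vectors to \<open>F\<close> forces \<open>S x = 0\<close> on the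
  complement, where the two forms then agree.\<close>

lemma form_discrete_add:
  assumes T: "form_discrete D T" and S: "csym S" "finite_rank S"
  shows "form_discrete D (\<lambda>x. T x + S x)"
  unfolding form_discrete_def
proof
  fix l :: real
  obtain F where F: "finite F" "\<forall>x\<in>D \<inter> ocomp F. l * (norm x)\<^sup>2 \<le> Re (cinner x (T x))"
    using T unfolding form_discrete_def by blast
  obtain F' K where F': "finite F'" "orthonormal F' (\<lambda>x. x)" "range S \<subseteq> cspan F'" "0 \<le> K"
      "\<And>x. norm (S x) \<le> K * norm x" "\<And>y. y \<in> ocomp (S ` F') \<Longrightarrow> S y = 0"
    using finite_rank_csym_bound[OF S] by metis
  have "l * (norm x)\<^sup>2 \<le> Re (cinner x (T x + S x))" if "x \<in> D \<inter> ocomp (F \<union> S ` F')" for x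
  proof -
    have "x \<in> D \<inter> ocomp F" "x \<in> ocomp (S ` F')" using that by (auto simp: ocomp_def)
    then show ?thesis using F(2) F'(6) by (simp add: cinner_add_right)
  qed
  then show "\<exists>F. finite F \<and> (\<forall>x\<in>D \<inter> ocomp F. l * (norm x)\<^sup>2 \<le> Re (cinner x (T x + S x)))"
    using F(1) F'(1) by (intro exI[of _ "F \<union> S ` F'"]) simp
qed

lemma bounded_from_below_add:
  assumes T: "bounded_from_below D T" and S: "csym S" "finite_rank S"
  shows "bounded_from_below D (\<lambda>x. T x + S x)"
proof -
  obtain c :: real where c: "\<forall>x\<in>D. c * (norm x)\<^sup>2 \<le> Re (cinner x (T x))"
    using T unfolding bounded_from_below_def by blast
  obtain F' K where F': "finite F'" "orthonormal F' (\<lambda>x. x)" "range S \<subseteq> cspan F'" "0 \<le> K"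
      "\<And>x. norm (S x) \<le> K * norm x" "\<And>y. y \<in> ocomp (S ` F') \<Longrightarrow> S y = 0"
    using finite_rank_csym_bound[OF S] by metis
  have "(c - K) * (norm x)\<^sup>2 \<le> Re (cinner x (T x + S x))" if "x \<in> D" for x
  proof -
    have "- Re (cinner x (S x)) \<le> norm x * norm (S x)"
      using cmod_cinner_le[of x "S x"] abs_Re_le_cmod[of "cinner x (S x)"] by linarith
    also have "\<dots> \<le> norm x * (K * norm x)" by (intro mult_left_mono F'(5)) simp
    finally have "- Re (cinner x (S x)) \<le> K * (norm x)\<^sup>2"
      by (simp add: power2_eq_square mult_ac)
    moreover have "c * (norm x)\<^sup>2 \<le> Re (cinner x (T x))" using c that by blast
    ultimately show ?thesis by (simp add: cinner_add_right left_diff_distrib)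
  qed
  then show ?thesis unfolding bounded_from_below_def by blast
qed

lemma eigen_form_sums:
  fixes e :: "nat \<Rightarrow> 'a::chilbert_space"
  assumes T: "selfadjoint D T" and e: "onb e"
    and eig: "\<And>n. e n \<in> D" "\<And>n. T (e n) = lam n *\<^sub>R e n" and x: "x \<in> D"
  shows "(\<lambda>n. complex_of_real (lam n * (cmod (cinner (e n) x))\<^sup>2)) sums cinner x (T x)"
proof -
  have "cinner x (e n) * cinner (e n) (T x)
      = complex_of_real (lam n * (cmod (cinner (e n) x))\<^sup>2)" for n
  proof -
    have "cinner (e n) (T x) = complex_of_real (lam n) * cinner (e n) x"
      using selfadjointD(5)[OF T eig(1)[of n] x]
      by (simp add: eig scaleR_scaleC cinner_scaleC_left)
    then show ?thesis
      using complex_norm_square[of "cinner (e n) x"] by (simp add: cnj_cinner mult_ac)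
  qed
  then show ?thesis
    using onb_parseval[OF e, of x "T x"] by simp
qed

lemma csym_diagonal:
  "csym (\<lambda>x. \<Sum>i\<in>I. (complex_of_real (\<mu> i) * cinner (b i) x) *\<^sub>C b i)"
  by (simp add: csym_def cinner_sum_left cinner_sum_right cinner_scaleC_left cinner_scaleC_right
      cnj_cinner mult_ac)

lemma finite_rank_sum:
  assumes "finite I"
  shows "finite_rank (\<lambda>x. \<Sum>i\<in>I. c i x *\<^sub>C b i)"
proof -
  have "(\<Sum>i\<in>I. c i x *\<^sub>C b i) \<in> cspan (b ` I)" for x
    by (intro cvec.span_sum cvec.span_scale, rule cvec.span_base, rule imageI)
  then show ?thesis
    unfolding finite_rank_def cfinite_dim_def using assms
    by (intro exI[of _ "b ` I"]) auto
qed

text \<open>The resolvent \<open>G\<close> at a point below the form is compact, so the eigenvectors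
  of \<open>T\<close> can be exhausted: if a maximal orthonormal set of them were not total, its
  complement would contain an eigenvector of \<open>G\<close> for some \<nu>, which is one of
  \<open>T\<close> for z + 1/\<nu>.\<close>

lemma form_discrete_eigenbasis:
  fixes T :: "'a::chilbert_space \<Rightarrow> 'a"
  assumes T: "selfadjoint D T" and bb: "bounded_from_below D T" and fd: "form_discrete D T"
    and inf: "\<not> cfinite_dim (UNIV :: 'a set)" and S: "countable S" "ctotal (S :: 'a set)"
  obtains e lam where "onb e" "\<And>n. e n \<in> D" "\<And>n. T (e n) = lam n *\<^sub>R e n"
    "\<And>l::real. finite {n. lam n < l}"
proof -
  note t = selfadjointD[OF T]
  note sub = csubspaceD[OF t(1)]
  obtain c :: real where c: "\<forall>x\<in>D. c * (norm x)\<^sup>2 \<le> Re (cinner x (T x))"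
    using bb unfolding bounded_from_below_def by blast
  define z where "z = c - 1"
  have "(z + 1) * (norm x)\<^sup>2 \<le> Re (cinner x (T x))" if "x \<in> D" for x
    using c that by (simp add: z_def)
  from form_resolvent[OF T this]
  obtain G where G: "csym G" "\<And>y. G y \<in> D" "\<And>y. T (G y) - z *\<^sub>R G y = y"
    "\<And>x. x \<in> D \<Longrightarrow> G (T x - z *\<^sub>R x) = x" "\<And>y. norm (G y) \<le> norm y"
    "\<And>y. 0 \<le> Re (cinner y (G y))"
    by metis
  note glin = clinearD[OF csym_clinear[OF G(1)]]
  have comp: "compact_like G"
    unfolding compact_like_def
  proof (intro allI impI)
    fix r :: real assume r: "0 < r"
    \<comment> \<open>At level z + 1/r the form of T - z exceeds 1/r off \<open>F\<close>, hence
      \<open>G\<close> is bounded by r on the vectors that it maps into the complement of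
      \<open>F\<close>.\<close>
    obtain F where F: "finite F"
        "\<forall>x\<in>D \<inter> ocomp F. (z + 1 / r) * (norm x)\<^sup>2 \<le> Re (cinner x (T x))"
      using fd unfolding form_discrete_def by blast
    have "norm (G y) \<le> r * norm y" if y: "y \<in> ocomp (G ` F)" for y
    proof (cases "G y = 0")
      case False
      have "G y \<in> D \<inter> ocomp F"
        using y G(2) by (auto simp: ocomp_def csymD[OF G(1)])
      then have "(z + 1 / r) * (norm (G y))\<^sup>2 \<le> Re (cinner (G y) (T (G y)))"
        using F(2) by blast
      then have "1 / r * (norm (G y))\<^sup>2 \<le> Re (cinner (G y) (T (G y) - z *\<^sub>R G y))"
        by (simp add: cinner_diff_right scaleR_scaleC cinner_scaleC_right cinner_self
            distrib_right)
      also have "\<dots> \<le> norm (G y) * norm y"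
        unfolding G(3) by (rule Re_cinner_le)
      finally have "norm (G y) * (norm (G y)) \<le> norm (G y) * (r * norm y)"
        using r by (simp add: power2_eq_square field_simps)
      then show ?thesis using False by simp
    qed (use r in simp)
    then show "\<exists>F. finite F \<and> (\<forall>y\<in>ocomp F. norm (G y) \<le> r * norm y)"
      using F(1) by (intro exI[of _ "G ` F"]) simp
  qed
  define X where "X = {x\<in>D. \<exists>\<mu>::real. T x = \<mu> *\<^sub>R x}"
  obtain M where M: "{} \<subseteq> M" "M \<subseteq> X" "orthonormal M (\<lambda>x. x)"
      "\<forall>x\<in>X. norm x = 1 \<longrightarrow> (\<exists>m\<in>M. cinner m x \<noteq> 0)"
    by (rule orthonormal_maximal[of "{}" X]) (auto simp: orthonormal_def)
  have inv: "G y \<in> ocomp M" if y: "y \<in> ocomp M" for y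
    unfolding ocomp_def
  proof (intro CollectI ballI)
    fix m assume m: "m \<in> M"
    then obtain \<mu> :: real where mD: "m \<in> D" and \<mu>: "T m = \<mu> *\<^sub>R m"
      using M(2) by (auto simp: X_def)
    have Gm: "(\<mu> - z) *\<^sub>R G m = m"
      using G(4)[OF mD] by (simp add: \<mu> glin scaleR_diff_left[symmetric])
    then have "\<mu> - z \<noteq> 0" using orthonormal_norm[OF M(3) m] by auto
    moreover have "complex_of_real (\<mu> - z) * cinner (G m) y = cinner m y"
      by (subst (2) Gm[symmetric]) (simp add: scaleR_scaleC cinner_scaleC_left)
    ultimately show "cinner m (G y) = 0"
      using y m by (simp add: csymD[OF G(1), symmetric] ocomp_def)
  qed
  have total: "ctotal M"
    unfolding ctotal_def
  proof (intro allI impI, rule ccontr)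
    fix x assume "\<forall>m\<in>M. cinner m x = 0" and x0: "x \<noteq> 0"
    then have xM: "x \<in> ocomp M" by (simp add: ocomp_def)
    have "G x \<noteq> 0" using x0 G(3)[of x] t(7) by auto
    then obtain u \<nu> where u: "u \<in> ocomp M" "norm u = 1" "\<nu> \<noteq> 0" "G u = complex_of_real \<nu> *\<^sub>C u"
      using compact_csym_eigenvector[OF G(1) _ zero_le_one comp csubspace_ocomp closed_ocomp inv xM]
        G(5) by (metis mult_1)
    have Gu: "G u = complex_of_real \<nu> *\<^sub>C u" by (rule u(4))
    have u_eq: "u = complex_of_real (1 / \<nu>) *\<^sub>C G u"
      using u(3) by (simp add: Gu scaleC_scaleC)
    have uD: "u \<in> D" by (subst u_eq) (intro sub G(2))
    have "T (G u) = complex_of_real \<nu> *\<^sub>C T u" unfolding Gu by (rule t(4)[OF uD])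
    then have "complex_of_real \<nu> *\<^sub>C T u = u + z *\<^sub>R (complex_of_real \<nu> *\<^sub>C u)"
      using G(3)[of u] by (simp add: Gu eq_diff_eq diff_eq_eq)
    then have "complex_of_real (1 / \<nu>) *\<^sub>C (complex_of_real \<nu> *\<^sub>C T u)
        = complex_of_real (1 / \<nu>) *\<^sub>C (u + z *\<^sub>R (complex_of_real \<nu> *\<^sub>C u))"
      by simp
    then have "T u = (1 / \<nu> + z) *\<^sub>R u"
      using u(3) by (simp add: scaleC_scaleC scaleC_add_right scaleR_scaleC scaleC_add_left)
    then have "u \<in> X" using uD by (auto simp: X_def)
    then show False using M(4) u(1,2) by (auto simp: ocomp_def)
  qed
  obtain e where e: "onb e" "range e = M"
    using total_set_extend_onb[OF inf orthonormal_countable[OF S M(3)] M(3) total, of 0]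
    by (auto simp: orthonormal_def)
  have eX: "e n \<in> X" for n using e(2) M(2) by auto
  then have "\<forall>n. \<exists>\<mu>::real. T (e n) = \<mu> *\<^sub>R e n" by (auto simp: X_def)
  then obtain lam :: "nat \<Rightarrow> real" where lam: "\<And>n. T (e n) = lam n *\<^sub>R e n" by metis
  have eD: "e n \<in> D" for n using eX[of n] by (simp add: X_def)
  have fin: "finite {n. lam n < l}" for l :: real
  proof -
    define I where "I = {n. lam n < l}"
    obtain F0 where F0: "finite F0" "\<forall>x\<in>D \<inter> ocomp F0. l * (norm x)\<^sup>2 \<le> Re (cinner x (T x))"
      using fd unfolding form_discrete_def by blast
    obtain F where F: "finite F" "orthonormal F (\<lambda>x. x)" "F0 \<subseteq> cspan F" "F \<subseteq> cspan F0"
      by (rule finite_orthonormal_basis[OF F0(1)])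
    \<comment> \<open>The orthogonal projection onto the span of \<open>F\<close>, in the shape of
      \<open>csym_diagonal\<close>. It is injective on the span of the eigenvectors below
      \<open>l\<close>: a nonzero vector there has form less than l |x|^2, while on the kernel of
      \<open>P\<close> in \<open>D\<close> the form is at least that.\<close>
    define P where "P x = (\<Sum>f\<in>F. (complex_of_real 1 * cinner f x) *\<^sub>C f)" for x :: 'a
    have P: "csym P" "finite_rank P"
      unfolding P_def by (rule csym_diagonal, rule finite_rank_sum[OF F(1)])
    have "x = 0" if x: "x \<in> cspan (e ` I)" and Px: "P x = 0" for x
    proof (rule onb_total[OF e(1)])
      fix n
      have "cinner f x = 0" if "f \<in> F" for f
        using cinner_unique_sum[OF F(2,1) that, of "\<lambda>f. cinner f x"] Px by (simp add: P_def)
      then have xF: "x \<in> ocomp F0"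
        using cinner_span_eq_0[of _ F x] F(3) by (auto simp: ocomp_def)
      have "cspan (e ` I) \<subseteq> D"
        by (rule cvec.span_minimal[OF _ t(1)]) (use eD in auto)
      then have xD: "x \<in> D" using x by blast
      have "(\<lambda>n. (l - lam n) * (cmod (cinner (e n) x))\<^sup>2) sums (l * (norm x)\<^sup>2 - Re (cinner x (T x)))"
        using sums_diff[OF sums_mult[OF onb_parseval_norm[OF e(1), of x], of l]
            sums_Re[OF eigen_form_sums[OF T e(1) eD lam xD]]]
        by (simp add: left_diff_distrib)
      moreover have out: "cinner (e n) x = 0" if "n \<notin> I" for n
      proof -
        have "cinner x (e n) = 0"
          by (rule cinner_span_eq_0[OF x])
            (use that orthonormalD[OF onb_orthonormal[OF e(1)]] in auto)
        then show ?thesis using cinner_commute[of "e n" x] by simp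
      qed
      have nn: "0 \<le> (l - lam n) * (cmod (cinner (e n) x))\<^sup>2" for n
        using out[of n] by (cases "n \<in> I") (auto simp: I_def)
      ultimately have s: "summable (\<lambda>n. (l - lam n) * (cmod (cinner (e n) x))\<^sup>2)"
          "(\<Sum>n. (l - lam n) * (cmod (cinner (e n) x))\<^sup>2) = l * (norm x)\<^sup>2 - Re (cinner x (T x))"
        by (auto simp: sums_iff)
      have "l * (norm x)\<^sup>2 \<le> Re (cinner x (T x))" using F0(2) xD xF by blast
      then have "(\<Sum>n. (l - lam n) * (cmod (cinner (e n) x))\<^sup>2) = 0"
        using suminf_nonneg[OF s(1) nn] s(2) by linarith
      then have "(l - lam n) * (cmod (cinner (e n) x))\<^sup>2 = 0"
        using suminf_eq_zero_iff[OF s(1) nn] by blast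
      then show "cinner (e n) x = 0"
        using out[of n] by (cases "n \<in> I") (auto simp: I_def)
    qed
    from orthonormal_card_le_rank[OF csym_clinear[OF P(1)] P(2)
        orthonormal_subset[OF onb_orthonormal[OF e(1)] subset_UNIV] this]
    show ?thesis by (simp add: I_def)
  qed
  show ?thesis by (rule that[OF e(1) eD lam fin])
qed


section \<open>From purely discrete spectrum to discreteness in min-max form\<close>

lemma not_spectrum_bounded_below:
  assumes "p \<notin> spectrum D T"
  obtains d where "0 < d" "\<And>x. x \<in> D \<Longrightarrow> d * norm x \<le> norm (T x - p *\<^sub>C x)"
proof -
  obtain R where R: "bounded_clinear R" "\<forall>x\<in>D. R (T x - p *\<^sub>C x) = x"
    using assms by (auto simp: spectrum_def resolvent_set_def)
  obtain K where K: "\<And>x. norm (R x) \<le> K * norm x"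
    using R(1) by (auto simp: bounded_clinear_def)
  define K' where "K' = max K 1"
  have K': "0 < K'" by (simp add: K'_def)
  have "norm x \<le> K' * norm (T x - p *\<^sub>C x)" if "x \<in> D" for x
  proof -
    have "norm x \<le> K * norm (T x - p *\<^sub>C x)"
      using K[of "T x - p *\<^sub>C x"] R(2) that by simp
    also have "\<dots> \<le> K' * norm (T x - p *\<^sub>C x)"
      by (intro mult_right_mono) (simp_all add: K'_def)
    finally show ?thesis .
  qed
  then show ?thesis using that[of "1 / K'"] K' by (simp add: field_simps)
qed

lemma eigenvalue_in_spectrum:
  assumes "x \<in> D" "x \<noteq> 0" "T x = p *\<^sub>C x"
  shows "p \<in> spectrum D T"
proof (rule ccontr)
  assume "p \<notin> spectrum D T"
  then obtain d where "0 < d" "\<And>x. x \<in> D \<Longrightarrow> d * norm x \<le> norm (T x - p *\<^sub>C x)"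
    using not_spectrum_bounded_below by metis
  from this(1) this(2)[OF assms(1)] show False using assms by (simp add: mult_le_0_iff)
qed

text \<open>With r = s - z and v = y / r - G y one has (T - s) G y = r v. A small v therefore forces
  G y to be small, and then also y = r (v + G y): a gap of \<open>T\<close> at \<open>s\<close>
  becomes a gap of \<open>G\<close> at 1 / (s - z).\<close>

lemma resolvent_shift_bounded_below:
  assumes G: "\<And>y. G y \<in> D" "\<And>y. T (G y) - z *\<^sub>R G y = y"
    and s: "z < s" "complex_of_real s \<notin> spectrum D T"
  shows "\<exists>d>0. \<forall>y. d * norm y \<le> norm ((1 / (s - z)) *\<^sub>R y - G y)"
proof -
  obtain d where d: "0 < d" "\<And>x. x \<in> D \<Longrightarrow> d * norm x \<le> norm (T x - complex_of_real s *\<^sub>C x)"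
    using not_spectrum_bounded_below[OF s(2)] by metis
  define r where "r = s - z"
  have r: "0 < r" using s(1) by (simp add: r_def)
  have main: "(1 / (1 + r / d)) * (1 / r) * norm y \<le> norm ((1 / r) *\<^sub>R y - G y)" for y
  proof -
    define v where "v = (1 / r) *\<^sub>R y - G y"
    have "T (G y) - complex_of_real s *\<^sub>C G y = y - r *\<^sub>R G y"
      using G(2)[of y] by (simp add: r_def scaleR_scaleC[symmetric] algebra_simps)
    also have "\<dots> = r *\<^sub>R v" using r by (simp add: v_def scaleR_diff_right)
    finally have "d * norm (G y) \<le> r * norm v"
      using d(2)[OF G(1), of y] r by simp
    then have Gy: "norm (G y) \<le> r / d * norm v" using d(1) by (simp add: field_simps)
    have "(1 / r) * norm y = norm (v + G y)" using r by (simp add: v_def)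
    also have "\<dots> \<le> norm v + norm (G y)" by (rule norm_triangle_ineq)
    also have "\<dots> \<le> (1 + r / d) * norm v" using Gy by (simp add: distrib_right)
    finally have le: "(1 / r) * norm y \<le> (1 + r / d) * norm v" .
    define q where "q = 1 + r / d"
    have "0 < q" using r d(1) by (simp add: q_def add_pos_pos)
    then have "(1 / q) * ((1 / r) * norm y) \<le> (1 / q) * (q * norm v)"
      using le by (intro mult_left_mono) (simp_all add: q_def)
    also have "(1 / q) * (q * norm v) = norm v" using \<open>0 < q\<close> by simp
    finally show ?thesis by (simp only: v_def q_def mult.assoc)
  qed
  have "0 < (1 / (1 + r / d)) * (1 / r)" using r d(1) by (simp add: add_pos_pos)
  then show ?thesis using main unfolding r_def by blast
qed


text \<open>The eigenvalues below \<open>l\<close> are finite in number and multiplicity, so the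
  form of \<open>T\<close> has to be bounded below on the complement \<open>W\<close> of their
  eigenvectors. There the supremum \<open>m\<close> of the form of the resolvent \<open>G\<close>
  cannot exceed 1 / (l - z). Otherwise q = z + 1/m, the level of \<open>T\<close> that matches
  \<open>m\<close>, is either no spectral point or an isolated one without eigenvectors in
  \<open>W\<close>; both bound the form of m - G below by a positive constant on the unit vectors of
  \<open>W\<close>, against the choice of \<open>m\<close>.\<close>

lemma pure_form_discrete:
  fixes T :: "'a::chilbert_space \<Rightarrow> 'a"
  assumes T: "selfadjoint D T" and bb: "bounded_from_below D T"
    and pure: "purely_discrete_spectrum D T"
  shows "form_discrete D T"
  unfolding form_discrete_def
proof
  fix l0 :: real
  note t = selfadjointD[OF T]
  note sub = csubspaceD[OF t(1)]
  have disc: "p isolated_in spectrum D T" "cfinite_dim (eigenspace D T p)"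
    if "p \<in> spectrum D T" for p
    using pure that by (auto simp: purely_discrete_spectrum_def essential_spectrum_def
        discrete_spectrum_def)
  obtain c :: real where c: "\<forall>x\<in>D. c * (norm x)\<^sup>2 \<le> Re (cinner x (T x))"
    using bb unfolding bounded_from_below_def by blast
  define z where "z = c - 1"
  \<comment> \<open>Raising the level to at least \<open>c\<close> ensures z < l.\<close>
  define l where "l = max l0 c"
  have zl: "z < l" by (simp add: z_def l_def)
  have "(z + 1) * (norm x)\<^sup>2 \<le> Re (cinner x (T x))" if "x \<in> D" for x
    using c that by (simp add: z_def)
  from form_resolvent[OF T this]
  obtain G where G: "csym G" "\<And>y. G y \<in> D" "\<And>y. T (G y) - z *\<^sub>R G y = y"
    "\<And>x. x \<in> D \<Longrightarrow> G (T x - z *\<^sub>R x) = x" "\<And>y. norm (G y) \<le> norm y"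
    "\<And>y. 0 \<le> Re (cinner y (G y))"
    by metis
  note glin = clinearD[OF csym_clinear[OF G(1)]]
  define \<Lambda> where "\<Lambda> = {s. s < l \<and> (\<exists>x\<in>D. x \<noteq> 0 \<and> T x = s *\<^sub>R x)}"
  have \<Lambda>_spec: "complex_of_real s \<in> spectrum D T" if "s \<in> \<Lambda>" for s
    using that eigenvalue_in_spectrum[of _ D T "complex_of_real s"]
    by (auto simp: \<Lambda>_def scaleR_scaleC)
  have "\<Lambda> \<subseteq> {c..l}"
  proof
    fix s assume s: "s \<in> \<Lambda>"
    then obtain x where x: "x \<in> D" "x \<noteq> 0" "T x = s *\<^sub>R x" by (auto simp: \<Lambda>_def)
    have "c * (norm x)\<^sup>2 \<le> s * (norm x)\<^sup>2"
      using c x(1) by (force simp: x(3) scaleR_scaleC cinner_scaleC_right cinner_self)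
    then show "s \<in> {c..l}" using x(2) s by (simp add: \<Lambda>_def)
  qed
  have fin: "finite \<Lambda>"
  proof (rule ccontr)
    assume "infinite \<Lambda>"
    \<comment> \<open>A limit point of eigenvalues lies in the spectrum, since T - p is not bounded
      below, and it is not isolated there.\<close>
    then obtain p where p: "p islimpt \<Lambda>"
      using Heine_Borel_imp_Bolzano_Weierstrass[OF compact_Icc[of c l]] \<open>\<Lambda> \<subseteq> {c..l}\<close> by blast
    have pspec: "complex_of_real p \<in> spectrum D T"
    proof (rule ccontr)
      assume "complex_of_real p \<notin> spectrum D T"
      then obtain d where d: "0 < d"
          "\<And>x. x \<in> D \<Longrightarrow> d * norm x \<le> norm (T x - complex_of_real p *\<^sub>C x)"
        using not_spectrum_bounded_below by metis
      obtain s where s: "s \<in> \<Lambda>" "dist s p < d"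
        using p d(1) unfolding islimpt_approachable by blast
      then obtain x where x: "x \<in> D" "x \<noteq> 0" "T x = s *\<^sub>R x" by (auto simp: \<Lambda>_def)
      have "T x - complex_of_real p *\<^sub>C x = (s - p) *\<^sub>R x"
        by (simp add: x(3) scaleR_scaleC[symmetric] scaleR_diff_left)
      then have "d * norm x \<le> \<bar>s - p\<bar> * norm x" using d(2)[OF x(1)] by simp
      then show False using s(2) x(2) by (simp add: dist_real_def)
    qed
    obtain r where r: "0 < r" "\<forall>y\<in>spectrum D T. dist (complex_of_real p) y < r \<longrightarrow> y = complex_of_real p"
      using disc(1)[OF pspec] unfolding isolated_in_dist_Ex_iff by blast
    obtain s where s: "s \<in> \<Lambda>" "s \<noteq> p" "dist s p < r"
      using p r(1) unfolding islimpt_approachable by blast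
    have "dist (complex_of_real p) (complex_of_real s) < r"
      using s(3) by (simp add: dist_commute)
    then show False using r(2) \<Lambda>_spec[OF s(1)] s(2) by auto
  qed
  define E where "E = {x\<in>D. \<exists>s<l. T x = s *\<^sub>R x}"
  have "\<forall>s\<in>\<Lambda>. \<exists>B. finite B \<and> eigenspace D T (complex_of_real s) \<subseteq> cspan B"
    using disc(2)[OF \<Lambda>_spec] by (simp add: cfinite_dim_def)
  from bchoice[OF this] obtain B
    where B: "\<forall>s\<in>\<Lambda>. finite (B s) \<and> eigenspace D T (complex_of_real s) \<subseteq> cspan (B s)" by blast
  define F where "F = (\<Union>s\<in>\<Lambda>. B s)"
  have finF: "finite F" using fin B by (simp add: F_def)
  have EF: "E \<subseteq> cspan F"
  proof
    fix x assume x: "x \<in> E"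
    show "x \<in> cspan F"
    proof (cases "x = 0")
      case True
      then show ?thesis by (simp add: cvec.span_zero)
    next
      case False
      then obtain s where s: "s \<in> \<Lambda>" "T x = s *\<^sub>R x" and xD: "x \<in> D"
        using x by (auto simp: E_def \<Lambda>_def)
      then have "x \<in> cspan (B s)"
        using B by (auto simp: eigenspace_def scaleR_scaleC)
      moreover have "cspan (B s) \<subseteq> cspan F"
        using s(1) by (intro cvec.span_mono) (auto simp: F_def)
      ultimately show ?thesis by blast
    qed
  qed
  define W where "W = ocomp E"
  have W: "csubspace W" "closed W" unfolding W_def by (rule csubspace_ocomp, rule closed_ocomp)
  note wsub = csubspaceD[OF W(1)]
  have GW: "G y \<in> W" if y: "y \<in> W" for y
    unfolding W_def ocomp_def
  proof (intro CollectI ballI)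
    fix m assume m: "m \<in> E"
    then obtain s where mD: "m \<in> D" and s: "T m = s *\<^sub>R m" by (auto simp: E_def)
    have Gm: "(s - z) *\<^sub>R G m = m"
      using G(4)[OF mD] by (simp add: s glin scaleR_diff_left[symmetric])
    show "cinner m (G y) = 0"
    proof (cases "s = z")
      case True
      then have "m = 0" using Gm by simp
      then show ?thesis by simp
    next
      case False
      have "complex_of_real (s - z) * cinner (G m) y = cinner m y"
        by (subst (2) Gm[symmetric]) (simp add: scaleR_scaleC cinner_scaleC_left)
      then show ?thesis
        using y m False by (simp add: csymD[OF G(1), symmetric] W_def ocomp_def)
    qed
  qed
  define U where "U = {x\<in>W. norm x = 1}"
  define m where "m = (SUP x\<in>U. Re (cinner x (G x)))"
  have "Re (cinner x (G x)) \<le> 1" if "x \<in> U" for x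
    using that Re_cinner_le[of x "G x"] G(5)[of x] by (simp add: U_def)
  then have bdd: "bdd_above ((\<lambda>x. Re (cinner x (G x))) ` U)" by (rule bdd_aboveI2)
  have le_m: "Re (cinner x (G x)) \<le> m" if "x \<in> U" for x
    unfolding m_def by (rule cSUP_upper[OF that bdd])
  have le_m': "Re (cinner x (G x)) \<le> m * (norm x)\<^sup>2" if "x \<in> W" for x
  proof (cases "x = 0")
    case False
    have "(1 / norm x) *\<^sub>R x \<in> U" using that False by (simp add: U_def wsub)
    from le_m[OF this] have "Re (cinner x (G x)) / (norm x)\<^sup>2 \<le> m"
      by (simp add: glin scaleR_scaleC cinner_scaleC_left cinner_scaleC_right power2_eq_square)
    then show ?thesis using False by (simp add: field_simps)
  qed simp
  have m_le: "m \<le> 1 / (l - z)" if ne: "U \<noteq> {}"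
  proof (rule ccontr)
    assume "\<not> ?thesis"
    then have big: "1 / (l - z) < m" by simp
    then have m0: "0 < m" using zl by (smt (verit) divide_pos_pos)
    have "1 / m < l - z" using big zl m0 by (simp add: field_simps)
    define q where "q = z + 1 / m"
    have ql: "q < l" and zq: "z < q" using \<open>1 / m < l - z\<close> m0 by (auto simp: q_def)
    have mq: "1 / (q - z) = m" by (simp add: q_def)
    define Y where "Y x = m *\<^sub>R x - G x" for x
    have Yc: "csym Y"
      by (auto simp: csym_def Y_def cinner_diff_left cinner_diff_right scaleR_scaleC
          cinner_scaleC_left cinner_scaleC_right csymD[OF G(1)])
    have YW: "Y x \<in> W" if "x \<in> W" for x unfolding Y_def by (intro wsub GW that)
    have Yform: "Re (cinner x (Y x)) = m * (norm x)\<^sup>2 - Re (cinner x (G x))" for x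
      by (simp add: Y_def cinner_diff_right scaleR_scaleC cinner_scaleC_right cinner_self)
    have Ypos: "0 \<le> Re (cinner x (Y x))" if "x \<in> W" for x
      unfolding Yform using le_m'[OF that] by simp
    have YK: "norm (Y x) \<le> (m + 1) * norm x" for x
      using norm_triangle_ineq4[of "m *\<^sub>R x" "G x"] G(5)[of x] m0
      by (simp add: Y_def distrib_right)
    have "\<exists>d>0. \<forall>x\<in>W. d * (norm x)\<^sup>2 \<le> Re (cinner x (Y x))"
    proof (cases "complex_of_real q \<in> spectrum D T")
      case False
      then obtain d where d: "0 < d" "\<forall>y. d * norm y \<le> norm (Y y)"
        using resolvent_shift_bounded_below[of G D T z q] G(2,3) zq unfolding mq Y_def by blast
      have "d\<^sup>2 / (m + 1) * (norm x)\<^sup>2 \<le> Re (cinner x (Y x))" if x: "x \<in> W" for x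
      proof -
        have "(d * norm x)\<^sup>2 \<le> (norm (Y x))\<^sup>2"
          using d by (intro power_mono) auto
        also have "\<dots> \<le> (m + 1) * Re (cinner x (Y x))"
          using m0 by (intro csym_nonneg_norm_le[OF Yc Ypos W(1) YW _ YK x]) auto
        finally show ?thesis using m0 by (simp add: power_mult_distrib field_simps)
      qed
      then show ?thesis using d(1) m0 by (intro exI[of _ "d\<^sup>2 / (m + 1)"]) auto
    next
      case True
      obtain r where r: "0 < r"
          "\<forall>y\<in>spectrum D T. dist (complex_of_real q) y < r \<longrightarrow> y = complex_of_real q"
        using disc(1)[OF True] unfolding isolated_in_dist_Ex_iff by blast
      \<comment> \<open>For s \<le> \<delta> the first entry gives m - s \<ge> m/2, so that u - q =
        s / (m (m - s)) is at most 2 s / m^2; the second entry keeps this below \<open>r\<close>,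
        where \<open>q\<close> is the only spectral point.\<close>
      define \<delta> where "\<delta> = min (m / 2) (r * m\<^sup>2 / 4)"
      have \<delta>: "0 < \<delta>" using m0 r(1) by (simp add: \<delta>_def)
      have ker: "x = 0" if x: "x \<in> W" "Y x = 0" for x
      proof -
        have Gx: "G x = m *\<^sub>R x" using x(2) by (simp add: Y_def)
        have x_eq: "x = complex_of_real (1 / m) *\<^sub>C G x"
          using m0 by (simp add: Gx scaleR_scaleC scaleC_scaleC)
        have xD: "x \<in> D" by (subst x_eq) (intro sub G(2))
        have "T (G x) = complex_of_real m *\<^sub>C T x"
          unfolding Gx scaleR_scaleC by (rule t(4)[OF xD])
        then have "complex_of_real m *\<^sub>C T x = x + z *\<^sub>R (m *\<^sub>R x)"
          using G(3)[of x] by (simp add: Gx eq_diff_eq diff_eq_eq)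
        then have "complex_of_real (1 / m) *\<^sub>C (complex_of_real m *\<^sub>C T x)
            = complex_of_real (1 / m) *\<^sub>C (x + z *\<^sub>R (m *\<^sub>R x))"
          by simp
        then have "T x = (1 / m + z) *\<^sub>R x"
          using m0 by (simp add: scaleC_scaleC scaleC_add_right scaleR_scaleC scaleC_add_left
              mult_ac)
        then have "x \<in> E" using xD ql by (auto simp: E_def q_def add.commute)
        then have "cinner x x = 0" using x(1) by (simp add: W_def ocomp_def)
        then show "x = 0" by (simp add: cinner_self_eq_0_iff)
      qed
      have gap: "\<exists>d>0. \<forall>x\<in>W. d * norm x \<le> norm (Y x - s *\<^sub>R x)" if s: "0 < s" "s \<le> \<delta>" for s
      proof -
        have ms: "0 < m - s" "m / 2 \<le> m - s" using s m0 by (auto simp: \<delta>_def)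
        define u where "u = z + 1 / (m - s)"
        have zu: "z < u" and mu: "1 / (u - z) = m - s" using ms by (auto simp: u_def)
        have "u - q = s / (m * (m - s))" using ms m0 by (simp add: u_def q_def field_simps)
        moreover have "0 < s / (m * (m - s))" using s ms m0 by simp
        moreover have "s / (m * (m - s)) \<le> s / (m * (m / 2))"
          using s ms m0 by (intro divide_left_mono mult_left_mono) auto
        moreover have "s / (m * (m / 2)) < r"
        proof -
          have "s \<le> r * m\<^sup>2 / 4" using s by (simp add: \<delta>_def)
          moreover have "0 < r * m\<^sup>2" using r(1) m0 by simp
          ultimately have "2 * s < r * m\<^sup>2" by linarith
          then show ?thesis using m0 by (simp add: field_simps power2_eq_square)
        qed
        ultimately have "0 < u - q" "u - q < r" by linarith+
        then have "complex_of_real u \<noteq> complex_of_real q"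
            "dist (complex_of_real q) (complex_of_real u) < r"
          by (auto simp: dist_real_def)
        then have "complex_of_real u \<notin> spectrum D T" using r(2) by blast
        from resolvent_shift_bounded_below[of G D T z u, OF G(2,3) zu this]
        obtain d where d: "0 < d" "\<forall>y. d * norm y \<le> norm ((m - s) *\<^sub>R y - G y)"
          unfolding mu by blast
        have "Y y - s *\<^sub>R y = (m - s) *\<^sub>R y - G y" for y by (simp add: Y_def algebra_simps)
        then show ?thesis using d by auto
      qed
      have "\<delta> * (norm x)\<^sup>2 \<le> Re (cinner x (Y x))" if x: "x \<in> W" for x
        by (rule gap_bounded_below[OF Yc _ YK W YW Ypos ker \<delta> gap x]) (use m0 in auto)
      then show ?thesis using \<delta> by blast
    qed
    then obtain d where d: "0 < d" "\<forall>x\<in>W. d * (norm x)\<^sup>2 \<le> Re (cinner x (Y x))" by blast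
    have "Re (cinner x (G x)) \<le> m - d" if "x \<in> U" for x
    proof -
      have "x \<in> W" "norm x = 1" using that by (auto simp: U_def)
      then show ?thesis using d(2) Yform[of x] by force
    qed
    then have "m \<le> m - d" unfolding m_def by (rule cSUP_least[OF ne])
    then show False using d(1) by simp
  qed
  have "l0 * (norm x)\<^sup>2 \<le> Re (cinner x (T x))" if x: "x \<in> D \<inter> ocomp F" for x
  proof (cases "x = 0")
    case False
    have xD: "x \<in> D" using x by simp
    have xW: "x \<in> W"
      using x EF cinner_span_eq_0[of _ F x] by (auto simp: W_def ocomp_def)
    have "(1 / norm x) *\<^sub>R x \<in> U" using xW False by (simp add: U_def wsub)
    then have "m \<le> 1 / (l - z)" using m_le by blast
    then have Gx: "Re (cinner x (G x)) \<le> 1 / (l - z) * (norm x)\<^sup>2"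
      using le_m'[OF xW] mult_right_mono[of m "1 / (l - z)" "(norm x)\<^sup>2"] by simp
    define y where "y = T x - z *\<^sub>R x"
    have Gy: "G y = x" unfolding y_def by (rule G(4)[OF xD])
    \<comment> \<open>Positivity of \<open>G\<close> at y - (l - z) x, where G y = x, turns the
      upper bound for the form of \<open>G\<close> into a lower bound for that of T - z.\<close>
    have "0 \<le> Re (cinner (y - (l - z) *\<^sub>R x) (G (y - (l - z) *\<^sub>R x)))" by (rule G(6))
    also have "\<dots> = Re (cinner y x) - 2 * (l - z) * (norm x)\<^sup>2 + (l - z)\<^sup>2 * Re (cinner x (G x))"
      unfolding csym_quadratic[OF G(1)] Gy by (simp add: cinner_self)
    also have "(l - z)\<^sup>2 * Re (cinner x (G x)) \<le> (l - z)\<^sup>2 * (1 / (l - z) * (norm x)\<^sup>2)"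
      by (intro mult_left_mono Gx) simp
    also have "\<dots> = (l - z) * (norm x)\<^sup>2" using zl by (simp add: power2_eq_square)
    finally have "(l - z) * (norm x)\<^sup>2 \<le> Re (cinner y x)" by (simp add: algebra_simps)
    also have "Re (cinner y x) = Re (cinner x (T x)) - z * (norm x)\<^sup>2"
      by (simp add: y_def Re_cinner_commute[of _ x] cinner_diff_right scaleR_scaleC
          cinner_scaleC_right cinner_self)
    finally have "l * (norm x)\<^sup>2 \<le> Re (cinner x (T x))" by (simp add: left_diff_distrib)
    moreover have "l0 * (norm x)\<^sup>2 \<le> l * (norm x)\<^sup>2"
      by (intro mult_right_mono) (simp_all add: l_def)
    ultimately show ?thesis by linarith
  qed (simp add: t)
  then show "\<exists>F. finite F \<and> (\<forall>x\<in>D \<inter> ocomp F. l0 * (norm x)\<^sup>2 \<le> Re (cinner x (T x)))"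
    using finF by blast
qed

section \<open>Spectral projections of a diagonal operator\<close>

lemma orth_projection_csym: "orth_projection P \<longleftrightarrow> csym P \<and> (\<forall>x. P (P x) = P x)"
  using csym_clinear[of P] by (auto simp: orth_projection_def csym_def)

lemma orth_projection_form:
  assumes "orth_projection P"
  shows "cinner x (P x) = complex_of_real ((norm (P x))\<^sup>2)"
proof -
  have "cinner x (P x) = cinner x (P (P x))"
    using assms by (simp add: orth_projection_def)
  also have "\<dots> = cinner (P x) (P x)"
    using assms unfolding orth_projection_csym csym_def by simp
  finally show ?thesis by (simp add: cinner_self)
qed

lemma orth_projection_norm_le:
  assumes "orth_projection P"
  shows "norm (P x) \<le> norm x"
proof (cases "P x = 0")
  case False
  have "norm (P x) * norm (P x) \<le> norm x * norm (P x)"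
    using Re_cinner_le[of x "P x"] by (simp add: orth_projection_form[OF assms] power2_eq_square)
  then show ?thesis using False by simp
qed simp

definition diag_proj ::
    "(nat \<Rightarrow> 'a::chilbert_space) \<Rightarrow> (nat \<Rightarrow> real) \<Rightarrow> real set \<Rightarrow> 'a \<Rightarrow> 'a"
  where "diag_proj e lam \<Omega> x = (\<Sum>n. (if lam n \<in> \<Omega> then cinner (e n) x else 0) *\<^sub>C e n)"

context
  fixes e :: "nat \<Rightarrow> 'a::chilbert_space" and lam :: "nat \<Rightarrow> real"
  assumes e: "onb e"
begin

lemma diag_proj_coeff:
  "cinner (e n) (diag_proj e lam \<Omega> x) = (if lam n \<in> \<Omega> then cinner (e n) x else 0)"
proof -
  have "summable (\<lambda>n. (cmod (if lam n \<in> \<Omega> then cinner (e n) x else 0))\<^sup>2)"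
    by (rule summable_comparison_test'[OF summable_orthonormal_coeff[OF onb_orthonormal[OF e], of x]])
      auto
  then show ?thesis
  proof (rule riesz_fischer[OF onb_orthonormal[OF e]])
    fix y
    assume "(\<lambda>n. (if lam n \<in> \<Omega> then cinner (e n) x else 0) *\<^sub>C e n) sums y"
      and y: "\<And>n. cinner (e n) y = (if lam n \<in> \<Omega> then cinner (e n) x else 0)"
    then have "diag_proj e lam \<Omega> x = y" by (simp add: diag_proj_def sums_iff)
    then show ?thesis by (simp add: y)
  qed
qed

lemma orth_projection_diag_proj: "orth_projection (diag_proj e lam \<Omega>)"
  unfolding orth_projection_csym
proof
  show "csym (diag_proj e lam \<Omega>)"
    unfolding csym_def
  proof (intro allI)
    fix x y
    have "cinner (diag_proj e lam \<Omega> x) (e n) = (if lam n \<in> \<Omega> then cinner x (e n) else 0)" for n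
      using diag_proj_coeff[of n \<Omega> x] cinner_commute[of _ "e n"] by simp
    then have "(\<lambda>n. cinner (diag_proj e lam \<Omega> x) (e n) * cinner (e n) y)
        = (\<lambda>n. cinner x (e n) * cinner (e n) (diag_proj e lam \<Omega> y))"
      by (auto simp: diag_proj_coeff)
    then show "cinner (diag_proj e lam \<Omega> x) y = cinner x (diag_proj e lam \<Omega> y)"
      using onb_parseval[OF e, of "diag_proj e lam \<Omega> x" y]
        onb_parseval[OF e, of x "diag_proj e lam \<Omega> y"] sums_unique2 by metis
  qed
  show "\<forall>x. diag_proj e lam \<Omega> (diag_proj e lam \<Omega> x) = diag_proj e lam \<Omega> x"
    by (intro allI onb_eqI[OF e]) (simp add: diag_proj_coeff)
qed

lemma diag_proj_form_sums:
  "(\<lambda>n. if lam n \<in> \<Omega> then (cmod (cinner (e n) x))\<^sup>2 else 0) sums Re (cinner x (diag_proj e lam \<Omega> x))"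
proof -
  have "(\<lambda>n. (cmod (cinner (e n) (diag_proj e lam \<Omega> x)))\<^sup>2)
      = (\<lambda>n. if lam n \<in> \<Omega> then (cmod (cinner (e n) x))\<^sup>2 else 0)"
    by (auto simp: diag_proj_coeff)
  then show ?thesis
    using onb_parseval_norm[OF e, of "diag_proj e lam \<Omega> x"]
    by (simp add: orth_projection_form[OF orth_projection_diag_proj])
qed

text \<open>The remainder after \<open>n\<close> terms is the projection for the set
  \<open>V n\<close>. Its squared norm is a series whose terms vanish eventually one by one and are
  dominated by the squared coefficients of \<open>x\<close>, so Tannery's theorem gives the limit
  0.\<close>

lemma diag_proj_sums:
  assumes A: "disjoint_family A"
  shows "(\<lambda>n. diag_proj e lam (A n) x) sums diag_proj e lam (\<Union>n. A n) x"
proof -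
  define U where "U n = (\<Union>i<n. A i)" for n :: nat
  define V where "V n = (\<Union>i. A i) - U n" for n
  have partial: "(\<Sum>i<n. diag_proj e lam (A i) x) = diag_proj e lam (U n) x" for n
  proof (rule onb_eqI[OF e])
    fix k
    have "(\<Sum>i<n. if lam k \<in> A i then cinner (e k) x else 0)
        = (if lam k \<in> U n then cinner (e k) x else 0)"
    proof (cases "lam k \<in> U n")
      case True
      then obtain j where j: "j < n" "lam k \<in> A j" by (auto simp: U_def)
      have "lam k \<in> A i \<longleftrightarrow> i = j" for i
        using A j(2) by (auto simp: disjoint_family_on_def)
      then show ?thesis using True j(1) by simp
    next
      case False
      then show ?thesis by (auto simp: U_def intro!: sum.neutral)
    qed
    then show "cinner (e k) (\<Sum>i<n. diag_proj e lam (A i) x) = cinner (e k) (diag_proj e lam (U n) x)"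
      by (simp add: cinner_sum_right diag_proj_coeff)
  qed
  have diff: "diag_proj e lam (\<Union>i. A i) x - diag_proj e lam (U n) x = diag_proj e lam (V n) x" for n
  proof (rule onb_eqI[OF e])
    fix k
    have "U n \<subseteq> (\<Union>i. A i)" by (auto simp: U_def)
    then show "cinner (e k) (diag_proj e lam (\<Union>i. A i) x - diag_proj e lam (U n) x)
        = cinner (e k) (diag_proj e lam (V n) x)"
      by (auto simp: cinner_diff_right diag_proj_coeff V_def)
  qed
  define a where "a k n = (if lam k \<in> V n then (cmod (cinner (e k) x))\<^sup>2 else 0)" for k n
  have lim: "(\<lambda>n. a k n) \<longlonglongrightarrow> 0" for k
  proof (rule tendsto_eventually)
    have "\<exists>N. \<forall>n\<ge>N. lam k \<notin> V n"
    proof (cases "lam k \<in> (\<Union>i. A i)")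
      case True
      then obtain j where "lam k \<in> A j" by auto
      then show ?thesis by (intro exI[of _ "Suc j"]) (auto simp: V_def U_def)
    qed (auto simp: V_def)
    then show "\<forall>\<^sub>F n in sequentially. a k n = 0"
      unfolding eventually_sequentially a_def by auto
  qed
  have "\<forall>\<^sub>F (k, n) in sequentially \<times>\<^sub>F sequentially. norm (a k n) \<le> (cmod (cinner (e k) x))\<^sup>2"
    by (intro always_eventually) (auto simp: a_def)
  from tannerys_theorem[OF lim this summable_orthonormal_coeff[OF onb_orthonormal[OF e]]]
  have "(\<lambda>n. \<Sum>k. a k n) \<longlonglongrightarrow> (\<Sum>k. 0)" by simp
  moreover have "(\<Sum>k. a k n) = (norm (diag_proj e lam (V n) x))\<^sup>2" for n
    using sums_unique[OF diag_proj_form_sums[of "V n" x]]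
    by (simp add: a_def orth_projection_form[OF orth_projection_diag_proj])
  ultimately have "(\<lambda>n. (norm (diag_proj e lam (\<Union>i. A i) x - diag_proj e lam (U n) x))\<^sup>2) \<longlonglongrightarrow> 0"
    by (simp add: diff)
  then have "(\<lambda>n. sqrt ((norm (diag_proj e lam (\<Union>i. A i) x - diag_proj e lam (U n) x))\<^sup>2)) \<longlonglongrightarrow> sqrt 0"
    by (intro tendsto_intros)
  then have "(\<lambda>n. norm (diag_proj e lam (U n) x - diag_proj e lam (\<Union>i. A i) x)) \<longlonglongrightarrow> 0"
    by (simp add: norm_minus_commute)
  then show ?thesis
    unfolding sums_def partial using LIM_zero_cancel tendsto_norm_zero_iff by blast
qed

lemma projection_valued_measure_diag_proj: "projection_valued_measure (diag_proj e lam)"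
proof -
  have "diag_proj e lam UNIV = id"
    by (rule ext, rule onb_eqI[OF e]) (simp add: diag_proj_coeff)
  then show ?thesis
    unfolding projection_valued_measure_def
    using orth_projection_diag_proj diag_proj_sums by blast
qed

text \<open>In this form integrals against the scalar measure become series over the basis, for
  integrability as well as for values.\<close>

lemma scalar_measure_diag_proj:
  "scalar_measure (diag_proj e lam) x
    = distr (density (count_space UNIV) (\<lambda>n. ennreal ((cmod (cinner (e n) x))\<^sup>2))) borel lam"
    (is "_ = ?M")
proof -
  have "ennreal (Re (cinner x (diag_proj e lam \<Omega> x))) = emeasure ?M \<Omega>" if "\<Omega> \<in> sets borel" for \<Omega>
  proof -
    have "emeasure ?M \<Omega>
        = (\<integral>\<^sup>+n. ennreal ((cmod (cinner (e n) x))\<^sup>2) * indicator (lam -` \<Omega>) n \<partial>count_space UNIV)"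
      using that by (subst emeasure_distr) (auto simp: emeasure_density)
    also have "\<dots> = (\<Sum>n. ennreal (if lam n \<in> \<Omega> then (cmod (cinner (e n) x))\<^sup>2 else 0))"
      unfolding nn_integral_count_space_nat by (intro suminf_cong) (auto simp: indicator_def)
    also have "\<dots> = ennreal (Re (cinner x (diag_proj e lam \<Omega> x)))"
      by (intro suminf_ennreal_eq diag_proj_form_sums) simp
    finally show ?thesis by simp
  qed
  then have "scalar_measure (diag_proj e lam) x = measure_of UNIV (sets borel) (emeasure ?M)"
    unfolding scalar_measure_def
    by (intro measure_of_eq) (auto simp: sets.sigma_sets_eq[of borel, simplified])
  also have "\<dots> = ?M"
    using measure_of_of_measure[of ?M] by simp
  finally show ?thesis .
qed

text \<open>The delicate half is that the domain of the integral is no larger than \<open>D\<close>.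
  If the numbers lam n <e n, x> are square-summable, Riesz-Fischer gives a vector \<open>w\<close>
  with these coefficients; it solves the weak equation for T x, so \<open>x\<close> lies in
  \<open>D\<close>.\<close>

lemma is_spectral_measure_diag_proj:
  assumes T: "selfadjoint D T"
    and eig: "\<And>n. e n \<in> D" "\<And>n. T (e n) = lam n *\<^sub>R e n"
  shows "is_spectral_measure D T (diag_proj e lam)"
proof -
  note t = selfadjointD[OF T]
  have int: "integrable (scalar_measure (diag_proj e lam) x) f
      \<longleftrightarrow> summable (\<lambda>n. norm ((cmod (cinner (e n) x))\<^sup>2 * f (lam n)))"
    if "f \<in> borel_measurable borel" for f :: "real \<Rightarrow> real" and x
    unfolding scalar_measure_diag_proj using that
    by (subst integrable_distr_eq) (auto simp: integrable_density integrable_count_space_nat_iff)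
  have intv: "integral\<^sup>L (scalar_measure (diag_proj e lam) x) f
      = (\<Sum>n. (cmod (cinner (e n) x))\<^sup>2 * f (lam n))"
    if f: "f \<in> borel_measurable borel" and i: "integrable (scalar_measure (diag_proj e lam) x) f"
    for f :: "real \<Rightarrow> real" and x
  proof -
    have "summable (\<lambda>n. norm ((cmod (cinner (e n) x))\<^sup>2 * f (lam n)))" using i int[OF f] by simp
    then have "integrable (count_space UNIV) (\<lambda>n. (cmod (cinner (e n) x))\<^sup>2 * f (lam n))"
      by (simp add: integrable_count_space_nat_iff)
    then show ?thesis
      unfolding scalar_measure_diag_proj using f
      by (subst integral_distr) (auto simp: integral_density integral_count_space_nat)
  qed
  have coeffT: "cinner (e n) (T x) = complex_of_real (lam n) * cinner (e n) x" if "x \<in> D" for n x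
    using t(5)[OF eig(1) that, of n] by (simp add: eig scaleR_scaleC cinner_scaleC_left)
  have dom: "x \<in> D \<longleftrightarrow> summable (\<lambda>n. (cmod (cinner (e n) x))\<^sup>2 * (lam n)\<^sup>2)" for x
  proof
    assume x: "x \<in> D"
    have "summable (\<lambda>n. (cmod (cinner (e n) (T x)))\<^sup>2)"
      by (rule summable_orthonormal_coeff[OF onb_orthonormal[OF e]])
    then show "summable (\<lambda>n. (cmod (cinner (e n) x))\<^sup>2 * (lam n)\<^sup>2)"
      by (simp add: coeffT[OF x] norm_mult power_mult_distrib mult.commute)
  next
    assume "summable (\<lambda>n. (cmod (cinner (e n) x))\<^sup>2 * (lam n)\<^sup>2)"
    then have "summable (\<lambda>n. (cmod (complex_of_real (lam n) * cinner (e n) x))\<^sup>2)"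
      by (simp add: norm_mult power_mult_distrib mult.commute)
    then have "\<exists>w. \<forall>n. cinner (e n) w = complex_of_real (lam n) * cinner (e n) x"
      by (rule riesz_fischer[OF onb_orthonormal[OF e]]) blast
    then obtain w where w: "\<And>n. cinner (e n) w = complex_of_real (lam n) * cinner (e n) x"
      by blast
    have "cinner x (T y) = cinner w y" if y: "y \<in> D" for y
    proof -
      have "cinner w (e n) = complex_of_real (lam n) * cinner x (e n)" for n
        using arg_cong[OF w[of n], of cnj] by (simp add: cnj_cinner)
      then have "(\<lambda>n. cinner x (e n) * cinner (e n) (T y)) = (\<lambda>n. cinner w (e n) * cinner (e n) y)"
        by (simp add: coeffT[OF y] mult_ac)
      then show ?thesis
        using onb_parseval[OF e, of x "T y"] onb_parseval[OF e, of w y] sums_unique2 by metis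
    qed
    from selfadjoint_maximal(1)[OF T this] show "x \<in> D" .
  qed
  have D: "D = {x. integrable (scalar_measure (diag_proj e lam) x) (\<lambda>t. t\<^sup>2)}"
    by (auto simp: int dom)
  have "cinner x (T x) = complex_of_real (\<integral>t. t \<partial>scalar_measure (diag_proj e lam) x)"
    if x: "x \<in> D" for x
  proof -
    have "summable (\<lambda>n. norm ((cmod (cinner (e n) x))\<^sup>2 * lam n))"
    proof (rule summable_comparison_test')
      show "summable (\<lambda>n. (cmod (cinner (e n) x))\<^sup>2 * (lam n)\<^sup>2 + (cmod (cinner (e n) x))\<^sup>2)"
        using x dom by (intro summable_add summable_orthonormal_coeff[OF onb_orthonormal[OF e]]) auto
      fix n
      have "\<bar>lam n\<bar> \<le> (lam n)\<^sup>2 + 1"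
        using zero_le_power2[of "\<bar>lam n\<bar> - 1"] zero_le_power2[of "lam n"]
        unfolding power2_diff by simp
      then have "(cmod (cinner (e n) x))\<^sup>2 * \<bar>lam n\<bar> \<le> (cmod (cinner (e n) x))\<^sup>2 * ((lam n)\<^sup>2 + 1)"
        by (intro mult_left_mono) auto
      then show "norm (norm ((cmod (cinner (e n) x))\<^sup>2 * lam n))
          \<le> (cmod (cinner (e n) x))\<^sup>2 * (lam n)\<^sup>2 + (cmod (cinner (e n) x))\<^sup>2"
        by (simp add: abs_mult distrib_left)
    qed
    then have i: "integrable (scalar_measure (diag_proj e lam) x) (\<lambda>t. t)" by (simp add: int)
    have "(\<lambda>t::real. t) \<in> borel_measurable borel" by simp
    from intv[OF this i] have "(\<integral>t. t \<partial>scalar_measure (diag_proj e lam) x)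
        = (\<Sum>n. (cmod (cinner (e n) x))\<^sup>2 * lam n)" .
    moreover have "(\<lambda>n. (cmod (cinner (e n) x))\<^sup>2 * lam n) sums Re (cinner x (T x))"
      using sums_Re[OF eigen_form_sums[OF T e eig x]] by (simp add: mult.commute)
    moreover have "Im (cinner x (T x)) = 0"
      using arg_cong[OF cinner_commute[of x "T x"], of Im] t(5)[OF x x] by simp
    ultimately show ?thesis by (simp add: complex_eq_iff sums_iff)
  qed
  then show ?thesis
    unfolding is_spectral_measure_def using projection_valued_measure_diag_proj D by blast
qed

end

section \<open>Projection-valued measures and uniqueness of the spectral measure\<close>

context
  fixes E :: "real set \<Rightarrow> 'a::chilbert_space \<Rightarrow> 'a"
  assumes E: "projection_valued_measure E"
begin

lemma pvm_proj: "\<Omega> \<in> sets borel \<Longrightarrow> orth_projection (E \<Omega>)"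
  using E by (simp add: projection_valued_measure_def)

lemma pvm_sums:
  "range A \<subseteq> sets borel \<Longrightarrow> disjoint_family A \<Longrightarrow> (\<lambda>n::nat. E (A n) x) sums E (\<Union>n. A n) x"
  using E by (simp add: projection_valued_measure_def)

text \<open>Countable additivity applies to the constant sequence of empty sets, and a convergent
  series with constant terms has zero terms.\<close>

lemma pvm_empty: "E {} x = 0"
proof -
  have "(\<lambda>n::nat. E {} x) sums E (\<Union>n::nat. {}) x"
    by (rule pvm_sums) (auto simp: disjoint_family_on_def)
  then have "summable (\<lambda>n::nat. E {} x)" by (rule sums_summable)
  then show ?thesis using summable_LIMSEQ_zero LIMSEQ_const_iff by blast
qed

lemma pvm_union:
  assumes "A \<in> sets borel" "B \<in> sets borel" "A \<inter> B = {}"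
  shows "E (A \<union> B) x = E A x + E B x"
proof -
  have "(\<lambda>n. E (binaryset A B n) x) sums E (\<Union>n. binaryset A B n) x"
    by (rule pvm_sums) (use assms in
        \<open>auto simp: range_binaryset_eq disjoint_family_on_def binaryset_def\<close>)
  moreover have "(\<lambda>n. E (binaryset A B n) x) sums (\<Sum>n\<in>{0,1}. E (binaryset A B n) x)"
    by (rule sums_finite) (auto simp: binaryset_def pvm_empty)
  ultimately show ?thesis
    using sums_unique2 by (fastforce simp: UN_binaryset_eq binaryset_def)
qed

text \<open>For y in the range of \<open>E B\<close>, additivity gives |E (A \<union> B) y|^2 = |E A
  y|^2 + |y|^2, while a projection does not increase norms.\<close>

lemma pvm_orth:
  assumes "A \<in> sets borel" "B \<in> sets borel" "A \<inter> B = {}"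
  shows "E A (E B x) = 0"
proof -
  define y where "y = E B x"
  have y: "E B y = y" using pvm_proj[OF assms(2)] by (simp add: y_def orth_projection_def)
  have R: "orth_projection (E (A \<union> B))" using assms by (intro pvm_proj) auto
  have "complex_of_real ((norm (E (A \<union> B) y))\<^sup>2) = cinner y (E (A \<union> B) y)"
    by (rule orth_projection_form[OF R, symmetric])
  also have "\<dots> = cinner y (E A y) + cinner y y"
    unfolding pvm_union[OF assms] y cinner_add_right ..
  also have "\<dots> = complex_of_real ((norm (E A y))\<^sup>2 + (norm y)\<^sup>2)"
    unfolding orth_projection_form[OF pvm_proj[OF assms(1)]] cinner_self by simp
  finally have "(norm (E (A \<union> B) y))\<^sup>2 = (norm (E A y))\<^sup>2 + (norm y)\<^sup>2"
    unfolding of_real_eq_iff .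
  moreover have "(norm (E (A \<union> B) y))\<^sup>2 \<le> (norm y)\<^sup>2"
    by (intro power_mono orth_projection_norm_le R) simp
  ultimately show ?thesis by (simp add: y_def)
qed

lemma emeasure_scalar_measure:
  assumes "\<Omega> \<in> sets borel"
  shows "emeasure (scalar_measure E x) \<Omega> = ennreal ((norm (E \<Omega> x))\<^sup>2)"
proof -
  have form: "Re (cinner x (E \<Omega> x)) = (norm (E \<Omega> x))\<^sup>2" if "\<Omega> \<in> sets borel" for \<Omega>
    by (simp add: orth_projection_form[OF pvm_proj[OF that]])
  have "emeasure (scalar_measure E x) \<Omega> = ennreal (Re (cinner x (E \<Omega> x)))"
    unfolding scalar_measure_def
  proof (rule emeasure_measure_of_sigma)
    show "sigma_algebra UNIV (sets (borel :: real measure))"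
      using sets.sigma_algebra_axioms[of "borel :: real measure"] by simp
    show "positive (sets borel) (\<lambda>\<Omega>. ennreal (Re (cinner x (E \<Omega> x))))"
      by (simp add: positive_def pvm_empty)
    show "countably_additive (sets borel) (\<lambda>\<Omega>. ennreal (Re (cinner x (E \<Omega> x))))"
      unfolding countably_additive_def
    proof (intro allI impI)
      fix A :: "nat \<Rightarrow> real set"
      assume A: "range A \<subseteq> sets borel" "disjoint_family A"
      show "(\<Sum>i. ennreal (Re (cinner x (E (A i) x)))) = ennreal (Re (cinner x (E (\<Union>i. A i) x)))"
      proof (rule suminf_ennreal_eq)
        show "0 \<le> Re (cinner x (E (A i) x))" for i
          using A(1) form[of "A i"] by auto
        show "(\<lambda>i. Re (cinner x (E (A i) x))) sums Re (cinner x (E (\<Union>i. A i) x))"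
          by (intro sums_Re cinner_sums_right pvm_sums A)
      qed
    qed
  qed (rule assms)
  then show ?thesis using form[OF assms] by simp
qed

lemma sets_scalar_measure [simp]: "sets (scalar_measure E x) = sets borel"
  unfolding scalar_measure_def
  by (simp add: sets_measure_of sets.sigma_sets_eq[of borel, simplified])

lemma space_scalar_measure [simp]: "space (scalar_measure E x) = UNIV"
  using sets_eq_imp_space_eq[OF sets_scalar_measure] by simp

text \<open>The mixed terms of the two components vanish under every projection of the measure.
  Since the scalar measure decides membership in the domain and the value of the form, the reflected
  vector shares both with \<open>x\<close>; this takes the place of a functional calculus.\<close>

lemma scalar_measure_flip:
  assumes \<Omega>: "\<Omega> \<in> sets borel"
  shows "scalar_measure E (E \<Omega> x - E (- \<Omega>) x) = scalar_measure E x"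
proof -
  define x1 where "x1 = E \<Omega> x"
  define x2 where "x2 = E (- \<Omega>) x"
  have c: "- \<Omega> \<in> sets borel" using \<Omega> by auto
  have "E (\<Omega> \<union> - \<Omega>) x = x1 + x2" unfolding x1_def x2_def by (rule pvm_union[OF \<Omega> c]) simp
  then have x: "x = x1 + x2"
    using E by (simp add: projection_valued_measure_def)
  have "Re (cinner (x1 - x2) (E \<Theta> (x1 - x2))) = Re (cinner (x1 + x2) (E \<Theta> (x1 + x2)))"
    if \<Theta>: "\<Theta> \<in> sets borel" for \<Theta>
  proof -
    have m: "\<Theta> \<inter> \<Omega> \<in> sets borel" "\<Theta> - \<Omega> \<in> sets borel" using \<Theta> \<Omega> by auto
    have P: "orth_projection (E \<Theta>)" by (rule pvm_proj[OF \<Theta>])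
    then have cs: "csym (E \<Theta>)" by (simp add: orth_projection_csym)
    note lin = clinearD[OF csym_clinear[OF cs]]
    have "E \<Theta> x2 = E (\<Theta> \<inter> \<Omega>) x2 + E (\<Theta> - \<Omega>) x2"
      using pvm_union[OF m, of x2] by (auto simp: Int_Diff_Un)
    also have "E (\<Theta> \<inter> \<Omega>) x2 = 0"
      unfolding x2_def by (rule pvm_orth[OF m(1) c]) auto
    finally have "cinner x1 (E \<Theta> x2) = cinner x1 (E (\<Theta> - \<Omega>) x2)" by simp
    also have "\<dots> = cinner (E (\<Theta> - \<Omega>) x1) x2"
      using pvm_proj[OF m(2)] by (simp add: orth_projection_csym csym_def)
    also have "E (\<Theta> - \<Omega>) x1 = 0"
      unfolding x1_def by (rule pvm_orth[OF m(2) \<Omega>]) auto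
    finally have 1: "cinner x1 (E \<Theta> x2) = 0" by simp
    then have "cinner x2 (E \<Theta> x1) = 0"
      using cinner_commute[of "E \<Theta> x2" x1] csymD[OF cs, of x2 x1] by simp
    with 1 show ?thesis
      by (simp add: lin cinner_add_left cinner_add_right cinner_diff_left cinner_diff_right)
  qed
  then have "scalar_measure E (x1 - x2) = scalar_measure E (x1 + x2)"
    unfolding scalar_measure_def
    by (intro measure_of_eq) (auto simp: sets.sigma_sets_eq[of borel, simplified])
  then show ?thesis
    by (simp only: x[symmetric] x1_def[symmetric] x2_def[symmetric])
qed

end

text \<open>Reflection shows that the component \<open>x1\<close> of \<open>x\<close> in \<Omega>
  lies in \<open>D\<close> and that the form there is \<mu> |x1|^2. So t - \<mu> integrates to zero
  against a measure concentrated strictly on one side of \<mu>, and this measure vanishes.\<close>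

lemma spectral_measure_eigenvector:
  fixes T :: "'a::chilbert_space \<Rightarrow> 'a"
  assumes T: "selfadjoint D T" and sm: "is_spectral_measure D T E"
    and x: "x \<in> D" "T x = \<mu> *\<^sub>R x" and \<Omega>: "\<Omega> \<in> sets borel"
    and side: "\<Omega> \<subseteq> {\<mu><..} \<or> \<Omega> \<subseteq> {..<\<mu>}"
  shows "E \<Omega> x = 0"
proof -
  note t = selfadjointD[OF T]
  note sub = csubspaceD[OF t(1)]
  have E: "projection_valued_measure E"
    and Ddef: "D = {x. integrable (scalar_measure E x) (\<lambda>t. t\<^sup>2)}"
    and Tint: "\<forall>x\<in>D. cinner x (T x) = complex_of_real (\<integral>t. t \<partial>scalar_measure E x)"
    using sm unfolding is_spectral_measure_def by blast+
  have c: "- \<Omega> \<in> sets borel" using \<Omega> by auto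
  define x1 where "x1 = E \<Omega> x"
  define x2 where "x2 = E (- \<Omega>) x"
  have "E (\<Omega> \<union> - \<Omega>) x = x1 + x2" unfolding x1_def x2_def by (rule pvm_union[OF E \<Omega> c]) simp
  then have xx: "x = x1 + x2"
    using E by (simp add: projection_valued_measure_def)
  have meas: "scalar_measure E (x1 - x2) = scalar_measure E x"
    unfolding x1_def x2_def by (rule scalar_measure_flip[OF E \<Omega>])
  have yD: "x1 - x2 \<in> D" using x(1) by (simp add: Ddef meas)
  have "x1 = (1/2) *\<^sub>R (x + (x1 - x2))" unfolding xx by (simp flip: scaleR_2)
  then have x1D: "x1 \<in> D" using x(1) yD sub(2,5) by metis
  then have x2D: "x2 \<in> D" using sub(3)[OF x(1) x1D] by (simp add: xx)
  \<comment> \<open>The form agrees at \<open>x\<close> and at its reflection; comparing the two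
    expansions shows that the real part of <x1, T x2> is zero.\<close>
  have "cinner (x1 - x2) (T (x1 - x2)) = cinner (x1 + x2) (T (x1 + x2))"
    using Tint yD x(1) meas unfolding xx[symmetric] by simp
  moreover have "cinner (x1 - x2) (T (x1 - x2))
      = cinner x1 (T x1) - cinner x1 (T x2) - (cinner x2 (T x1) - cinner x2 (T x2))"
    using x1D x2D by (simp add: t cinner_diff_left cinner_diff_right)
  moreover have "cinner (x1 + x2) (T (x1 + x2))
      = cinner x1 (T x1) + cinner x1 (T x2) + (cinner x2 (T x1) + cinner x2 (T x2))"
    using x1D x2D by (simp add: t cinner_add_left cinner_add_right)
  ultimately have "Re (cinner x1 (T x1) - cinner x1 (T x2) - (cinner x2 (T x1) - cinner x2 (T x2)))
      = Re (cinner x1 (T x1) + cinner x1 (T x2) + (cinner x2 (T x1) + cinner x2 (T x2)))"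
    by metis
  moreover have "Re (cinner x2 (T x1)) = Re (cinner x1 (T x2))"
    using t(5)[OF x1D x2D] Re_cinner_commute[of x2 "T x1"] by simp
  ultimately have "Re (cinner x1 (T x2)) = 0" by simp
  then have "Re (cinner x1 (T x1)) = Re (cinner x1 (T x))"
    using x1D x2D by (simp add: xx t cinner_add_right)
  also have "\<dots> = \<mu> * Re (cinner x1 x)" by (simp add: x(2) scaleR_scaleC cinner_scaleC_right)
  also have "Re (cinner x1 x) = (norm x1)\<^sup>2"
    unfolding x1_def
    using orth_projection_form[OF pvm_proj[OF E \<Omega>], of x] Re_cinner_commute[of x "E \<Omega> x"] by simp
  finally have form: "Re (cinner x1 (T x1)) = \<mu> * (norm x1)\<^sup>2" .
  define M where "M = scalar_measure E x1"
  have setsM [simp]: "sets M = sets borel" and spaceM [simp]: "space M = UNIV"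
    unfolding M_def by (rule sets_scalar_measure[OF E], rule space_scalar_measure[OF E])
  have measM: "(borel_measurable M :: (real \<Rightarrow> real) set) = borel_measurable borel"
    by (rule measurable_cong_sets) simp_all
  have Mall: "emeasure M UNIV = ennreal ((norm x1)\<^sup>2)"
    using emeasure_scalar_measure[OF E, of UNIV x1] E
    by (simp add: M_def projection_valued_measure_def)
  interpret finite_measure M by standard (simp add: Mall)
  have sq: "integrable M (\<lambda>t. t\<^sup>2)" using x1D by (simp add: Ddef M_def)
  have int: "integrable M (\<lambda>t. t)"
  proof (rule Bochner_Integration.integrable_bound)
    show "integrable M (\<lambda>t. t\<^sup>2 + 1)" using sq by simp
    show "(\<lambda>t. t) \<in> borel_measurable M" by (simp add: measM)
    have "norm t \<le> norm (t\<^sup>2 + 1)" for t :: real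
    proof -
      have "2 * \<bar>t\<bar> \<le> t\<^sup>2 + 1"
        using zero_le_power2[of "\<bar>t\<bar> - 1"] unfolding power2_diff by simp
      then show ?thesis
        unfolding real_norm_def using abs_ge_zero[of t] abs_ge_self[of "t\<^sup>2 + 1"] by linarith
    qed
    then show "AE t in M. norm t \<le> norm (t\<^sup>2 + 1)" by simp
  qed
  have "(\<integral>t. t \<partial>M) = \<mu> * (norm x1)\<^sup>2"
    using Tint x1D form by (simp add: M_def)
  moreover have "measure M UNIV = (norm x1)\<^sup>2" using Mall by (simp add: measure_def)
  ultimately have zero: "(\<integral>t. t - \<mu> \<partial>M) = 0"
    using int by (subst Bochner_Integration.integral_diff) auto
  have AE: "AE t in M. t \<in> \<Omega>"
  proof (rule AE_I)
    show "{t \<in> space M. t \<notin> \<Omega>} \<subseteq> - \<Omega>" by auto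
    have "E (- \<Omega>) x1 = 0" unfolding x1_def by (rule pvm_orth[OF E c \<Omega>]) simp
    then show "emeasure M (- \<Omega>) = 0"
      unfolding M_def using emeasure_scalar_measure[OF E c, of x1] by simp
    show "- \<Omega> \<in> sets M" using c by simp
  qed
  have "AE t in M. t - \<mu> = 0"
    using side
  proof
    assume s: "\<Omega> \<subseteq> {\<mu><..}"
    have "AE t in M. 0 \<le> t - \<mu>" using AE by eventually_elim (use s in auto)
    then show ?thesis
      using integral_nonneg_eq_0_iff_AE[of M "\<lambda>t. t - \<mu>"] int zero by simp
  next
    assume s: "\<Omega> \<subseteq> {..<\<mu>}"
    have "AE t in M. 0 \<le> \<mu> - t" using AE by eventually_elim (use s in auto)
    moreover have "(\<integral>t. \<mu> - t \<partial>M) = 0"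
      using zero Bochner_Integration.integral_minus[of M "\<lambda>t. t - \<mu>"] by simp
    ultimately have "AE t in M. \<mu> - t = 0"
      using integral_nonneg_eq_0_iff_AE[of M "\<lambda>t. \<mu> - t"] int by simp
    then show ?thesis by eventually_elim simp
  qed
  with AE have "AE t in M. False"
    by eventually_elim (use side in auto)
  then have "emeasure M UNIV = 0" by (simp add: AE_iff_measurable[of UNIV])
  then show ?thesis using Mall by (simp add: x1_def)
qed

text \<open>Any competing spectral measure annihilates \<open>e n\<close> on each Borel set that
  misses \<open>lam n\<close>, by splitting that set into the parts above and below
  \<open>lam n\<close>. It therefore agrees with the diagonal one on the basis, which makes the
  definite description proper.\<close>

lemma spectral_projection_eigenbasis:
  fixes e :: "nat \<Rightarrow> 'a::chilbert_space"
  assumes e: "onb e" and T: "selfadjoint D T"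
    and eig: "\<And>n. e n \<in> D" "\<And>n. T (e n) = lam n *\<^sub>R e n" and \<Omega>: "\<Omega> \<in> sets borel"
  shows "spectral_projection D T \<Omega> = diag_proj e lam \<Omega>"
  unfolding spectral_projection_def
proof (rule the_equality)
  show "\<exists>E. is_spectral_measure D T E \<and> diag_proj e lam \<Omega> = E \<Omega>"
    using is_spectral_measure_diag_proj[OF e T eig] by blast
next
  fix P assume "\<exists>E. is_spectral_measure D T E \<and> P = E \<Omega>"
  then obtain E where sm: "is_spectral_measure D T E" and P: "P = E \<Omega>" by blast
  have E: "projection_valued_measure E" using sm by (simp add: is_spectral_measure_def)
  have out: "E \<Theta> (e n) = 0" if "\<Theta> \<in> sets borel" "lam n \<notin> \<Theta>" for \<Theta> n
  proof -
    have m: "\<Theta> \<inter> {lam n<..} \<in> sets borel" "\<Theta> \<inter> {..<lam n} \<in> sets borel"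
      using that(1) by auto
    have u: "\<Theta> = (\<Theta> \<inter> {lam n<..}) \<union> (\<Theta> \<inter> {..<lam n})"
      using that(2) by (auto simp: not_less le_less)
    have "E (\<Theta> \<inter> {lam n<..}) (e n) = 0" "E (\<Theta> \<inter> {..<lam n}) (e n) = 0"
      by (rule spectral_measure_eigenvector[OF T sm eig m(1)], simp)
        (rule spectral_measure_eigenvector[OF T sm eig m(2)], simp)
    moreover have "(\<Theta> \<inter> {lam n<..}) \<inter> (\<Theta> \<inter> {..<lam n}) = {}" by auto
    ultimately show ?thesis
      using pvm_union[OF E m, of "e n"] by (subst u) simp
  qed
  have coeff: "E \<Omega> (e n) = (if lam n \<in> \<Omega> then e n else 0)" for n
  proof (cases "lam n \<in> \<Omega>")
    case True
    have c: "- \<Omega> \<in> sets borel" using \<Omega> by auto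
    have "E (\<Omega> \<union> - \<Omega>) (e n) = E \<Omega> (e n) + E (- \<Omega>) (e n)"
      by (rule pvm_union[OF E \<Omega> c]) simp
    then show ?thesis
      using E True out[OF c, of n] by (simp add: projection_valued_measure_def)
  qed (simp add: out[OF \<Omega>])
  have cs: "csym (E \<Omega>)" using pvm_proj[OF E \<Omega>] by (simp add: orth_projection_csym)
  show "P = diag_proj e lam \<Omega>"
  proof (rule ext, rule onb_eqI[OF e])
    fix x n
    have "cinner (e n) (P x) = cinner (E \<Omega> (e n)) x" by (simp add: P csymD[OF cs])
    then show "cinner (e n) (P x) = cinner (e n) (diag_proj e lam \<Omega> x)"
      by (simp add: coeff diag_proj_coeff[OF e])
  qed
qed

section \<open>Realisation of block-Hankel operators\<close>

lemma bounded_seq_span_subseq: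
  fixes b :: "'i \<Rightarrow> 'a::complex_inner"
  assumes I: "finite I" "orthonormal I b" and x: "\<And>n. x n \<in> cspan (b ` I)" "\<And>n. norm (x n) \<le> M"
  obtains r :: "nat \<Rightarrow> nat" and y where "strict_mono r" "y \<in> cspan (b ` I)" "(\<lambda>n. x (r n)) \<longlonglongrightarrow> y"
proof -
  obtain r :: "nat \<Rightarrow> nat"
    where r: "strict_mono r" "\<forall>f\<in>b ` I. convergent (\<lambda>n. cinner f (x (r n)))"
    using coordinates_convergent_subseq[OF finite_imageI[OF I(1)], of x M b] x(2) by blast
  define l where "l i = lim (\<lambda>n. cinner (b i) (x (r n)))" for i
  have l: "(\<lambda>n. cinner (b i) (x (r n))) \<longlonglongrightarrow> l i" if "i \<in> I" for i
    using r(2) that by (simp add: l_def convergent_LIMSEQ_iff)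
  have "(\<lambda>n. \<Sum>i\<in>I. cinner (b i) (x (r n)) *\<^sub>C b i) \<longlonglongrightarrow> (\<Sum>i\<in>I. l i *\<^sub>C b i)"
    by (intro tendsto_sum tendsto_scaleC l tendsto_const)
  moreover have "(\<Sum>i\<in>I. cinner (b i) (x (r n)) *\<^sub>C b i) = x (r n)" for n
    by (rule span_expansion[OF I x(1), symmetric])
  ultimately have "(\<lambda>n. x (r n)) \<longlonglongrightarrow> (\<Sum>i\<in>I. l i *\<^sub>C b i)" by simp
  moreover have "(\<Sum>i\<in>I. l i *\<^sub>C b i) \<in> cspan (b ` I)"
    by (intro cvec.span_sum cvec.span_scale, rule cvec.span_base, rule imageI)
  ultimately show ?thesis using that r(1) by blast
qed

lemma isometry_cinner:
  assumes V: "\<And>x y. V (x + y) = V x + V y" "\<And>c x. V (c *\<^sub>C x) = c *\<^sub>C V x"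
    and W: "csubspace W" "\<And>x. x \<in> W \<Longrightarrow> norm (V x) = norm x" and xy: "x \<in> W" "y \<in> W"
  shows "cinner (V x) (V y) = cinner x y"
proof -
  have re: "Re (cinner (V x) (V y)) = Re (cinner x y)" if y: "y \<in> W" for y
  proof -
    have "(norm (V x + V y))\<^sup>2 = (norm (x + y))\<^sup>2"
      using W(2)[OF csubspaceD(2)[OF W(1) xy(1) y]] by (simp add: V)
    then show ?thesis
      unfolding norm_add_cinner using W(2)[OF xy(1)] W(2)[OF y] by simp
  qed
  have "Re (cinner (V x) (V (\<i> *\<^sub>C y))) = Re (cinner x (\<i> *\<^sub>C y))"
    by (intro re csubspaceD[OF W(1)] xy)
  then have "Im (cinner (V x) (V y)) = Im (cinner x y)"
    by (simp add: V cinner_scaleC_right)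
  then show ?thesis using re[OF xy(2)] by (simp add: complex_eq_iff)
qed

lemma onb_unitary:
  fixes e :: "nat \<Rightarrow> 'a::chilbert_space" and f :: "nat \<Rightarrow> 'b::chilbert_space"
  assumes e: "onb e" and f: "onb f"
  obtains U where "clinear U" "bij U" "\<And>x y. cinner (U x) (U y) = cinner x y"
    "\<And>n x. cinner (f n) (U x) = cinner (e n) x"
proof -
  have ex: "\<exists>y. \<forall>n. cinner (g n) y = cinner (h n) x"
    if "onb g" "onb h" for g :: "nat \<Rightarrow> 'c::chilbert_space" and h :: "nat \<Rightarrow> 'd::chilbert_space" and x
    by (rule riesz_fischer[OF onb_orthonormal[OF that(1)]
          summable_orthonormal_coeff[OF onb_orthonormal[OF that(2)], of x]]) blast
  obtain U where U: "\<And>n x. cinner (f n) (U x) = cinner (e n) x"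
    using ex[OF f e] by metis
  obtain U' where U': "\<And>n x. cinner (e n) (U' x) = cinner (f n) x"
    using ex[OF e f] by metis
  have "clinear U"
    by (rule clinearI; rule onb_eqI[OF f])
      (simp_all add: U cinner_add_right cinner_scaleC_right)
  moreover have "bij U"
  proof (rule o_bij[of U'])
    show "U' \<circ> U = id" by (rule ext, rule onb_eqI[OF e]) (simp add: U U')
    show "U \<circ> U' = id" by (rule ext, rule onb_eqI[OF f]) (simp add: U U')
  qed
  moreover have "cinner (U x) (U y) = cinner x y" for x y
  proof -
    have "cinner (U x) (f n) = cinner x (e n)" for n
      using U[of n x] cnj_cinner by metis
    then show ?thesis
      using onb_parseval[OF f, of "U x" "U y"] onb_parseval[OF e, of x y] sums_unique2
      by (simp add: U)
  qed
  ultimately show ?thesis using that U by blast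
qed

definition ell2_single :: "nat \<Rightarrow> 'h::complex_inner \<Rightarrow> 'h ell2"
  where "ell2_single n v = Abs_ell2 (\<lambda>k. if k = n then v else 0)"

lemma ell2_nth_single: "ell2_nth (ell2_single n v) k = (if k = n then v else 0)"
proof -
  have "summable (\<lambda>k. (norm (if k = n then v else 0))\<^sup>2)"
    by (rule summable_finite[of "{n}"]) auto
  then show ?thesis by (simp add: ell2_single_def Abs_ell2_inverse)
qed

lemma cinner_ell2_single: "cinner (ell2_single n v) x = cinner v (ell2_nth x n)"
proof -
  have "(\<lambda>k. cinner (if k = n then v else 0) (ell2_nth x k))
      = (\<lambda>k. if k = n then cinner v (ell2_nth x k) else 0)" by auto
  then show ?thesis
    using sums_unique[OF sums_single[of n "\<lambda>k. cinner v (ell2_nth x k)"]]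
    by (simp add: cinner_ell2_def ell2_nth_single)
qed

lemma cinner_axis: "cinner (axis i 1) v = (v :: complex ^ 'n) $ i"
proof -
  have "(\<lambda>j. cinner ((axis i 1 :: complex ^ 'n) $ j) (v $ j)) = (\<lambda>j. if j = i then v $ j else 0)"
    by (auto simp: axis_def cinner_complex_def)
  then show ?thesis unfolding cinner_vec_def by (simp only:) simp
qed

lemma ell2_countable_total:
  "\<exists>S :: (complex ^ 'n) ell2 set. countable S \<and> ctotal S"
proof (intro exI conjI)
  let ?S = "range (\<lambda>(n, i). ell2_single n (axis i 1)) :: (complex ^ 'n) ell2 set"
  show "countable ?S"
    by (intro countable_image) (simp add: countableI_type)
  show "ctotal ?S"
    unfolding ctotal_def
  proof (intro allI impI)
    fix x :: "(complex ^ 'n) ell2"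
    assume x: "\<forall>s\<in>?S. cinner s x = 0"
    have "ell2_nth x n $ i = 0" for n i
    proof -
      have "cinner (ell2_single n (axis i 1)) x = 0" using x by auto
      then show ?thesis by (simp add: cinner_ell2_single cinner_axis)
    qed
    then show "x = 0" by (intro ell2_eqI) (simp add: vec_eq_iff zero_ell2.rep_eq)
  qed
qed

lemma ell2_infinite_dim: "\<not> cfinite_dim (UNIV :: (complex ^ 'n) ell2 set)"
proof
  assume "cfinite_dim (UNIV :: (complex ^ 'n) ell2 set)"
  then obtain B :: "(complex ^ 'n) ell2 set" where B: "finite B" "UNIV \<subseteq> cspan B"
    by (auto simp: cfinite_dim_def)
  fix i :: 'n
  have "orthonormal UNIV (\<lambda>n. ell2_single n (axis i 1 :: complex ^ 'n))"
    by (auto simp: orthonormal_def cinner_ell2_single ell2_nth_single cinner_axis)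
  from orthonormal_card_le[OF B(1) this] B(2) show False by auto
qed

text \<open>The state space is the span of the \<open>b i\<close>. \<open>iso\<close> says 1 - A* A
  = C* C, symmetry of A J says A J = J A*, and \<open>obs\<close> is an observability condition in
  place of a statement on unimodular eigenvalues; the \<open>J\<close>-invariance in it is what the
  check for flip chains exploits. \<open>projA\<close> makes \<open>A\<close> vanish on the
  orthogonal complement, so that it is a contraction everywhere.\<close>

context
  fixes I :: "'i set" and b :: "'i \<Rightarrow> 'a::chilbert_space" and A J :: "'a \<Rightarrow> 'a"
    and C :: "'a \<Rightarrow> complex ^ 'n"
  assumes fin: "finite I" and b: "orthonormal I b"
    and A: "clinear A" and C: "clinear C" and J: "csym J"
    and ranA: "\<And>x. A x \<in> cspan (b ` I)" and ranJ: "\<And>x. J x \<in> cspan (b ` I)"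
    and projA: "\<And>x. A (\<Sum>i\<in>I. cinner (b i) x *\<^sub>C b i) = A x"
    and iso: "\<And>x. x \<in> cspan (b ` I) \<Longrightarrow> (norm (A x))\<^sup>2 + (norm (C x))\<^sup>2 = (norm x)\<^sup>2"
    and K: "csym (\<lambda>x. A (J x))"
    and obs: "\<And>W. csubspace W \<Longrightarrow> W \<subseteq> cspan (b ` I) \<Longrightarrow>
      (\<forall>w\<in>W. A w \<in> W \<and> J w \<in> W \<and> C w = 0) \<Longrightarrow> W \<subseteq> {0}"
begin

private abbreviation R where "R \<equiv> cspan (b ` I)"
private definition P where "P x = (\<Sum>i\<in>I. cinner (b i) x *\<^sub>C b i)"
text \<open>\<open>Ad\<close> and \<open>Cd\<close> are the adjoints of \<open>A\<close> and
  \<open>C\<close> as maps into the state space, written out in the basis.\<close>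

private definition Ad where "Ad y = (\<Sum>i\<in>I. cinner (A (b i)) y *\<^sub>C b i)"
private definition Cd where "Cd u = (\<Sum>i\<in>I. cinner (C (b i)) u *\<^sub>C b i)"

private lemma subR: "csubspace R"
  by (rule cvec.subspace_span)

private lemma bR: "i \<in> I \<Longrightarrow> b i \<in> R"
  by (rule cvec.span_base) simp

private lemma sumR: "(\<Sum>i\<in>I. c i *\<^sub>C b i) \<in> R"
  by (intro cvec.span_sum cvec.span_scale bR)

private lemma PR: "P x \<in> R" unfolding P_def by (rule sumR)

private lemma P_id: "x \<in> R \<Longrightarrow> P x = x"
  unfolding P_def by (rule span_expansion[OF fin b, symmetric])

private lemma AP: "A (P x) = A x"
  unfolding P_def by (rule projA)

private lemma P_norm: "norm (P x) \<le> norm x"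
proof (rule power2_le_imp_le)
  show "(norm (P x))\<^sup>2 \<le> (norm x)\<^sup>2"
    unfolding P_def norm_orthonormal_sum[OF b fin] by (rule bessel[OF b fin])
qed simp

private lemma A_le: "norm (A x) \<le> norm x"
proof (rule power2_le_imp_le)
  have "(norm (A x))\<^sup>2 \<le> (norm (P x))\<^sup>2"
    using iso[OF PR, of x] zero_le_power2[of "norm (C (P x))"] unfolding AP by linarith
  also have "\<dots> \<le> (norm x)\<^sup>2" by (intro power_mono P_norm) simp
  finally show "(norm (A x))\<^sup>2 \<le> (norm x)\<^sup>2" .
qed simp

private lemma Ad: "cinner (Ad y) x = cinner y (A x)"
proof -
  have "cinner y (A x) = cinner y (A (P x))" by (simp add: AP)
  also have "\<dots> = (\<Sum>i\<in>I. cinner (b i) x * cinner y (A (b i)))"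
    by (simp add: P_def clinearD[OF A] cinner_sum_right cinner_scaleC_right)
  also have "\<dots> = cinner (Ad y) x"
    by (simp add: Ad_def cinner_sum_left cinner_scaleC_left cnj_cinner mult.commute)
  finally show ?thesis by simp
qed

private lemma AdR: "Ad y \<in> R" unfolding Ad_def by (rule sumR)

private lemma Ad_le: "norm (Ad y) \<le> norm y"
proof (cases "Ad y = 0")
  case False
  have "(norm (Ad y))\<^sup>2 = Re (cinner y (A (Ad y)))"
    unfolding Re_cinner_self[symmetric] Ad ..
  also have "\<dots> \<le> norm y * norm (Ad y)"
    by (intro order_trans[OF Re_cinner_le] mult_left_mono A_le) simp
  finally show ?thesis using False by (simp add: power2_eq_square)
qed simp

text \<open>The operator A J is its own adjoint, and its adjoint is J A*.\<close>

private lemma AJ: "A (J x) = J (Ad x)"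
proof (rule cinner_ext)
  fix y
  have "cinner (J (Ad x)) y = cinner (A (J x)) y"
    by (simp add: csymD[OF J] Ad) (rule csymD[OF K, symmetric])
  then show "cinner y (A (J x)) = cinner y (J (Ad x))"
    using cnj_cinner by metis
qed

private lemma AnJ: "(A ^^ n) (J x) = J ((Ad ^^ n) x)"
proof (induction n arbitrary: x)
  case (Suc n)
  have "(A ^^ Suc n) (J x) = (A ^^ n) (J (Ad x))" by (simp only: funpow_Suc_right o_apply AJ)
  also have "\<dots> = J ((Ad ^^ Suc n) x)" by (simp only: Suc funpow_Suc_right o_apply)
  finally show ?case .
qed simp

private lemma An_lin: "clinear (A ^^ n)"
proof (induction n)
  case 0
  show ?case by (rule clinearI) auto
next
  case (Suc n)
  show ?case by (rule clinearI) (simp_all add: clinearD[OF A] clinearD[OF Suc])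
qed

private lemma AnR: "x \<in> R \<Longrightarrow> (A ^^ n) x \<in> R"
  by (cases n) (auto simp: ranA)

private lemma An_le: "norm ((A ^^ n) x) \<le> norm x"
  by (induction n) (auto intro: order_trans[OF A_le])

private lemma An_diff_le: "norm ((A ^^ n) x - (A ^^ n) y) \<le> norm (x - y)"
  using An_le[of n "x - y"] by (simp add: clinearD[OF An_lin])

text \<open>The unobservable space: the largest \<open>A\<close>-invariant subspace of the state
  space on which \<open>C\<close> vanishes.\<close>

private definition W where "W = {x\<in>R. \<forall>n. C ((A ^^ n) x) = 0}"

private lemma subW: "csubspace W"
  unfolding W_def
  by (rule cvec.subspaceI)
    (auto simp: clinearD[OF An_lin] clinearD[OF C] csubspaceD[OF subR])

private lemma AW: "x \<in> W \<Longrightarrow> A x \<in> W"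
  unfolding W_def by (auto simp: ranA) (metis funpow_Suc_right o_apply)

private lemma AnW: "x \<in> W \<Longrightarrow> (A ^^ n) x \<in> W"
  by (induction n) (auto simp: AW)

private lemma C_W: "x \<in> W \<Longrightarrow> C x = 0"
  unfolding W_def by (auto dest: spec[of _ 0])

private lemma A_W_norm: "x \<in> W \<Longrightarrow> norm (A x) = norm x"
  using iso[of x] C_W[of x] by (simp add: W_def)

private lemma An_W_norm: "x \<in> W \<Longrightarrow> norm ((A ^^ n) x) = norm x"
  by (induction n) (simp_all add: A_W_norm AnW)

text \<open>\<open>A\<close> preserves norms on \<open>W\<close> and its adjoint is a contraction,
  so expanding |A* A x - x|^2 leaves nothing positive.\<close>

private lemma AdA: "x \<in> W \<Longrightarrow> Ad (A x) = x"
proof -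
  assume x: "x \<in> W"
  have "(norm (Ad (A x) - x))\<^sup>2 = (norm (Ad (A x)))\<^sup>2 - 2 * (norm (A x))\<^sup>2 + (norm x)\<^sup>2"
    unfolding norm_diff_cinner Ad Re_cinner_self ..
  also have "\<dots> \<le> 0"
    using power_mono[OF Ad_le[of "A x"] norm_ge_zero, of 2] A_W_norm[OF x] by simp
  finally show ?thesis by simp
qed

private lemma AdnAn: "x \<in> W \<Longrightarrow> (Ad ^^ n) ((A ^^ n) x) = x"
proof (induction n)
  case (Suc n)
  have "(Ad ^^ Suc n) ((A ^^ Suc n) x) = (Ad ^^ n) (Ad (A ((A ^^ n) x)))"
    by (subst funpow_Suc_right) simp
  then show ?case using Suc AdA[OF AnW[OF Suc.prems]] by simp
qed simp

text \<open>A bounded orbit in finite dimension has iterates close together whose exponents are far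
  apart; \<open>A\<close> is isometric on \<open>W\<close>, so the smaller power can be
  cancelled.\<close>

private lemma recurrent:
  assumes x: "x \<in> W" and e: "0 < e"
  obtains n where "k \<le> n" "norm (x - (A ^^ n) x) < e"
proof -
  obtain r :: "nat \<Rightarrow> nat" and y
    where r: "strict_mono r" "y \<in> R" "(\<lambda>n. (A ^^ r n) x) \<longlonglongrightarrow> y"
    by (rule bounded_seq_span_subseq[OF fin b, of "\<lambda>n. (A ^^ n) x" "norm x"])
      (use AnR x An_le in \<open>auto simp: W_def\<close>)
  then have c: "Cauchy (\<lambda>n. (A ^^ r n) x)" by (simp add: LIMSEQ_imp_Cauchy)
  obtain M where M: "\<forall>m\<ge>M. \<forall>n\<ge>M. norm ((A ^^ r m) x - (A ^^ r n) x) < e"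
    using CauchyD[OF c e] by blast
  have grow: "r M + k \<le> r (M + k)"
  proof (induction k)
    case (Suc k)
    have "r (M + k) < r (M + Suc k)" using r(1) by (simp add: strict_mono_def)
    then show ?case using Suc by simp
  qed simp
  define n where "n = r (M + k) - r M"
  have n: "r (M + k) = r M + n" "k \<le> n" using grow by (auto simp: n_def)
  have "(A ^^ r M) x - (A ^^ r (M + k)) x = (A ^^ r M) (x - (A ^^ n) x)"
    by (simp add: n(1) funpow_add clinearD[OF An_lin])
  moreover have "x - (A ^^ n) x \<in> W" by (intro csubspaceD[OF subW] AnW x)
  ultimately have "norm (x - (A ^^ n) x) < e"
    using M An_W_norm[of "x - (A ^^ n) x" "r M"] by (metis le_add1 order_refl)
  then show ?thesis using that n(2) by blast
qed

private lemma finite_rank_J: "finite_rank J"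
  unfolding finite_rank_def cfinite_dim_def
  using fin ranJ by (intro exI[of _ "b ` I"]) auto

text \<open>
  \<open>A\<close> is unitary on \<open>W\<close>, so the powers \<open>A\<^sup>n x\<close> return to \<open>x\<close>; as \<open>A\<^sup>n J A\<^sup>n x = J x\<close>,
  this keeps the norms of \<open>A\<^sup>k J x\<close> from decreasing.
\<close>

private lemma JW:
  assumes x: "x \<in> W"
  shows "J x \<in> W"
proof -
  obtain F M where "finite F" "orthonormal F (\<lambda>x. x)" "range J \<subseteq> cspan F" and M: "0 \<le> M"
    "\<And>x. norm (J x) \<le> M * norm x" "\<And>y. y \<in> ocomp (J ` F) \<Longrightarrow> J y = 0"
    using finite_rank_csym_bound[OF J finite_rank_J] by metis
  note Jlin = clinearD[OF csym_clinear[OF J]]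
  have norm_eq: "norm ((A ^^ k) (J x)) = norm (J x)" for k
  proof (rule antisym[OF An_le])
    show "norm (J x) \<le> norm ((A ^^ k) (J x))"
    proof (rule field_le_epsilon)
      fix e :: real assume e: "0 < e"
      then have "0 < e / (M + 1)" using M(1) by simp
      then obtain n where n: "k \<le> n" "norm (x - (A ^^ n) x) < e / (M + 1)"
        by (rule recurrent[OF x])
      define y where "y = J ((A ^^ n) x)"
      have "J x = (A ^^ n) y" unfolding y_def AnJ AdnAn[OF x] ..
      also have "\<dots> = (A ^^ (n - k)) ((A ^^ k) y)"
        using n(1) by (metis comp_apply funpow_add le_add_diff_inverse2)
      finally have "norm (J x) \<le> norm ((A ^^ k) y)" using An_le by metis
      also have "\<dots> \<le> norm ((A ^^ k) (J x)) + norm ((A ^^ k) y - (A ^^ k) (J x))"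
        using norm_triangle_sub by blast
      also have "norm ((A ^^ k) y - (A ^^ k) (J x)) \<le> norm (y - J x)" by (rule An_diff_le)
      also have "norm (y - J x) = norm (J (x - (A ^^ n) x))"
        by (simp add: y_def Jlin norm_minus_commute)
      also have "\<dots> \<le> M * norm (x - (A ^^ n) x)" by (rule M(2))
      also have "\<dots> \<le> M * (e / (M + 1))" using n(2) M(1) by (intro mult_left_mono) auto
      also have "\<dots> \<le> e" using M(1) e by (simp add: field_simps)
      finally show "norm (J x) \<le> norm ((A ^^ k) (J x)) + e" by simp
    qed
  qed
  have "C ((A ^^ k) (J x)) = 0" for k
    using iso[OF AnR[OF ranJ], of k x] norm_eq[of k] norm_eq[of "Suc k"] by simp
  then show ?thesis using ranJ by (simp add: W_def)
qed

private lemma W_zero: "x \<in> W \<Longrightarrow> x = 0"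
proof -
  assume x: "x \<in> W"
  have "W \<subseteq> R" by (auto simp: W_def)
  moreover have "\<forall>w\<in>W. A w \<in> W \<and> J w \<in> W \<and> C w = 0" using AW JW C_W by blast
  ultimately have "W \<subseteq> {0}" by (rule obs[OF subW])
  then show "x = 0" using x by blast
qed

private lemma blAn: "bounded_linear (A ^^ n)"
proof -
  have "bounded_clinear (A ^^ n)"
    unfolding bounded_clinear_def using An_lin An_le by (auto intro!: exI[of _ 1])
  then show ?thesis by (rule bounded_clinear_bounded_linear)
qed

text \<open>The norms decrease to some \<open>L\<close>, and all iterates of a cluster point
  \<open>y\<close> of the orbit have norm \<open>L\<close>. Then \<open>iso\<close> makes every
  output of \<open>y\<close> vanish, so \<open>y\<close> is unobservable and hence zero.\<close>

private lemma An_decay: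
  assumes x: "x \<in> R"
  shows "(\<lambda>n. norm ((A ^^ n) x)) \<longlonglongrightarrow> 0"
proof -
  have "decseq (\<lambda>n. norm ((A ^^ n) x))"
    by (rule decseq_SucI) (simp add: A_le)
  then obtain L where L: "(\<lambda>n. norm ((A ^^ n) x)) \<longlonglongrightarrow> L"
    by (rule decseq_convergent[of _ 0]) auto
  obtain r :: "nat \<Rightarrow> nat" and y
    where r: "strict_mono r" "y \<in> R" "(\<lambda>n. (A ^^ r n) x) \<longlonglongrightarrow> y"
    by (rule bounded_seq_span_subseq[OF fin b, of "\<lambda>n. (A ^^ n) x" "norm x"])
      (use AnR x An_le in auto)
  have norm_y: "norm ((A ^^ k) y) = L" for k
  proof -
    have "(\<lambda>n. norm ((A ^^ k) ((A ^^ r n) x))) \<longlonglongrightarrow> norm ((A ^^ k) y)"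
      by (intro tendsto_norm bounded_linear.tendsto[OF blAn] r(3))
    moreover have mono: "strict_mono (\<lambda>n. k + r n)" using r(1) by (simp add: strict_mono_def)
    have "(\<lambda>n. norm ((A ^^ k) ((A ^^ r n) x))) \<longlonglongrightarrow> L"
      using LIMSEQ_subseq_LIMSEQ[OF L mono] by (simp add: o_def funpow_add)
    ultimately show ?thesis by (rule LIMSEQ_unique)
  qed
  have "C ((A ^^ k) y) = 0" for k
    using iso[OF AnR[OF r(2)], of k] norm_y[of k] norm_y[of "Suc k"] by simp
  then have "y = 0" by (intro W_zero) (simp add: W_def r(2))
  then show ?thesis using L norm_y[of 0] by simp
qed

text \<open>By \<open>iso\<close>, |C A^j x|^2 is the drop from |A^j x|^2 to |A^(j+1) x|^2; the sum
  telescopes and the remainder decays.\<close>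

private lemma CA_sums:
  assumes x: "x \<in> R"
  shows "(\<lambda>j. (norm (C ((A ^^ j) x)))\<^sup>2) sums (norm x)\<^sup>2"
proof -
  have "(\<Sum>j<n. (norm (C ((A ^^ j) x)))\<^sup>2) = (norm x)\<^sup>2 - (norm ((A ^^ n) x))\<^sup>2" for n
  proof (induction n)
    case (Suc n)
    then show ?case using iso[OF AnR[OF x], of n] by simp
  qed simp
  moreover have "(\<lambda>n. (norm x)\<^sup>2 - (norm ((A ^^ n) x))\<^sup>2) \<longlonglongrightarrow> (norm x)\<^sup>2 - 0\<^sup>2"
    by (intro tendsto_intros An_decay x)
  ultimately show ?thesis by (simp add: sums_def)
qed

text \<open>The observability map. Projecting by \<open>P\<close> first makes the sequence
  square-summable for every \<open>x\<close>, as \<open>Abs_ell2\<close> requires.\<close>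

private definition V where "V x = Abs_ell2 (\<lambda>j. C ((A ^^ j) (P x)))"

private lemma V_nth: "ell2_nth (V x) j = C ((A ^^ j) (P x))"
proof -
  have "summable (\<lambda>j. (norm (C ((A ^^ j) (P x))))\<^sup>2)"
    using CA_sums[OF PR] by (rule sums_summable)
  then show ?thesis by (simp add: V_def Abs_ell2_inverse)
qed

private lemma P_lin: "P (x + y) = P x + P y" "P (c *\<^sub>C x) = c *\<^sub>C P x"
  by (simp_all add: P_def cinner_add_right cinner_scaleC_right scaleC_add_left sum.distrib
      cvec.scale_sum_right scaleC_scaleC)

private lemma V_lin: "V (x + y) = V x + V y" "V (c *\<^sub>C x) = c *\<^sub>C V x"
  by (rule ell2_eqI, simp add: V_nth P_lin clinearD[OF C] clinearD[OF An_lin]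
      plus_ell2.rep_eq scaleC_ell2.rep_eq)+

private lemma V_norm: "x \<in> R \<Longrightarrow> norm (V x) = norm x"
proof -
  assume x: "x \<in> R"
  have "(norm (V x))\<^sup>2 = (norm x)\<^sup>2"
    using sums_unique[OF CA_sums[OF x]] by (simp add: ell2_norm_square V_nth P_id[OF x])
  then show ?thesis by simp
qed

private lemma V_cinner: "x \<in> R \<Longrightarrow> y \<in> R \<Longrightarrow> cinner (V x) (V y) = cinner x y"
  by (rule isometry_cinner[OF V_lin subR V_norm])

private lemma VP: "V (P x) = V x"
  by (simp add: V_def P_id PR)

private lemma orthonormal_V: "orthonormal I (\<lambda>i. V (b i))"
  using b by (simp add: orthonormal_def V_cinner bR)

text \<open>The adjoint of \<open>V\<close>, so that \<Gamma> below is V J V*.\<close>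

private definition Vd where "Vd y = (\<Sum>i\<in>I. cinner (V (b i)) y *\<^sub>C b i)"

private lemma Vd: "cinner (V x) y = cinner x (Vd y)"
proof -
  have Vlin: "clinear V" by (rule clinearI) (simp_all add: V_lin)
  have "V x = V (P x)" by (rule VP[symmetric])
  also have "\<dots> = (\<Sum>i\<in>I. cinner (b i) x *\<^sub>C V (b i))"
    by (simp add: P_def clinearD[OF Vlin])
  finally have "cinner (V x) y = (\<Sum>i\<in>I. cnj (cinner (b i) x) * cinner (V (b i)) y)"
    by (simp add: cinner_sum_left cinner_scaleC_left)
  then show ?thesis
    by (simp add: Vd_def cinner_sum_right cinner_scaleC_right cnj_cinner mult.commute)
qed

private definition \<Gamma> where "\<Gamma> y = V (J (Vd y))"

private lemma csym_\<Gamma>: "csym \<Gamma>"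
  unfolding csym_def
proof (intro allI)
  fix x y
  have "cinner (\<Gamma> x) y = cinner (Vd x) (J (Vd y))"
    by (simp add: \<Gamma>_def Vd csymD[OF J])
  also have "\<dots> = cnj (cinner (V (J (Vd y))) x)"
    by (simp only: Vd cnj_cinner)
  finally show "cinner (\<Gamma> x) y = cinner x (\<Gamma> y)"
    by (simp only: cnj_cinner \<Gamma>_def)
qed

private lemma \<Gamma>_sum: "\<Gamma> y = (\<Sum>i\<in>I. cinner (V (b i)) y *\<^sub>C V (J (b i)))"
proof -
  have Vlin: "clinear V" by (rule clinearI) (simp_all add: V_lin)
  show ?thesis
    by (simp add: \<Gamma>_def Vd_def clinearD[OF Vlin] clinearD[OF csym_clinear[OF J]])
qed

private lemma finite_rank_\<Gamma>: "finite_rank \<Gamma>"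
  unfolding \<Gamma>_sum[abs_def] by (rule finite_rank_sum[OF fin])

text \<open>The basis sum collapses to C A^j J Ad^k Cd u, and \<open>AnJ\<close> turns J Ad^k into
  A^k J: only j + k survives.\<close>

private lemma hankel_entry:
  "(\<Sum>i\<in>I. cinner (C ((A ^^ k) (b i))) u *\<^sub>C C ((A ^^ j) (J (b i))))
    = C ((A ^^ (j + k)) (J (Cd u)))"
proof -
  define w where "w = (\<Sum>i\<in>I. cinner (C ((A ^^ k) (b i))) u *\<^sub>C b i)"
  have Cd_eq: "cinner x (Cd u) = cinner (C x) u" if x: "x \<in> R" for x
  proof -
    have "C x = (\<Sum>i\<in>I. cinner (b i) x *\<^sub>C C (b i))"
      by (subst P_id[OF x, symmetric]) (simp add: P_def clinearD[OF C])
    then show ?thesis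
      by (simp add: Cd_def cinner_sum_left cinner_sum_right cinner_scaleC_left
          cinner_scaleC_right cnj_cinner mult.commute)
  qed
  have Adn: "cinner x ((Ad ^^ k) y) = cinner ((A ^^ k) x) y" for x y k
  proof (induction k arbitrary: x)
    case (Suc k)
    have "cinner x ((Ad ^^ Suc k) y) = cinner (A x) ((Ad ^^ k) y)"
      using Ad[of "(Ad ^^ k) y" x] cnj_cinner by (metis comp_apply funpow.simps(2))
    then show ?case by (simp only: Suc funpow_Suc_right o_apply)
  qed simp
  have AdnR: "(Ad ^^ k) (Cd u) \<in> R"
    by (cases k) (auto simp: AdR Cd_def sumR)
  have "w = (\<Sum>i\<in>I. cinner (b i) ((Ad ^^ k) (Cd u)) *\<^sub>C b i)"
    unfolding w_def by (rule sum.cong) (simp_all add: Adn Cd_eq AnR bR)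
  also have "\<dots> = (Ad ^^ k) (Cd u)" by (rule span_expansion[OF fin b AdnR, symmetric])
  finally have w: "w = (Ad ^^ k) (Cd u)" .
  have "(\<Sum>i\<in>I. cinner (C ((A ^^ k) (b i))) u *\<^sub>C C ((A ^^ j) (J (b i)))) = C ((A ^^ j) (J w))"
    by (simp add: w_def clinearD[OF C] clinearD[OF An_lin] clinearD[OF csym_clinear[OF J]])
  also have "\<dots> = C ((A ^^ j) ((A ^^ k) (J (Cd u))))" by (simp add: w AnJ)
  finally show ?thesis by (simp add: funpow_add)
qed

private definition entry :: "nat \<Rightarrow> complex ^ 'n ^ 'n"
  where "entry n = (\<chi> p q. C ((A ^^ n) (J (Cd (axis q 1)))) $ p)"

private lemma entry: "entry n *v u = C ((A ^^ n) (J (Cd u)))"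
proof -
  define f where "f u = C ((A ^^ n) (J (Cd u)))" for u
  have f: "clinear f"
    by (rule clinearI) (simp_all add: f_def Cd_def clinearD[OF C] clinearD[OF An_lin]
        clinearD[OF csym_clinear[OF J]] cinner_add_right cinner_scaleC_right scaleC_add_left
        sum.distrib cvec.scale_sum_right scaleC_scaleC)
  have "u = (\<Sum>q\<in>UNIV. (u $ q) *\<^sub>C axis q 1)"
    by (simp add: vec_eq_iff scaleC_vec_def scaleC_complex_def axis_def if_distrib
        cong: if_cong)
  then have "f u = (\<Sum>q\<in>UNIV. (u $ q) *\<^sub>C f (axis q 1))"
    by (metis (no_types, lifting) clinearD(2,6)[OF f] sum.cong)
  then show ?thesis
    by (simp add: vec_eq_iff matrix_vector_mult_def entry_def f_def scaleC_vec_def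
        scaleC_complex_def mult.commute)
qed

private lemma hankel_sums: "(\<lambda>k. entry (j + k) *v ell2_nth y k) sums ell2_nth (\<Gamma> y) j"
proof -
  have nth_sum: "ell2_nth (\<Sum>i\<in>S. c i *\<^sub>C v i) j = (\<Sum>i\<in>S. c i *\<^sub>C ell2_nth (v i) j)"
    if "finite S" for S :: "'i set" and c and v :: "'i \<Rightarrow> (complex ^ 'n) ell2"
    using that by (induction S)
      (simp_all add: zero_ell2.rep_eq plus_ell2.rep_eq scaleC_ell2.rep_eq)
  have "(\<lambda>k. cinner (ell2_nth (V (b i)) k) (ell2_nth y k)) sums cinner (V (b i)) y" for i
    unfolding cinner_ell2_def
    by (intro summable_sums summable_ell2_cinner ell2_summable)
  then have s: "(\<lambda>k. cinner (ell2_nth (V (b i)) k) (ell2_nth y k) *\<^sub>C ell2_nth (V (J (b i))) j)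
      sums (cinner (V (b i)) y *\<^sub>C ell2_nth (V (J (b i))) j)" for i
    by (rule bounded_linear.sums[OF bounded_bilinear.bounded_linear_left[OF bounded_bilinear_scaleC]])
  have "(\<lambda>k. \<Sum>i\<in>I. cinner (ell2_nth (V (b i)) k) (ell2_nth y k) *\<^sub>C ell2_nth (V (J (b i))) j)
      sums (\<Sum>i\<in>I. cinner (V (b i)) y *\<^sub>C ell2_nth (V (J (b i))) j)"
    by (rule sums_sum) (rule s)
  also have "(\<Sum>i\<in>I. cinner (V (b i)) y *\<^sub>C ell2_nth (V (J (b i))) j) = ell2_nth (\<Gamma> y) j"
    by (simp add: \<Gamma>_sum nth_sum[OF fin])
  also have "(\<lambda>k. \<Sum>i\<in>I. cinner (ell2_nth (V (b i)) k) (ell2_nth y k) *\<^sub>C ell2_nth (V (J (b i))) j)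
      = (\<lambda>k. entry (j + k) *v ell2_nth y k)"
    unfolding entry hankel_entry[symmetric]
    by (intro ext sum.cong) (simp_all add: V_nth P_id bR ranJ)
  finally show ?thesis .
qed

lemma hankel_realisation:
  obtains \<Gamma> :: "(complex ^ 'n) ell2 \<Rightarrow> (complex ^ 'n) ell2" and V
  where "block_hankel \<Gamma>" "finite_rank \<Gamma>" "orthonormal I (\<lambda>i. V (b i))"
    "\<And>x. V x = (\<Sum>i\<in>I. cinner (b i) x *\<^sub>C V (b i))"
    "\<And>y. \<Gamma> y = V (J (\<Sum>i\<in>I. cinner (V (b i)) y *\<^sub>C b i))"
proof -
  have Vlin: "clinear V" by (rule clinearI) (simp_all add: V_lin)
  have V_exp: "V x = (\<Sum>i\<in>I. cinner (b i) x *\<^sub>C V (b i))" for x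
  proof -
    have "V x = V (P x)" by (rule VP[symmetric])
    also have "\<dots> = (\<Sum>i\<in>I. cinner (b i) x *\<^sub>C V (b i))"
      by (simp add: P_def clinearD[OF Vlin])
    finally show ?thesis .
  qed
  obtain F M where "finite F" "orthonormal F (\<lambda>x. x)" "range \<Gamma> \<subseteq> cspan F" "0 \<le> M"
    and M: "\<And>x. norm (\<Gamma> x) \<le> M * norm x" "\<And>y. y \<in> ocomp (\<Gamma> ` F) \<Longrightarrow> \<Gamma> y = 0"
    using finite_rank_csym_bound[OF csym_\<Gamma> finite_rank_\<Gamma>] by metis
  have "block_hankel \<Gamma>"
    unfolding block_hankel_def
  proof (intro conjI)
    show "bounded_clinear \<Gamma>"
      unfolding bounded_clinear_def using csym_clinear[OF csym_\<Gamma>] M(1) by blast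
    show "selfadjoint UNIV \<Gamma>" using csym_\<Gamma> by (simp add: selfadjoint_UNIV_iff)
    show "\<exists>a. \<forall>x j. (\<lambda>k. a (j + k) *v ell2_nth x k) sums ell2_nth (\<Gamma> x) j"
      using hankel_sums by blast
  qed
  then show ?thesis
    by (rule that[OF _ finite_rank_\<Gamma> orthonormal_V V_exp]) (simp add: \<Gamma>_def Vd_def)
qed

text \<open>The two finite orthonormal systems are extended to bases of both spaces and matched by a
  unitary. Off these systems \<open>J\<close> and \<Gamma> both vanish, so the unitary intertwines
  them.\<close>

lemma hankel_unitarily_equivalent:
  assumes inf: "\<not> cfinite_dim (UNIV :: 'a set)"
    and S: "countable S" "ctotal (S :: 'a set)"
  shows "\<exists>\<Gamma> :: (complex ^ 'n) ell2 \<Rightarrow> (complex ^ 'n) ell2.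
    block_hankel \<Gamma> \<and> finite_rank \<Gamma> \<and> unitarily_equivalent J \<Gamma>"
proof (rule hankel_realisation)
  fix \<Gamma> :: "(complex ^ 'n) ell2 \<Rightarrow> (complex ^ 'n) ell2" and V
  assume \<Gamma>: "block_hankel \<Gamma>" "finite_rank \<Gamma>" and oV: "orthonormal I (\<lambda>i. V (b i))"
    and V: "\<And>x. V x = (\<Sum>i\<in>I. cinner (b i) x *\<^sub>C V (b i))"
    and \<Gamma>V: "\<And>y. \<Gamma> y = V (J (\<Sum>i\<in>I. cinner (V (b i)) y *\<^sub>C b i))"
  define n where "n = card I"
  obtain g where g: "bij_betw g {..<n} I"
    using ex_bij_betw_nat_finite[OF fin] by (auto simp: n_def atLeast0LessThan)
  then have gI: "g ` {..<n} = I" "inj_on g {..<n}" by (auto simp: bij_betw_def)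
  have o1: "orthonormal {..<n} (\<lambda>k. b (g k))"
    using orthonormal_compose[of g "{..<n}" b] b gI by simp
  have o2: "orthonormal {..<n} (\<lambda>k. V (b (g k)))"
    using orthonormal_compose[of g "{..<n}" "\<lambda>i. V (b i)"] oV gI by simp
  obtain e where e: "onb e" "\<And>k. k < n \<Longrightarrow> e k = b (g k)"
    using onb_extend[OF inf S o1] by metis
  obtain S' :: "(complex ^ 'n) ell2 set" where S': "countable S'" "ctotal S'"
    using ell2_countable_total by metis
  obtain f where f: "onb f" "\<And>k. k < n \<Longrightarrow> f k = V (b (g k))"
    using onb_extend[OF ell2_infinite_dim S' o2] by metis
  obtain U where U: "clinear U" "bij U" "\<And>x y. cinner (U x) (U y) = cinner x y"
    "\<And>n x. cinner (f n) (U x) = cinner (e n) x"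
    using onb_unitary[OF e(1) f(1)] by metis
  have Vb: "cinner (V (b i)) (U x) = cinner (b i) x"
    and cross: "cinner (f m) (V (b i)) = cinner (e m) (b i)" if i: "i \<in> I" for i x m
  proof -
    obtain k where k: "k < n" "i = g k" using i gI(1) by auto
    show "cinner (V (b i)) (U x) = cinner (b i) x"
      using U(4)[of k x] by (simp add: k e(2) f(2))
    have "cinner (f m) (f k) = cinner (e m) (e k)"
      using orthonormalD[OF onb_orthonormal[OF f(1)], of m k]
        orthonormalD[OF onb_orthonormal[OF e(1)], of m k] by simp
    then show "cinner (f m) (V (b i)) = cinner (e m) (b i)" by (simp add: k e(2) f(2))
  qed
  have JP: "J (P x) = J x" for x
  proof (rule cinner_ext)
    fix y
    have "cinner (J y) (x - P x) = 0"
      by (rule cinner_span_eq_0[OF ranJ]) (auto simp: P_def orthonormal_residual[OF b fin])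
    then show "cinner y (J (P x)) = cinner y (J x)"
      using csymD[OF J, of y] by (simp add: cinner_diff_right)
  qed
  have "U (J x) = \<Gamma> (U x)" for x
  proof -
    have "\<Gamma> (U x) = V (J (P x))" by (simp add: \<Gamma>V Vb P_def)
    also have "\<dots> = V (J x)" by (simp add: JP)
    also have "\<dots> = U (J x)"
    proof (rule onb_eqI[OF f(1)])
      fix m
      have "cinner (f m) (V (J x)) = (\<Sum>i\<in>I. cinner (b i) (J x) * cinner (e m) (b i))"
        by (subst V) (simp add: cinner_sum_right cinner_scaleC_right cross)
      also have "\<dots> = cinner (e m) (\<Sum>i\<in>I. cinner (b i) (J x) *\<^sub>C b i)"
        by (simp add: cinner_sum_right cinner_scaleC_right)
      also have "\<dots> = cinner (e m) (J x)"
        by (simp only: span_expansion[OF fin b ranJ, symmetric])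
      finally show "cinner (f m) (V (J x)) = cinner (f m) (U (J x))" by (simp add: U(4))
    qed
    finally show ?thesis by simp
  qed
  then have "unitarily_equivalent J \<Gamma>"
    unfolding unitarily_equivalent_def using U(1-3) by blast
  then show ?thesis using \<Gamma> by blast
qed

end

section \<open>Self-adjoint operators built from flip chains\<close>

text \<open>Vandermonde by elimination: subtracting t u times the relation for n from that for n + 1
  removes the term of \<open>u\<close> and multiplies the others by the nonzero numbers t i - t
  u.\<close>

lemma sum_powers_eq_0:
  fixes g :: "'i \<Rightarrow> complex" and t :: "'i \<Rightarrow> real"
  assumes "finite X" "inj_on t X" "\<And>n. (\<Sum>i\<in>X. g i * complex_of_real (t i ^ n)) = 0" "i \<in> X"
  shows "g i = 0"
  using assms
proof (induction X arbitrary: g i rule: finite_induct)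
  case (insert u X)
  have zero: "g i = 0" if i: "i \<in> X" for i
  proof -
    have "(\<Sum>i\<in>X. (g i * complex_of_real (t i - t u)) * complex_of_real (t i ^ n)) = 0" for n
    proof -
      have "(\<Sum>i\<in>insert u X. g i * complex_of_real (t i ^ Suc n))
          - complex_of_real (t u) * (\<Sum>i\<in>insert u X. g i * complex_of_real (t i ^ n))
          = (\<Sum>i\<in>insert u X. (g i * complex_of_real (t i - t u)) * complex_of_real (t i ^ n))"
        unfolding sum_distrib_left sum_subtractf[symmetric]
        by (rule sum.cong) (simp_all add: algebra_simps)
      then have "(\<Sum>i\<in>insert u X. (g i * complex_of_real (t i - t u)) * complex_of_real (t i ^ n)) = 0"
        unfolding insert.prems(2) by simp
      then show ?thesis using insert.hyps by simp
    qed
    then have "g i * complex_of_real (t i - t u) = 0"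
      using insert.IH[of "\<lambda>i. g i * complex_of_real (t i - t u)" i] insert.prems(1) i
      by (simp add: inj_on_def)
    moreover have "t i \<noteq> t u" using insert.prems(1) insert.hyps(2) i by (auto simp: inj_on_def)
    ultimately show ?thesis by simp
  qed
  have "(\<Sum>i\<in>X. g i) = 0" by (rule sum.neutral) (use zero in blast)
  then have "g u = 0" using insert.prems(2)[of 0] insert.hyps by simp
  then show ?case using zero insert.prems(3) by auto
qed simp

text \<open>Roots of the eigenvalues are taken in a diagonalisation. The range condition will
  confine the root to the span of the chain heads.\<close>

lemma psd_square_root:
  fixes Q :: "'a::chilbert_space \<Rightarrow> 'a"
  assumes Q: "csym Q" "finite_rank Q" and pos: "\<And>x. 0 \<le> Re (cinner x (Q x))"
  obtains K where "csym K" "\<And>x. (norm (K x))\<^sup>2 = Re (cinner x (Q x))" "\<And>x. K x \<in> cspan (range Q)"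
proof (rule finite_rank_csym_diagonal[OF Q])
  fix M and \<mu> :: "'a \<Rightarrow> real"
  assume M: "finite M" "orthonormal M (\<lambda>x. x)" "M \<subseteq> range Q"
    "\<And>m. m \<in> M \<Longrightarrow> \<mu> m \<noteq> 0" "\<And>m. m \<in> M \<Longrightarrow> Q m = complex_of_real (\<mu> m) *\<^sub>C m"
    "\<And>x. Q x = (\<Sum>m\<in>M. (complex_of_real (\<mu> m) * cinner m x) *\<^sub>C m)"
  have mu: "0 \<le> \<mu> m" if "m \<in> M" for m
    using pos[of m] M(5)[OF that] orthonormal_norm[OF M(2) that]
    by (simp add: cinner_scaleC_right cinner_self)
  define K where "K x = (\<Sum>m\<in>M. (complex_of_real (sqrt (\<mu> m)) * cinner m x) *\<^sub>C m)" for x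
  have "csym K" unfolding K_def by (rule csym_diagonal)
  moreover have "(norm (K x))\<^sup>2 = Re (cinner x (Q x))" for x
  proof -
    have "(norm (K x))\<^sup>2 = (\<Sum>m\<in>M. \<mu> m * (cmod (cinner m x))\<^sup>2)"
      unfolding K_def norm_orthonormal_sum[OF M(2,1)]
      by (rule sum.cong) (simp_all add: norm_mult power_mult_distrib mu)
    also have "complex_of_real \<dots> = cinner x (Q x)"
      unfolding of_real_sum
      by (subst M(6), subst cinner_sum_right, rule sum.cong)
        (simp_all only: cinner_scaleC_right of_real_mult complex_norm_square cnj_cinner mult.assoc)
    finally show ?thesis by (metis Re_complex_of_real)
  qed
  moreover have "K x \<in> cspan (range Q)" for x
    unfolding K_def
    by (intro cvec.span_sum cvec.span_scale, rule cvec.span_base) (use M(3) in auto)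
  ultimately show ?thesis using that by blast
qed

text \<open>Each member of \<open>Ch\<close> labels a chain with scale \<open>s c\<close> and output
  channel \<kappa> c. On a chain \<open>J\<close> has the eigenvalues s c and - s c, but only s c if
  the length is 1; the last two assumptions say that in one channel these values never coincide
  across chains.\<close>

context
  fixes Ch :: "'c set" and len :: "'c \<Rightarrow> nat" and b :: "'c \<times> nat \<Rightarrow> 'a::chilbert_space"
    and s :: "'c \<Rightarrow> real" and \<kappa> :: "'c \<Rightarrow> 'n::finite" and J :: "'a \<Rightarrow> 'a"
  assumes finCh: "finite Ch" and len: "\<And>c. c \<in> Ch \<Longrightarrow> 1 \<le> len c"
    and s0: "\<And>c. c \<in> Ch \<Longrightarrow> s c \<noteq> 0"
    and b: "orthonormal (SIGMA c:Ch. {..<len c}) b"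
    and J: "csym J" and ranJ: "\<And>x. J x \<in> cspan (b ` (SIGMA c:Ch. {..<len c}))"
    and Jb: "\<And>c j. c \<in> Ch \<Longrightarrow> j < len c \<Longrightarrow> J (b (c, j)) = s c *\<^sub>R b (c, len c - 1 - j)"
    and inj: "\<And>c c'. c \<in> Ch \<Longrightarrow> c' \<in> Ch \<Longrightarrow> \<kappa> c = \<kappa> c' \<Longrightarrow> s c = s c' \<Longrightarrow> c = c'"
    and opp: "\<And>c c'. c \<in> Ch \<Longrightarrow> c' \<in> Ch \<Longrightarrow> \<kappa> c = \<kappa> c' \<Longrightarrow> s c = - s c' \<Longrightarrow> len c = 1 \<and> len c' = 1"
begin

private definition I where "I = (SIGMA c:Ch. {..<len c})"
private abbreviation L where "L \<equiv> cspan (b ` I)"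

private lemma finI: "finite I"
  unfolding I_def using finCh by simp

private lemma bI: "orthonormal I b"
  using b by (simp add: I_def)

private lemma ranJ': "J x \<in> L"
  using ranJ by (simp add: I_def)

private lemma bL: "i \<in> I \<Longrightarrow> b i \<in> L"
  by (rule cvec.span_base) simp

private lemma sumL: "(\<Sum>i\<in>I. c i *\<^sub>C b i) \<in> L"
  by (intro cvec.span_sum cvec.span_scale bL)

private lemma R_eqI:
  assumes "x \<in> L" "y \<in> L" "\<And>i. i \<in> I \<Longrightarrow> cinner (b i) x = cinner (b i) y"
  shows "x = y"
  using span_expansion[OF finI bI assms(1)] span_expansion[OF finI bI assms(2)] assms(3) by simp

private lemma R_norm:
  assumes "x \<in> L"
  shows "(norm x)\<^sup>2 = (\<Sum>i\<in>I. (cmod (cinner (b i) x))\<^sup>2)"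
  using norm_orthonormal_sum[OF bI finI, of "\<lambda>i. cinner (b i) x"]
    span_expansion[OF finI bI assms] by simp

text \<open>\<open>flip\<close> is the index map of \<open>J\<close>, and \<open>flop\<close> that
  of \<open>K\<close> off the heads. \<open>flop\<close> after \<open>flip\<close> sends position j
  to j + 1, so K J^{-1} shifts along the chain up to its end.\<close>

private definition flip where "flip = (\<lambda>(c, j). (c, len c - 1 - j))"
private definition flop where "flop = (\<lambda>(c, j). (c, len c - j))"
private definition I1 where "I1 = {i\<in>I. snd i \<noteq> 0}"

private lemma flip: "i \<in> I \<Longrightarrow> flip i \<in> I" "i \<in> I \<Longrightarrow> flip (flip i) = i" "fst (flip i) = fst i"
  by (auto simp: I_def flip_def split: prod.splits)

private lemma flop: "i \<in> I1 \<Longrightarrow> flop i \<in> I1" "i \<in> I1 \<Longrightarrow> flop (flop i) = i" "fst (flop i) = fst i"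
  by (auto simp: I_def I1_def flop_def split: prod.splits)

private lemma I1_sub: "i \<in> I1 \<Longrightarrow> i \<in> I"
  by (simp add: I1_def)

private lemma sum_flip: "(\<Sum>i\<in>I. F (flip i)) = (\<Sum>i\<in>I. F i)"
  by (rule sum.reindex_bij_witness[of _ flip flip]) (auto simp: flip)

private lemma sum_flop: "(\<Sum>i\<in>I1. F (flop i)) = (\<Sum>i\<in>I1. F i)"
  by (rule sum.reindex_bij_witness[of _ flop flop]) (auto simp: flop)

private lemma sum_split: "(\<Sum>i\<in>I. F i) = (\<Sum>i\<in>I1. F i) + (\<Sum>c\<in>Ch. F (c, 0))"
proof -
  have "0 < len c" if "c \<in> Ch" for c using len[OF that] by simp
  then have "I = I1 \<union> (\<lambda>c. (c, 0)) ` Ch" by (auto simp: I_def I1_def image_iff)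
  moreover have "I1 \<inter> (\<lambda>c. (c, 0)) ` Ch = {}" by (auto simp: I1_def)
  moreover have "finite I1" using finI by (simp add: I1_def)
  ultimately have "(\<Sum>i\<in>I. F i) = (\<Sum>i\<in>I1. F i) + (\<Sum>i\<in>(\<lambda>c. (c, 0)) ` Ch. F i)"
    using finCh by (metis finite_imageI sum.union_disjoint)
  then show ?thesis by (simp add: sum.reindex inj_on_def)
qed

private lemma J_coeff: "i \<in> I \<Longrightarrow> cinner (b i) (J x) = complex_of_real (s (fst i)) * cinner (b (flip i)) x"
proof -
  assume i: "i \<in> I"
  then obtain c j where cj: "i = (c, j)" "c \<in> Ch" "j < len c" by (auto simp: I_def)
  have "cinner (b i) (J x) = cinner (J (b i)) x" by (rule csymD[OF J, symmetric])
  then show ?thesis by (simp add: cj Jb flip_def scaleR_scaleC cinner_scaleC_left)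
qed

text \<open>The inverse of \<open>J\<close> on \<open>L\<close>, zero on the orthogonal
  complement.\<close>

private definition J' where
  "J' x = (\<Sum>i\<in>I. (complex_of_real (1 / s (fst i)) * cinner (b (flip i)) x) *\<^sub>C b i)"

private lemma J'_coeff:
  "i \<in> I \<Longrightarrow> cinner (b i) (J' x) = complex_of_real (1 / s (fst i)) * cinner (b (flip i)) x"
  unfolding J'_def by (rule cinner_unique_sum[OF bI finI])

private lemma J'R: "J' x \<in> L" unfolding J'_def by (rule sumL)

private lemma s_I: "i \<in> I \<Longrightarrow> s (fst i) \<noteq> 0"
  using s0 by (auto simp: I_def)

private lemma JJ': "x \<in> L \<Longrightarrow> J (J' x) = x"
  by (rule R_eqI[OF ranJ']) (simp_all add: J_coeff J'_coeff flip s_I)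

private lemma J'J: "x \<in> L \<Longrightarrow> J' (J x) = x"
  by (rule R_eqI[OF J'R]) (simp_all add: J_coeff J'_coeff flip s_I)

private lemma J'J_coeff: "i \<in> I \<Longrightarrow> cinner (b i) (J' (J x)) = cinner (b i) x"
  by (simp add: J_coeff J'_coeff flip s_I)

private lemma J'_clinear: "clinear J'"
  by (rule clinearI; rule R_eqI)
    (simp_all add: J'R J'_coeff cvec.subspace_add[OF cvec.subspace_span]
      cvec.subspace_scale[OF cvec.subspace_span] cinner_add_right cinner_scaleC_right distrib_left)

text \<open>A single output has to observe all heads of channel \<open>k\<close>; their sum suffices
  because the scales differ.\<close>

private definition v where "v k = (\<Sum>c\<in>{c\<in>Ch. \<kappa> c = k}. b (c, 0))"

private lemma cinner_v: "cinner (v k) x = (\<Sum>c\<in>{c\<in>Ch. \<kappa> c = k}. cinner (b (c, 0)) x)"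
  by (simp add: v_def cinner_sum_left)

text \<open>The size is dictated by \<open>Q_pos\<close>, where Cauchy-Schwarz over the heads of a
  channel costs a factor of at most \<open>card Ch\<close>.\<close>

private lemma small_exists: "\<exists>\<gamma>::real. 0 < \<gamma> \<and> (\<forall>c\<in>Ch. \<gamma>\<^sup>2 * real (card Ch) \<le> (s c)\<^sup>2)"
proof (cases "Ch = {}")
  case True
  then show ?thesis by (auto intro: exI[of _ 1])
next
  case False
  define m where "m = Min ((\<lambda>c. (s c)\<^sup>2) ` Ch)"
  have m: "0 < m" unfolding m_def using finCh False s0 by (subst Min_gr_iff) auto
  have card: "0 < card Ch" using finCh False by (simp add: card_gt_0_iff)
  have "(sqrt (m / card Ch))\<^sup>2 * real (card Ch) \<le> (s c)\<^sup>2" if "c \<in> Ch" for c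
    using m card finCh that by (simp add: m_def)
  then show ?thesis using m card by (intro exI[of _ "sqrt (m / card Ch)"]) simp
qed

private definition \<gamma> where "\<gamma> = (SOME \<gamma>::real. 0 < \<gamma> \<and> (\<forall>c\<in>Ch. \<gamma>\<^sup>2 * real (card Ch) \<le> (s c)\<^sup>2))"

private lemma \<gamma>: "0 < \<gamma>" "c \<in> Ch \<Longrightarrow> \<gamma>\<^sup>2 * real (card Ch) \<le> (s c)\<^sup>2"
  using someI_ex[OF small_exists] unfolding \<gamma>_def by blast+

text \<open>On the heads this is J^2 minus C'* C' for the output map \<open>C'\<close> below; its
  root is the part of \<open>K\<close> that \<open>flop\<close> leaves open.\<close>

private definition Q where
  "Q x = (\<Sum>c\<in>Ch. (complex_of_real ((s c)\<^sup>2) * cinner (b (c, 0)) x) *\<^sub>C b (c, 0))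
    + (\<Sum>k\<in>UNIV. (complex_of_real (- (\<gamma>\<^sup>2)) * cinner (v k) x) *\<^sub>C v k)"

private abbreviation H where "H \<equiv> cspan ((\<lambda>c. b (c, 0)) ` Ch)"

private lemma csym_Q: "csym Q"
  unfolding csym_def Q_def cinner_add_left cinner_add_right
  by (intro allI arg_cong2[of _ _ _ _ "(+)"] csymD[OF csym_diagonal])

private lemma hH: "c \<in> Ch \<Longrightarrow> b (c, 0) \<in> H"
  by (rule cvec.span_base) simp

private lemma Q_H: "Q x \<in> H"
proof -
  have "v k \<in> H" for k
    unfolding v_def by (intro cvec.span_sum hH) simp
  then show ?thesis
    unfolding Q_def by (intro cvec.span_add cvec.span_sum cvec.span_scale) (simp_all add: hH)
qed

private lemma finite_rank_Q: "finite_rank Q"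
  unfolding finite_rank_def cfinite_dim_def
  using finCh Q_H by (intro exI[of _ "(\<lambda>c. b (c, 0)) ` Ch"]) auto

private lemma Q_form:
  "Re (cinner x (Q x)) = (\<Sum>c\<in>Ch. (s c)\<^sup>2 * (cmod (cinner (b (c, 0)) x))\<^sup>2)
    - (\<Sum>k\<in>UNIV. \<gamma>\<^sup>2 * (cmod (cinner (v k) x))\<^sup>2)"
proof -
  have *: "Re (cinner x ((complex_of_real r * cinner w x) *\<^sub>C w)) = r * (cmod (cinner w x))\<^sup>2" for r w
  proof -
    have "cinner x ((complex_of_real r * cinner w x) *\<^sub>C w)
        = complex_of_real (r * (cmod (cinner w x))\<^sup>2)"
      by (simp only: cinner_scaleC_right of_real_mult complex_norm_square cnj_cinner mult.assoc)
    then show ?thesis by simp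
  qed
  show ?thesis
    by (simp only: Q_def cinner_add_right cinner_sum_right Re_sum * plus_complex.sel)
      (simp add: sum_negf)
qed

text \<open>Cauchy-Schwarz in each channel and the choice of \<gamma>; the channels partition the
  chains, so the bounds add up to the sum over all heads.\<close>

private lemma Q_pos: "0 \<le> Re (cinner x (Q x))"
proof -
  have "(\<Sum>k\<in>UNIV. \<gamma>\<^sup>2 * (cmod (cinner (v k) x))\<^sup>2)
      \<le> (\<Sum>k\<in>UNIV. \<Sum>c\<in>{c\<in>Ch. \<kappa> c = k}. (s c)\<^sup>2 * (cmod (cinner (b (c, 0)) x))\<^sup>2)"
  proof (rule sum_mono)
    fix k
    let ?C = "{c\<in>Ch. \<kappa> c = k}"
    have "(cmod (cinner (v k) x))\<^sup>2 \<le> (\<Sum>c\<in>?C. cmod (cinner (b (c, 0)) x))\<^sup>2"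
      unfolding cinner_v by (intro power_mono norm_sum) simp
    also have "\<dots> \<le> (\<Sum>c\<in>?C. (cmod (cinner (b (c, 0)) x))\<^sup>2) * card ?C"
      by (rule sum_squared_le_sum_of_squares)
    also have "\<dots> \<le> (\<Sum>c\<in>?C. (cmod (cinner (b (c, 0)) x))\<^sup>2) * card Ch"
      using finCh by (intro mult_left_mono) (auto intro!: card_mono sum_nonneg)
    finally have "\<gamma>\<^sup>2 * (cmod (cinner (v k) x))\<^sup>2
        \<le> \<gamma>\<^sup>2 * ((\<Sum>c\<in>?C. (cmod (cinner (b (c, 0)) x))\<^sup>2) * card Ch)"
      by (intro mult_left_mono) auto
    also have "\<dots> = (\<Sum>c\<in>?C. (\<gamma>\<^sup>2 * real (card Ch)) * (cmod (cinner (b (c, 0)) x))\<^sup>2)"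
      by (simp add: sum_distrib_left sum_distrib_right mult_ac)
    also have "\<dots> \<le> (\<Sum>c\<in>?C. (s c)\<^sup>2 * (cmod (cinner (b (c, 0)) x))\<^sup>2)"
      by (intro sum_mono mult_right_mono \<gamma>) auto
    finally show "\<gamma>\<^sup>2 * (cmod (cinner (v k) x))\<^sup>2
        \<le> (\<Sum>c\<in>?C. (s c)\<^sup>2 * (cmod (cinner (b (c, 0)) x))\<^sup>2)" .
  qed
  also have "\<dots> = (\<Sum>c\<in>Ch. (s c)\<^sup>2 * (cmod (cinner (b (c, 0)) x))\<^sup>2)"
    using sum.group[OF finCh finite subset_UNIV, where g = \<kappa>] by simp
  finally show ?thesis unfolding Q_form by simp
qed

private definition K0 where "K0 = (SOME K0. csym K0 \<and>
  (\<forall>x. (norm (K0 x))\<^sup>2 = Re (cinner x (Q x))) \<and> (\<forall>x. K0 x \<in> cspan (range Q)))"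

private lemma K0: "csym K0" "(norm (K0 x))\<^sup>2 = Re (cinner x (Q x))" "K0 x \<in> H"
proof -
  have "\<exists>K0. csym K0 \<and> (\<forall>x. (norm (K0 x))\<^sup>2 = Re (cinner x (Q x)))
      \<and> (\<forall>x. K0 x \<in> cspan (range Q))"
    by (rule psd_square_root[OF csym_Q finite_rank_Q Q_pos]) blast
  from someI_ex[OF this]
  have *: "csym K0" "\<forall>x. (norm (K0 x))\<^sup>2 = Re (cinner x (Q x))" "\<forall>x. K0 x \<in> cspan (range Q)"
    unfolding K0_def by blast+
  have "cspan (range Q) \<subseteq> H"
    by (rule cvec.span_minimal) (use Q_H in \<open>auto simp: cvec.subspace_span\<close>)
  with * show "csym K0" "(norm (K0 x))\<^sup>2 = Re (cinner x (Q x))" "K0 x \<in> H" by auto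
qed

private lemma HR: "H \<subseteq> L"
  using len by (intro cvec.span_mono) (force simp: I_def)

private lemma K0_b: "i \<in> I1 \<Longrightarrow> K0 (b i) = 0"
proof -
  assume i: "i \<in> I1"
  have zero: "cinner (b (c, 0)) (b i) = 0" if "c \<in> Ch" for c
  proof -
    have "(c, 0) \<in> I" using that len[OF that] by (auto simp: I_def)
    then show ?thesis using orthonormalD[OF bI _ I1_sub[OF i]] i by (auto simp: I1_def)
  qed
  have "cinner (v k) (b i) = 0" for k
    unfolding cinner_v by (rule sum.neutral) (auto simp: zero)
  then have "(norm (K0 (b i)))\<^sup>2 = 0" by (simp add: K0(2) Q_form zero)
  then show ?thesis by simp
qed

private lemma K0_coeff: "i \<in> I1 \<Longrightarrow> cinner (b i) (K0 x) = 0"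
  using csymD[OF K0(1), of "b i" x] by (simp add: K0_b)

private definition K1 where
  "K1 x = (\<Sum>i\<in>I1. (complex_of_real (s (fst i)) * cinner (b (flop i)) x) *\<^sub>C b i)"

private lemma bI1: "orthonormal I1 b" "finite I1"
  using orthonormal_subset[OF bI] finI by (auto simp: I1_def)

private lemma K1_coeff:
  "i \<in> I1 \<Longrightarrow> cinner (b i) (K1 x) = complex_of_real (s (fst i)) * cinner (b (flop i)) x"
  unfolding K1_def by (rule cinner_unique_sum[OF bI1])

private lemma csym_K1: "csym K1"
  unfolding csym_def
proof (intro allI)
  fix x y
  have "cinner (K1 x) y
      = (\<Sum>i\<in>I1. complex_of_real (s (fst i)) * (cinner x (b (flop i)) * cinner (b i) y))"
    by (simp add: K1_def cinner_sum_left cinner_scaleC_left cnj_cinner mult_ac)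
  also have "\<dots> = (\<Sum>i\<in>I1. complex_of_real (s (fst (flop i)))
      * (cinner x (b (flop (flop i))) * cinner (b (flop i)) y))"
    by (rule sum_flop[symmetric])
  also have "\<dots> = cinner x (K1 y)"
    unfolding K1_def cinner_sum_right cinner_scaleC_right
    by (rule sum.cong) (simp_all add: flop mult_ac)
  finally show "cinner (K1 x) y = cinner x (K1 y)" .
qed

private definition K where "K x = K1 x + K0 x"

private lemma csym_K: "csym K"
  by (simp add: csym_def K_def cinner_add_left cinner_add_right csymD[OF K0(1)] csymD[OF csym_K1])

private lemma KR: "K x \<in> L"
  unfolding K_def K1_def using K0(3) HR
  by (intro cvec.span_add cvec.span_sum cvec.span_scale) (auto simp: bL I1_sub)

private lemma K_coeff:
  "i \<in> I1 \<Longrightarrow> cinner (b i) (K x) = complex_of_real (s (fst i)) * cinner (b (flop i)) x"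
  by (simp add: K_def cinner_add_right K1_coeff K0_coeff)

private definition C' :: "'a \<Rightarrow> complex ^ 'n" where
  "C' x = (\<chi> k. complex_of_real \<gamma> * cinner (v k) x)"

private lemma C'_clinear: "clinear C'"
  by (rule clinearI) (simp_all add: C'_def vec_eq_iff cinner_add_right cinner_scaleC_right
      scaleC_vec_def scaleC_complex_def distrib_left mult_ac)

text \<open>Off the heads \<open>J\<close> and \<open>K\<close> permute coordinates within a chain
  with the same factor, and on the heads K^2 = Q by construction. The two parts of \<open>K\<close>
  do not interfere because \<open>K0\<close> kills the range of \<open>K1\<close>. This is J^2 - K^2
  = C'* C' on \<open>L\<close>.\<close>

private lemma norm_K_C':
  assumes y: "y \<in> L"
  shows "(norm (K y))\<^sup>2 + (norm (C' y))\<^sup>2 = (norm (J y))\<^sup>2"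
proof -
  have K1: "(norm (K1 y))\<^sup>2 = (\<Sum>i\<in>I1. (s (fst i))\<^sup>2 * (cmod (cinner (b i) y))\<^sup>2)"
    unfolding K1_def norm_orthonormal_sum[OF bI1]
    using sum_flop[of "\<lambda>i. (s (fst i))\<^sup>2 * (cmod (cinner (b i) y))\<^sup>2"]
    by (simp add: norm_mult power_mult_distrib flop)
  have "K0 (K1 y) = 0"
    unfolding K1_def
    by (simp add: clinearD[OF csym_clinear[OF K0(1)]] K0_b)
  then have "cinner (K1 y) (K0 y) = 0" using csymD[OF K0(1), of "K1 y" y] by simp
  then have KK: "(norm (K y))\<^sup>2 = (norm (K1 y))\<^sup>2 + (norm (K0 y))\<^sup>2"
    unfolding K_def norm_add_cinner by simp
  have C: "(norm (C' y))\<^sup>2 = (\<Sum>k\<in>UNIV. \<gamma>\<^sup>2 * (cmod (cinner (v k) y))\<^sup>2)"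
    unfolding norm_vec_def L2_set_def
    by (simp add: C'_def sum_nonneg norm_mult power_mult_distrib)
  have "(norm (J y))\<^sup>2 = (\<Sum>i\<in>I. (s (fst (flip i)))\<^sup>2 * (cmod (cinner (b (flip i)) y))\<^sup>2)"
    unfolding R_norm[OF ranJ']
    by (rule sum.cong) (simp_all add: J_coeff norm_mult power_mult_distrib flip)
  also have "\<dots> = (\<Sum>i\<in>I. (s (fst i))\<^sup>2 * (cmod (cinner (b i) y))\<^sup>2)" by (rule sum_flip)
  also have "\<dots> = (\<Sum>i\<in>I1. (s (fst i))\<^sup>2 * (cmod (cinner (b i) y))\<^sup>2)
      + (\<Sum>c\<in>Ch. (s c)\<^sup>2 * (cmod (cinner (b (c, 0)) y))\<^sup>2)"
    by (simp add: sum_split)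
  finally show ?thesis unfolding KK K1 C K0(2) Q_form by simp
qed

text \<open>\<open>J\<close> swaps the first and last coordinates of a chain and multiplies them by
  \<open>s c\<close>, so their half-sum and half-difference evolve with the factors s c and - s c.
  The vanishing outputs along the \<open>J\<close>-orbit of \<open>w\<close> are then power sums
  with distinct bases, and every coefficient is zero.\<close>

private lemma heads_zero:
  assumes W: "W \<subseteq> L" "\<And>w. w \<in> W \<Longrightarrow> J w \<in> W" "\<And>w. w \<in> W \<Longrightarrow> C' w = 0"
    and w: "w \<in> W" and c: "c \<in> Ch"
  shows "cinner (b (c, 0)) w = 0"
proof -
  define \<alpha> where "\<alpha> c = cinner (b (c, 0)) w" for c
  define \<beta> where "\<beta> c = cinner (b (c, len c - 1)) w" for c
  define g where "g = (\<lambda>(c, p). if p then (\<alpha> c + \<beta> c) / 2 else (\<alpha> c - \<beta> c) / 2)"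
  define t where "t = (\<lambda>(c, p). if p then s c else - s c)"
  have pw: "cinner (b (c, 0)) ((J ^^ n) w)
        = g (c, True) * complex_of_real (t (c, True) ^ n) + g (c, False) * complex_of_real (t (c, False) ^ n)
      \<and> cinner (b (c, len c - 1)) ((J ^^ n) w)
        = g (c, True) * complex_of_real (t (c, True) ^ n) - g (c, False) * complex_of_real (t (c, False) ^ n)"
    if c: "c \<in> Ch" for c n
  proof (induction n)
    case 0
    show ?case by (simp add: g_def \<alpha>_def \<beta>_def add_divide_distrib diff_divide_distrib)
  next
    case (Suc n)
    have "(c, 0) \<in> I" "(c, len c - 1) \<in> I" using c len[OF c] by (auto simp: I_def)
    then have e: "cinner (b (c, 0)) ((J ^^ Suc n) w)
          = complex_of_real (s c) * cinner (b (c, len c - 1)) ((J ^^ n) w)"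
        "cinner (b (c, len c - 1)) ((J ^^ Suc n) w)
          = complex_of_real (s c) * cinner (b (c, 0)) ((J ^^ n) w)"
      using len[OF c] by (simp_all add: J_coeff flip_def)
    show ?case
      unfolding e Suc[THEN conjunct1] Suc[THEN conjunct2] by (simp add: t_def algebra_simps)
  qed
  \<comment> \<open>In a chain of length 1 the first and last coordinates coincide and the
    difference mode is zero; leaving it out keeps \<open>t\<close> injective when a channel carries
    opposite scales.\<close>
  define X where "X = {(c', p) \<in> {c'\<in>Ch. \<kappa> c' = \<kappa> c} \<times> UNIV. p \<or> len c' \<noteq> 1}"
  have finC: "finite {c'\<in>Ch. \<kappa> c' = \<kappa> c}" using finCh by simp
  have finX: "finite X"
    by (rule finite_subset[of _ "{c'\<in>Ch. \<kappa> c' = \<kappa> c} \<times> UNIV"]) (use finC in \<open>auto simp: X_def\<close>)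
  have injX: "inj_on t X"
  proof (rule inj_onI)
    fix i j assume ij: "i \<in> X" "j \<in> X" "t i = t j"
    obtain c1 p1 c2 p2 where e: "i = (c1, p1)" "j = (c2, p2)" by fastforce
    have c12: "c1 \<in> Ch" "c2 \<in> Ch" "\<kappa> c1 = \<kappa> c2" using ij by (auto simp: e X_def)
    show "i = j"
    proof (cases "p1 = p2")
      case True
      then have "s c1 = s c2" using ij(3) by (auto simp: e t_def split: if_splits)
      then show ?thesis using inj[OF c12] True by (simp add: e)
    next
      case False
      then have "s c1 = - s c2" using ij(3) by (auto simp: e t_def split: if_splits)
      then have "len c1 = 1" "len c2 = 1" using opp[OF c12] by auto
      then show ?thesis using ij(1,2) False by (auto simp: e X_def)
    qed
  qed
  have JnW: "(J ^^ n) w \<in> W" for n by (induction n) (auto simp: W(2) w)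
  have zero: "(\<Sum>i\<in>X. g i * complex_of_real (t i ^ n)) = 0" for n
  proof -
    have "C' ((J ^^ n) w) $ \<kappa> c = 0" using W(3)[OF JnW] by simp
    then have "0 = (\<Sum>c'\<in>{c'\<in>Ch. \<kappa> c' = \<kappa> c}. cinner (b (c', 0)) ((J ^^ n) w))"
      using \<gamma>(1) by (simp add: C'_def cinner_v)
    also have "\<dots> = (\<Sum>c'\<in>{c'\<in>Ch. \<kappa> c' = \<kappa> c}. \<Sum>p\<in>UNIV. g (c', p) * complex_of_real (t (c', p) ^ n))"
      by (rule sum.cong) (use pw in \<open>simp_all add: UNIV_bool add.commute\<close>)
    also have "\<dots> = (\<Sum>i\<in>{c'\<in>Ch. \<kappa> c' = \<kappa> c} \<times> UNIV. g i * complex_of_real (t i ^ n))"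
      by (simp add: sum.cartesian_product split_def)
    also have "\<dots> = (\<Sum>i\<in>X. g i * complex_of_real (t i ^ n))"
    proof (rule sum.mono_neutral_right)
      show "\<forall>i\<in>{c'\<in>Ch. \<kappa> c' = \<kappa> c} \<times> UNIV - X. g i * complex_of_real (t i ^ n) = 0"
        by (auto simp: X_def g_def \<alpha>_def \<beta>_def)
    qed (use finC in \<open>auto simp: X_def\<close>)
    finally show ?thesis by simp
  qed
  have gX: "g i = 0" if "i \<in> X" for i
    by (rule sum_powers_eq_0[OF finX injX zero that])
  have "g (c, True) = 0" by (rule gX) (use c in \<open>simp add: X_def\<close>)
  moreover have "g (c, False) = 0"
  proof (cases "len c = 1")
    case True
    then show ?thesis by (simp add: g_def \<alpha>_def \<beta>_def)
  next
    case False
    then show ?thesis using c by (intro gX) (simp add: X_def)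
  qed
  ultimately show ?thesis using pw[OF c, of 0] by simp
qed

text \<open>Coordinate j of J K w is (s c)^2 times coordinate j + 1 of w. As \<open>W\<close> is
  invariant under \<open>J\<close> and \<open>K\<close>, vanishing propagates from the heads along
  each chain.\<close>

private lemma observable:
  assumes W: "csubspace W" "W \<subseteq> L" "\<forall>w\<in>W. K (J' w) \<in> W \<and> J w \<in> W \<and> C' (J' w) = 0"
  shows "W \<subseteq> {0}"
proof
  fix w assume w: "w \<in> W"
  have JW: "J w \<in> W" if "w \<in> W" for w using W(3) that by blast
  have CW: "C' w = 0" and KW: "K w \<in> W" if w: "w \<in> W" for w
  proof -
    have "K (J' (J w)) \<in> W \<and> C' (J' (J w)) = 0" using W(3) JW[OF w] by blast
    moreover have "J' (J w) = w" using W(2) w by (intro J'J) blast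
    ultimately show "C' w = 0" "K w \<in> W" by simp_all
  qed
  have coord: "\<forall>w\<in>W. cinner (b (c, j)) w = 0" if "c \<in> Ch" "j < len c" for c j
    using that(2)
  proof (induction j)
    case 0
    then show ?case using heads_zero[OF W(2) JW CW _ that(1)] by blast
  next
    case (Suc j)
    show ?case
    proof
      fix w assume w: "w \<in> W"
      have cj: "(c, len c - 1 - j) \<in> I1"
        using Suc.prems that(1) by (auto simp: I_def I1_def)
      have "cinner (b (c, len c - 1 - j)) (K w) = 0"
      proof -
        have "(c, j) \<in> I" using Suc.prems that(1) by (auto simp: I_def)
        then have "0 = complex_of_real (s c) * cinner (b (c, len c - 1 - j)) (K w)"
          using J_coeff[of "(c, j)" "K w"] Suc.IH Suc.prems JW[OF KW[OF w]] by (simp add: flip_def)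
        then show ?thesis using s0[OF that(1)] by simp
      qed
      moreover have "flop (c, len c - 1 - j) = (c, Suc j)"
        using Suc.prems by (simp add: flop_def)
      ultimately show "cinner (b (c, Suc j)) w = 0"
        using K_coeff[OF cj, of w] s0[OF that(1)] by simp
    qed
  qed
  have "w = 0"
  proof (rule R_eqI)
    show "w \<in> L" using w W(2) by blast
    show "cinner (b i) w = cinner (b i) 0" if "i \<in> I" for i
      using that coord w by (auto simp: I_def)
  qed (rule cvec.span_zero)
  then show "w \<in> {0}" by simp
qed

text \<open>With y = J' x, \<open>norm_K_C'\<close> becomes the isometry condition for A = K J' and
  C = C' J', and A J = K is symmetric.\<close>

lemma flip_chains_hankel:
  assumes inf: "\<not> cfinite_dim (UNIV :: 'a set)"
    and S: "countable S" "ctotal (S :: 'a set)"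
  shows "\<exists>\<Gamma> :: (complex ^ 'n) ell2 \<Rightarrow> (complex ^ 'n) ell2.
    block_hankel \<Gamma> \<and> finite_rank \<Gamma> \<and> unitarily_equivalent J \<Gamma>"
proof (rule hankel_unitarily_equivalent[where I = I and b = b and A = "\<lambda>x. K (J' x)"
      and C = "\<lambda>x. C' (J' x)"])
  note klin = clinearD[OF csym_clinear[OF csym_K]]
  show "clinear (\<lambda>x. K (J' x))"
    by (rule clinearI) (simp_all add: klin clinearD[OF J'_clinear])
  show "clinear (\<lambda>x. C' (J' x))"
    by (rule clinearI) (simp_all add: clinearD[OF C'_clinear] clinearD[OF J'_clinear])
  show "K (J' (\<Sum>i\<in>I. cinner (b i) x *\<^sub>C b i)) = K (J' x)" for x
  proof -
    have "J' (\<Sum>i\<in>I. cinner (b i) x *\<^sub>C b i) = J' x"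
      by (rule R_eqI[OF J'R J'R]) (simp add: J'_coeff cinner_unique_sum[OF bI finI] flip)
    then show ?thesis by simp
  qed
  show "(norm (K (J' x)))\<^sup>2 + (norm (C' (J' x)))\<^sup>2 = (norm x)\<^sup>2" if "x \<in> L" for x
    using norm_K_C'[OF J'R, of x] by (simp add: JJ'[OF that])
  \<comment> \<open>J' J x differs from x by a vector orthogonal to \<open>L\<close>, and
    \<open>L\<close> contains the range of the symmetric \<open>K\<close>.\<close>
  have KJ: "K (J' (J x)) = K x" for x
  proof -
    have "cinner (K y) (J' (J x) - x) = 0" for y
      by (rule cinner_span_eq_0[OF KR]) (auto simp: cinner_diff_right J'J_coeff)
    then have "cinner y (K (J' (J x) - x)) = cinner y 0" for y
      by (simp only: csymD[OF csym_K, symmetric] cinner_zero_right)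
    then have "K (J' (J x) - x) = 0" by (rule cinner_ext)
    then show ?thesis by (simp add: klin)
  qed
  show "csym (\<lambda>x. K (J' (J x)))" unfolding KJ by (rule csym_K)
qed (fact finI bI J KR ranJ' inf S | rule observable, assumption+)+

end

section \<open>Differences of two projections\<close>

lemma finite_rank_compact_like:
  assumes A: "csym A" "finite_rank A"
  shows "compact_like A"
proof (rule finite_rank_csym_bound[OF A])
  fix F K
  assume F: "finite F" "\<And>y. y \<in> ocomp (A ` F) \<Longrightarrow> A y = 0"
  show "compact_like A"
    unfolding compact_like_def
  proof (intro allI impI exI conjI ballI)
    fix e :: real and y assume "0 < e" "y \<in> ocomp (A ` F)"
    then show "norm (A y) \<le> e * norm y" using F(2) by simp
  qed (use F(1) in simp)
qed

context
  fixes P Q :: "'a::chilbert_space \<Rightarrow> 'a"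
  assumes P: "orth_projection P" "finite_rank P" and Q: "orth_projection Q" "finite_rank Q"
begin

private definition J where "J x = P x - Q x"
private definition B where "B x = x - P x - Q x"

private lemma PQ: "csym P" "csym Q" "P (P x) = P x" "Q (Q x) = Q x"
  using P(1) Q(1) by (simp_all add: orth_projection_csym)

private lemmas linP = clinearD[OF csym_clinear[OF PQ(1)]]
private lemmas linQ = clinearD[OF csym_clinear[OF PQ(2)]]

private lemma csym_J: "csym J"
  by (simp add: csym_def J_def cinner_diff_left cinner_diff_right csymD[OF PQ(1)] csymD[OF PQ(2)])

private lemma csym_B: "csym B"
  by (simp add: csym_def B_def cinner_diff_left cinner_diff_right csymD[OF PQ(1)] csymD[OF PQ(2)])

private lemmas linJ = clinearD[OF csym_clinear[OF csym_J]]
private lemmas linB = clinearD[OF csym_clinear[OF csym_B]]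

private lemma JJ: "J (J x) = x - B (B x)"
  by (simp add: J_def B_def linP linQ PQ)

private lemma BJ: "B (J x) = - J (B x)"
  by (simp add: J_def B_def linP linQ PQ)

private lemma finite_rank_PQ: "finite_rank J"
proof -
  obtain F G where F: "finite F" "range P \<subseteq> cspan F" and G: "finite G" "range Q \<subseteq> cspan G"
    using P(2) Q(2) by (auto simp: finite_rank_def cfinite_dim_def)
  have "J x \<in> cspan (F \<union> G)" for x
  proof -
    have "P x \<in> cspan (F \<union> G)" "Q x \<in> cspan (F \<union> G)"
      using F(2) G(2) cvec.span_mono[of F "F \<union> G"] cvec.span_mono[of G "F \<union> G"] by auto
    then show ?thesis unfolding J_def by (rule cvec.span_diff)
  qed
  then show ?thesis
    unfolding finite_rank_def cfinite_dim_def using F(1) G(1) by (intro exI[of _ "F \<union> G"]) auto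
qed

private lemma range_J_finite:
  assumes "orthonormal M (\<lambda>x. x)" "M \<subseteq> range J"
  shows "finite M"
proof -
  obtain F where "finite F" "range J \<subseteq> cspan F"
    using finite_rank_PQ by (auto simp: finite_rank_def cfinite_dim_def)
  then show ?thesis using orthonormal_card_le[of F M "\<lambda>x. x"] assms by auto
qed

text \<open>An eigenvector u of \<open>B\<close> for \<nu> in (0, 1) has the partner J u for -\<nu>,
  and J^2 u = (1 - \<nu>^2) u. All pairs with the same \<sigma> = sqrt (1 - \<nu>^2) are joined into
  one chain labelled (\<sigma>, 0). Each eigenvector of \<open>J\<close> chosen for 1 or -1 is a
  chain of length 1, and its second label selects the channel.\<close>

lemma projection_difference_hankel:
  assumes card_pos: "\<And>I b. orthonormal I b \<Longrightarrow> (\<And>i. i \<in> I \<Longrightarrow> P (b i) - Q (b i) = b i) \<Longrightarrow>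
      card (I :: 'a set) \<le> CARD('n::finite)"
    and card_neg: "\<And>I b. orthonormal I b \<Longrightarrow> (\<And>i. i \<in> I \<Longrightarrow> P (b i) - Q (b i) = - b i) \<Longrightarrow>
      card (I :: 'a set) \<le> CARD('n)"
    and inf: "\<not> cfinite_dim (UNIV :: 'a set)"
    and S: "countable S" "ctotal (S :: 'a set)"
  shows "\<exists>\<Gamma> :: (complex ^ 'n) ell2 \<Rightarrow> (complex ^ 'n) ell2.
    block_hankel \<Gamma> \<and> finite_rank \<Gamma> \<and> unitarily_equivalent (\<lambda>x. P x - Q x) \<Gamma>"
proof -
  define X where "X = {u. \<exists>r>0. r < 1 \<and> B u = r *\<^sub>R u}"
  obtain M where M: "{} \<subseteq> M" "M \<subseteq> X" "orthonormal M (\<lambda>x. x)"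
      "\<forall>x\<in>X. norm x = 1 \<longrightarrow> (\<exists>m\<in>M. cinner m x \<noteq> 0)"
    by (rule orthonormal_maximal[of "{}" X]) (auto simp: orthonormal_def)
  have "\<forall>u\<in>M. \<exists>r>0. r < 1 \<and> B u = r *\<^sub>R u" using M(2) by (auto simp: X_def)
  from bchoice[OF this] obtain \<nu>
    where \<nu>: "\<forall>u\<in>M. 0 < \<nu> u \<and> \<nu> u < 1 \<and> B u = \<nu> u *\<^sub>R u" by blast
  define sc where "sc u = sqrt (1 - (\<nu> u)\<^sup>2)" for u
  have sc: "0 < sc u" "sc u < 1" "(sc u)\<^sup>2 = 1 - (\<nu> u)\<^sup>2" if "u \<in> M" for u
  proof -
    have "0 < \<nu> u" "(\<nu> u)\<^sup>2 < 1"
      using \<nu> that power_strict_mono[of "\<nu> u" 1 2] by auto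
    then show "0 < sc u" "sc u < 1" "(sc u)\<^sup>2 = 1 - (\<nu> u)\<^sup>2" by (auto simp: sc_def)
  qed
  have JJM: "J (J u) = (sc u)\<^sup>2 *\<^sub>R u" if u: "u \<in> M" for u
    unfolding sc(3)[OF u]
    using \<nu> u by (simp add: JJ linB scaleR_left_diff_distrib power2_eq_square)
  have BJM: "B (J u) = - (\<nu> u *\<^sub>R J u)" if u: "u \<in> M" for u
    using \<nu> u by (simp add: BJ linJ)
  define Xs where "Xs \<sigma> = {u. J u = \<sigma> *\<^sub>R u}" for \<sigma> :: real
  obtain Mp where Mp: "{} \<subseteq> Mp" "Mp \<subseteq> Xs 1" "orthonormal Mp (\<lambda>x. x)"
      "\<forall>x\<in>Xs 1. norm x = 1 \<longrightarrow> (\<exists>m\<in>Mp. cinner m x \<noteq> 0)"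
    by (rule orthonormal_maximal[of "{}" "Xs 1"]) (auto simp: orthonormal_def)
  obtain Mn where Mn: "{} \<subseteq> Mn" "Mn \<subseteq> Xs (- 1)" "orthonormal Mn (\<lambda>x. x)"
      "\<forall>x\<in>Xs (- 1). norm x = 1 \<longrightarrow> (\<exists>m\<in>Mn. cinner m x \<noteq> 0)"
    by (rule orthonormal_maximal[of "{}" "Xs (- 1)"]) (auto simp: orthonormal_def)
  have finM: "finite M"
  proof (rule range_J_finite[OF M(3)], rule subsetI)
    fix u assume u: "u \<in> M"
    have "J ((1 / (sc u)\<^sup>2) *\<^sub>R J u) = u" using sc(1)[OF u] by (simp add: linJ JJM[OF u])
    then show "u \<in> range J" by (metis rangeI)
  qed
  have finMp: "finite Mp"
  proof (rule range_J_finite[OF Mp(3)], rule subsetI)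
    fix u assume "u \<in> Mp"
    then have "J u = u" using Mp(2) by (auto simp: Xs_def)
    then show "u \<in> range J" by (metis rangeI)
  qed
  have finMn: "finite Mn"
  proof (rule range_J_finite[OF Mn(3)], rule subsetI)
    fix u assume "u \<in> Mn"
    then have "J (- u) = u" using Mn(2) by (auto simp: Xs_def linJ)
    then show "u \<in> range J" by (metis rangeI)
  qed
  have cMp: "card Mp \<le> CARD('n)"
    by (rule card_pos[OF Mp(3)]) (use Mp(2) in \<open>auto simp: Xs_def J_def\<close>)
  have cMn: "card Mn \<le> CARD('n)"
    by (rule card_neg[OF Mn(3)]) (use Mn(2) in \<open>auto simp: Xs_def J_def\<close>)
  define Ms where "Ms \<sigma> = (if \<sigma> = 1 then Mp else if \<sigma> = - 1 then Mn else {u\<in>M. sc u = \<sigma>})" for \<sigma>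
  define k where "k \<sigma> = card (Ms \<sigma>)" for \<sigma>
  have finMs: "finite (Ms \<sigma>)" for \<sigma> using finM finMp finMn by (simp add: Ms_def)
  have "\<forall>\<sigma>. \<exists>g. bij_betw g {..<k \<sigma>} (Ms \<sigma>)"
    using ex_bij_betw_nat_finite[OF finMs] by (simp add: k_def atLeast0LessThan)
  then obtain E where E: "\<And>\<sigma>. bij_betw (E \<sigma>) {..<k \<sigma>} (Ms \<sigma>)" by metis
  obtain h :: "nat \<Rightarrow> 'n" where h: "bij_betw h {..<CARD('n)} UNIV"
    using ex_bij_betw_nat_finite[of "UNIV :: 'n set"] by (auto simp: atLeast0LessThan)
  have E_in: "E \<sigma> l \<in> Ms \<sigma>" if "l < k \<sigma>" for \<sigma> l
    using E[of \<sigma>] that by (auto simp: bij_betw_def)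
  have E_M: "E \<sigma> l \<in> M" "sc (E \<sigma> l) = \<sigma>" if "l < k \<sigma>" "\<sigma> \<noteq> 1" "\<sigma> \<noteq> - 1" for \<sigma> l
    using E_in[OF that(1)] that(2,3) by (auto simp: Ms_def)
  define Ch where "Ch = (\<lambda>u. (sc u, 0::nat)) ` M \<union> (\<lambda>l. (1, l)) ` {..<k 1} \<union> (\<lambda>l. (- 1, l)) ` {..<k (- 1)}"
  define len where "len = (\<lambda>(\<sigma>::real, l::nat). if \<sigma> = 1 \<or> \<sigma> = - 1 then 1 else 2 * k \<sigma>)"
  \<comment> \<open>The second half lists the normalised partners in reverse order, so that
    \<open>J\<close> sends position j to 2 k - 1 - j.\<close>
  define b where "b = (\<lambda>((\<sigma>, l), j). if \<sigma> = 1 \<or> \<sigma> = - 1 then E \<sigma> l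
      else if j < k \<sigma> then E \<sigma> j else (1 / \<sigma>) *\<^sub>R J (E \<sigma> (2 * k \<sigma> - 1 - j)))"
  define \<kappa> where "\<kappa> = (\<lambda>(\<sigma>::real, l). h l)"
  have Ch_cases: "(\<exists>u\<in>M. \<sigma> = sc u \<and> 0 < \<sigma> \<and> \<sigma> < 1 \<and> l = 0 \<and> 0 < k \<sigma>)
      \<or> (\<sigma> = 1 \<or> \<sigma> = - 1) \<and> l < k \<sigma>" if "(\<sigma>, l) \<in> Ch" for \<sigma> l
  proof -
    have "0 < k (sc u)" if u: "u \<in> M" for u
    proof -
      have "u \<in> Ms (sc u)" using sc(1,2)[OF u] u by (auto simp: Ms_def)
      then show ?thesis using finMs by (auto simp: k_def card_gt_0_iff)
    qed
    then show ?thesis using that sc by (auto simp: Ch_def)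
  qed
  let ?I = "SIGMA c:Ch. {..<len c}"

  \<comment> \<open>\<open>Y\<close> indexes the vectors by an eigenvector and a flag for its
    partner. Orthonormality is proved for this indexing and carried to the chains along the
    injection \<psi>.\<close>
  define Y where "Y = (Mp \<union> Mn \<union> M) \<times> {False} \<union> M \<times> {True}"
  define \<phi> where "\<phi> = (\<lambda>(u, p). if p then (1 / sc u) *\<^sub>R J u else u)"
  define \<psi> where "\<psi> = (\<lambda>((\<sigma>, l), j). if \<sigma> = 1 \<or> \<sigma> = - 1 then (E \<sigma> l, False)
      else if j < k \<sigma> then (E \<sigma> j, False) else (E \<sigma> (2 * k \<sigma> - 1 - j), True))"
  have B0: "B u = 0" if u: "J u = \<sigma> *\<^sub>R u" "\<sigma> = 1 \<or> \<sigma> = - 1" for u \<sigma>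
  proof -
    have "J (J u) = u" using u by (auto simp: linJ)
    then have "B (B u) = 0" by (simp add: JJ)
    then have "cinner (B u) (B u) = 0" using csymD[OF csym_B, of u "B u"] by simp
    then show ?thesis by (simp add: cinner_self_eq_0_iff)
  qed
  have Mpn: "J u = \<sigma> *\<^sub>R u" "B u = 0" if "u \<in> Ms \<sigma>" "\<sigma> = 1 \<or> \<sigma> = - 1" for u \<sigma>
  proof -
    show "J u = \<sigma> *\<^sub>R u" using that Mp(2) Mn(2) by (auto simp: Ms_def Xs_def)
    then show "B u = 0" using B0 that(2) by blast
  qed
  have MpB: "J u = 1 *\<^sub>R u" "B u = 0" if "u \<in> Mp" for u
    using Mpn[of u 1] that by (auto simp: Ms_def)
  have MnB: "J u = (- 1) *\<^sub>R u" "B u = 0" if "u \<in> Mn" for u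
    using Mpn[of u "- 1"] that by (auto simp: Ms_def)
  have swap: "cinner x y = 0 \<Longrightarrow> cinner y x = 0" for x y :: 'a
    by (subst cinner_commute) simp
  have o_pn: "cinner u w = 0" if "u \<in> Mp" "w \<in> Mn" for u w
    using csymD[OF csym_J, of u w] MpB(1)[OF that(1)] MnB(1)[OF that(2)]
    by (simp add: cinner_minus_right)
  have o_0M: "cinner u w = 0" if "B u = 0" "w \<in> M" for u w
    using csymD[OF csym_B, of u w] that \<nu> by (force simp: scaleR_scaleC cinner_scaleC_right)
  have o_0JM: "cinner u (J w) = 0" if "B u = 0" "w \<in> M" for u w
    using csymD[OF csym_B, of u "J w"] that \<nu>
    by (force simp: BJM scaleR_scaleC cinner_scaleC_right cinner_minus_right)
  have o_MJM: "cinner u (J w) = 0" if "u \<in> M" "w \<in> M" for u w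
  proof -
    have "complex_of_real (\<nu> u) * cinner u (J w) = - (complex_of_real (\<nu> w) * cinner u (J w))"
      using csymD[OF csym_B, of u "J w"] that \<nu>
      by (simp add: BJM scaleR_scaleC cinner_scaleC_right cinner_scaleC_left cinner_minus_right)
    then have "complex_of_real (\<nu> u + \<nu> w) * cinner u (J w) = 0" by (simp add: algebra_simps)
    moreover have "\<nu> u + \<nu> w \<noteq> 0" using \<nu> that by (metis add_pos_pos less_irrefl)
    ultimately show ?thesis by (simp only: mult_eq_0_iff of_real_eq_0_iff) simp
  qed
  have o_JMJM: "cinner (J u) (J w) = (if u = w then complex_of_real ((sc u)\<^sup>2) else 0)"
    if "u \<in> M" "w \<in> M" for u w
    using orthonormalD[OF M(3) that] csymD[OF csym_J, of u "J w"] that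
    by (simp add: JJM scaleR_scaleC cinner_scaleC_right)
  have o\<phi>: "orthonormal Y \<phi>"
    unfolding orthonormal_def
  proof (intro ballI)
    fix i j assume ij: "i \<in> Y" "j \<in> Y"
    obtain u p w q where e: "i = (u, p)" "j = (w, q)" by fastforce
    have FF: "cinner u w = (if u = w then 1 else 0)" if "u \<in> Mp \<union> Mn \<union> M" "w \<in> Mp \<union> Mn \<union> M"
    proof -
      consider "u \<in> Mp" "w \<in> Mp" | "u \<in> Mn" "w \<in> Mn" | "u \<in> M" "w \<in> M"
        | "u \<in> Mp" "w \<in> Mn" | "u \<in> Mn" "w \<in> Mp" | "B u = 0" "w \<in> M" | "u \<in> M" "B w = 0"
        using \<open>u \<in> Mp \<union> Mn \<union> M\<close> \<open>w \<in> Mp \<union> Mn \<union> M\<close> MpB(2) MnB(2) by blast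
      then show ?thesis
      proof cases
        case 1 then show ?thesis by (rule orthonormalD[OF Mp(3)])
      next
        case 2 then show ?thesis by (rule orthonormalD[OF Mn(3)])
      next
        case 3 then show ?thesis by (rule orthonormalD[OF M(3)])
      next
        case 4 then have "cinner u w = 0" by (rule o_pn)
        moreover have "u \<noteq> w" using calculation orthonormalD[OF Mp(3) 4(1) 4(1)] by auto
        ultimately show ?thesis by simp
      next
        case 5
        have "cinner u w = 0" by (rule swap[OF o_pn[OF 5(2,1)]])
        moreover have "u \<noteq> w" using calculation orthonormalD[OF Mn(3) 5(1) 5(1)] by auto
        ultimately show ?thesis by simp
      next
        case 6 then have "cinner u w = 0" by (rule o_0M)
        moreover have "u \<noteq> w" using calculation orthonormalD[OF M(3) 6(2) 6(2)] by auto
        ultimately show ?thesis by simp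
      next
        case 7
        have "cinner u w = 0" by (rule swap[OF o_0M[OF 7(2,1)]])
        moreover have "u \<noteq> w" using calculation orthonormalD[OF M(3) 7(1) 7(1)] by auto
        ultimately show ?thesis by simp
      qed
    qed
    have FT: "cinner x (J y) = 0" if "x \<in> Mp \<union> Mn \<union> M" "y \<in> M" for x y
      using that MpB(2) MnB(2) o_0JM o_MJM by blast
    show "cinner (\<phi> i) (\<phi> j) = (if i = j then 1 else 0)"
    proof (cases p; cases q)
      assume "\<not> p" "\<not> q"
      then show ?thesis using ij FF by (auto simp: e Y_def \<phi>_def)
    next
      assume pq: "\<not> p" "q"
      then have "u \<in> Mp \<union> Mn \<union> M" "w \<in> M" using ij by (auto simp: e Y_def)
      then show ?thesis using pq FT by (simp add: e \<phi>_def scaleR_scaleC cinner_scaleC_right)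
    next
      assume pq: "p" "\<not> q"
      then have "w \<in> Mp \<union> Mn \<union> M" "u \<in> M" using ij by (auto simp: e Y_def)
      then have "cinner (J u) w = 0" by (rule swap[OF FT])
      then show ?thesis using pq by (simp add: e \<phi>_def scaleR_scaleC cinner_scaleC_left)
    next
      assume pq: "p" "q"
      then have uw: "u \<in> M" "w \<in> M" using ij by (auto simp: e Y_def)
      then show ?thesis using pq o_JMJM[OF uw] sc(1)[OF uw(1)]
        by (auto simp: e \<phi>_def scaleR_scaleC cinner_scaleC_left cinner_scaleC_right power2_eq_square)
    qed
  qed
  have b\<psi>: "b i = \<phi> (\<psi> i)" and \<psi>Y: "\<psi> i \<in> Y" if i: "i \<in> ?I" for i
  proof -
    obtain \<sigma> l j where e: "i = ((\<sigma>, l), j)" by (metis prod.collapse)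
    have c: "(\<sigma>, l) \<in> Ch" "j < len (\<sigma>, l)" using i by (auto simp: e)
    have "b i = \<phi> (\<psi> i) \<and> \<psi> i \<in> Y"
    proof (cases "\<sigma> = 1 \<or> \<sigma> = - 1")
      case True
      then have "E \<sigma> l \<in> Ms \<sigma>" using Ch_cases[OF c(1)] E_in by auto
      then show ?thesis using True by (auto simp: e b_def \<phi>_def \<psi>_def Y_def Ms_def)
    next
      case False
      then have n: "\<sigma> \<noteq> 1" "\<sigma> \<noteq> - 1" by auto
      then have j: "j < 2 * k \<sigma>" using c(2) by (simp add: len_def)
      show ?thesis
      proof (cases "j < k \<sigma>")
        case True
        then show ?thesis using n E_M[OF True n] by (auto simp: e b_def \<phi>_def \<psi>_def Y_def)
      next
        case False
        then have "2 * k \<sigma> - 1 - j < k \<sigma>" using j by auto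
        then show ?thesis using n False E_M[OF _ n] by (auto simp: e b_def \<phi>_def \<psi>_def Y_def)
      qed
    qed
    then show "b i = \<phi> (\<psi> i)" "\<psi> i \<in> Y" by auto
  qed
  have Ms_disj: "\<sigma> = \<tau>" if "u \<in> Ms \<sigma>" "u \<in> Ms \<tau>" for u \<sigma> \<tau>
  proof -
    have d: "u \<notin> Mn \<and> u \<notin> M" if "u \<in> Mp"
      using o_pn[of u u] o_0M[of u u] MpB(2)[of u] orthonormalD[OF Mp(3), of u u] that by auto
    have d': "u \<notin> M" if "u \<in> Mn"
      using o_0M[of u u] MnB(2)[of u] orthonormalD[OF Mn(3), of u u] that by auto
    show ?thesis using that d d' by (auto simp: Ms_def split: if_splits)
  qed
  have E_inj: "l = l'" if "E \<sigma> l = E \<sigma> l'" "l < k \<sigma>" "l' < k \<sigma>" for \<sigma> l l'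
    using E[of \<sigma>] that by (auto simp: bij_betw_def inj_on_def)
  have inj\<psi>: "inj_on \<psi> ?I"
  proof (rule inj_onI)
    fix i i' assume ii: "i \<in> ?I" "i' \<in> ?I" "\<psi> i = \<psi> i'"
    obtain \<sigma> l j \<sigma>' l' j' where e: "i = ((\<sigma>, l), j)" "i' = ((\<sigma>', l'), j')" by (metis prod.collapse)
    have c: "(\<sigma>, l) \<in> Ch" "j < len (\<sigma>, l)" "(\<sigma>', l') \<in> Ch" "j' < len (\<sigma>', l')"
      using ii(1,2) by (auto simp: e)
    have fst\<psi>: "fst (\<psi> ((\<sigma>, l), j)) \<in> Ms \<sigma>" if "(\<sigma>, l) \<in> Ch" "j < len (\<sigma>, l)" for \<sigma> l j
      using that Ch_cases[OF that(1)] by (auto simp: \<psi>_def len_def intro!: E_in)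
    have "\<sigma> = \<sigma>'"
      using Ms_disj fst\<psi>[OF c(1,2)] fst\<psi>[OF c(3,4)] ii(3) unfolding e by metis
    note s' = this[symmetric]
    show "i = i'"
    proof (cases "\<sigma> = 1 \<or> \<sigma> = - 1")
      case True
      then have "l < k \<sigma>" "l' < k \<sigma>" "j = 0" "j' = 0"
        using Ch_cases[OF c(1)] Ch_cases[OF c(3)] c(2,4) s' by (auto simp: len_def)
      moreover have "E \<sigma> l = E \<sigma> l'" using ii(3) True by (auto simp: e s' \<psi>_def)
      ultimately show ?thesis using E_inj by (auto simp: e s')
    next
      case False
      then have "l = 0" "l' = 0" "j < 2 * k \<sigma>" "j' < 2 * k \<sigma>"
        using Ch_cases[OF c(1)] Ch_cases[OF c(3)] c(2,4) s' by (auto simp: len_def)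
      moreover have "j = j'"
      proof (cases "j < k \<sigma>")
        case True
        then have "j' < k \<sigma>" "E \<sigma> j = E \<sigma> j'"
          using ii(3) False by (auto simp: e s' \<psi>_def split: if_splits)
        then show ?thesis using E_inj True by blast
      next
        case nj: False
        then have "\<not> j' < k \<sigma>" "E \<sigma> (2 * k \<sigma> - 1 - j) = E \<sigma> (2 * k \<sigma> - 1 - j')"
          using ii(3) False by (auto simp: e s' \<psi>_def split: if_splits)
        then have "2 * k \<sigma> - 1 - j = 2 * k \<sigma> - 1 - j'"
          using nj \<open>j < 2 * k \<sigma>\<close> \<open>j' < 2 * k \<sigma>\<close> by (intro E_inj[of \<sigma>]) auto
        then show ?thesis using \<open>j < 2 * k \<sigma>\<close> \<open>j' < 2 * k \<sigma>\<close> by linarith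
      qed
      ultimately show ?thesis by (simp add: e s')
    qed
  qed
  have ob: "orthonormal ?I b"
  proof -
    have "orthonormal (\<psi> ` ?I) \<phi>"
      by (rule orthonormal_subset[OF o\<phi>]) (use \<psi>Y in blast)
    from orthonormal_compose[OF this inj\<psi>] show ?thesis
      using b\<psi> unfolding orthonormal_def by metis
  qed
  have Jb: "J (b (c, j)) = fst c *\<^sub>R b (c, len c - 1 - j)" if c: "c \<in> Ch" "j < len c" for c j
  proof -
    obtain \<sigma> l where e: "c = (\<sigma>, l)" by fastforce
    show ?thesis
    proof (cases "\<sigma> = 1 \<or> \<sigma> = - 1")
      case True
      then have "E \<sigma> l \<in> Ms \<sigma>" using Ch_cases c(1) E_in unfolding e by fastforce
      then have "J (E \<sigma> l) = \<sigma> *\<^sub>R E \<sigma> l" using True by (rule Mpn(1))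
      then show ?thesis using True by (auto simp: e b_def)
    next
      case False
      then have n: "\<sigma> \<noteq> 1" "\<sigma> \<noteq> - 1" by auto
      then have pos: "0 < \<sigma>" and j: "j < 2 * k \<sigma>"
        using Ch_cases c unfolding e len_def by fastforce+
      show ?thesis
      proof (cases "j < k \<sigma>")
        case True
        then have "\<not> 2 * k \<sigma> - 1 - j < k \<sigma>" "2 * k \<sigma> - 1 - (2 * k \<sigma> - 1 - j) = j" by auto
        then show ?thesis using True n pos by (simp add: e b_def len_def)
      next
        case False
        then have lt: "2 * k \<sigma> - 1 - j < k \<sigma>" using j by auto
        have "J (J (E \<sigma> (2 * k \<sigma> - 1 - j))) = \<sigma>\<^sup>2 *\<^sub>R E \<sigma> (2 * k \<sigma> - 1 - j)"
          using JJM E_M[OF lt n] by simp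
        then show ?thesis using False lt n pos
          by (simp add: e b_def len_def linJ power2_eq_square)
      qed
    qed
  qed
  have len1: "1 \<le> len c" if "c \<in> Ch" for c
    using Ch_cases that by (cases c) (fastforce simp: len_def)
  have finCh: "finite Ch" using finM by (simp add: Ch_def)
  have finI: "finite ?I" using finCh by simp
  have M_b: "u \<in> b ` ?I" if uM: "u \<in> Mp \<union> Mn \<union> M" for u
  proof -
    consider "u \<in> Ms 1" | "u \<in> Ms (- 1)" | "u \<in> M" using uM by (auto simp: Ms_def)
    then show ?thesis
    proof cases
      case 1
      then obtain l where "l < k 1" "u = E 1 l" using E[of 1] by (auto simp: bij_betw_def)
      then show ?thesis by (intro image_eqI[of _ _ "((1, l), 0)"]) (auto simp: b_def Ch_def len_def)
    next
      case 2
      then obtain l where "l < k (- 1)" "u = E (- 1) l"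
        using E[of "- 1"] by (auto simp: bij_betw_def)
      then show ?thesis by (intro image_eqI[of _ _ "((- 1, l), 0)"]) (auto simp: b_def Ch_def len_def)
    next
      case 3
      then have n: "sc u \<noteq> 1" "sc u \<noteq> - 1" using sc(1,2)[OF 3] by auto
      then have "u \<in> Ms (sc u)" using 3 by (simp add: Ms_def)
      then obtain j where "j < k (sc u)" "u = E (sc u) j"
        using E[of "sc u"] by (auto simp: bij_betw_def)
      then show ?thesis
        using n 3 by (intro image_eqI[of _ _ "((sc u, 0), j)"]) (auto simp: b_def Ch_def len_def)
    qed
  qed
  have Bb: "\<exists>r. B (b i) = r *\<^sub>R b i" if i: "i \<in> ?I" for i
  proof -
    obtain u p where e: "\<psi> i = (u, p)" by fastforce
    have "(u, p) \<in> Y" using \<psi>Y[OF i] e by simp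
    then consider "u \<in> Mp \<union> Mn" "\<not> p" | "u \<in> M" "\<not> p" | "u \<in> M" "p" by (auto simp: Y_def)
    then show ?thesis
    proof cases
      case 1
      then have "B u = 0" using MpB(2) MnB(2) by blast
      moreover have "b i = u" using 1(2) by (simp add: b\<psi>[OF i] e \<phi>_def)
      ultimately show ?thesis by (intro exI[of _ 0]) simp
    next
      case 2
      then have "B u = \<nu> u *\<^sub>R u" using \<nu> by blast
      moreover have "b i = u" using 2(2) by (simp add: b\<psi>[OF i] e \<phi>_def)
      ultimately show ?thesis by (intro exI[of _ "\<nu> u"]) simp
    next
      case 3
      then have "B (b i) = (- \<nu> u) *\<^sub>R b i"
        by (simp add: b\<psi>[OF i] e \<phi>_def linB BJM)
      then show ?thesis by blast
    qed
  qed
  define W where "W = ocomp (b ` ?I)"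
  have BW: "B y \<in> W" if y: "y \<in> W" for y
    unfolding W_def ocomp_def
  proof (intro CollectI ballI, elim imageE)
    fix m i assume i: "i \<in> ?I" "m = b i"
    obtain r where "B (b i) = r *\<^sub>R b i" using Bb[OF i(1)] by blast
    moreover have "cinner (b i) y = 0" using y i(1) unfolding W_def ocomp_def by blast
    ultimately show "cinner m (B y) = 0"
      using csymD[OF csym_B, of "b i" y]
      by (simp add: i(2) scaleR_scaleC cinner_scaleC_left)
  qed
  have JW: "J y \<in> W" if y: "y \<in> W" for y
    unfolding W_def ocomp_def
  proof (intro CollectI ballI, elim imageE)
    fix m i assume i: "i \<in> ?I" "m = b i"
    obtain c j where e: "i = (c, j)" by fastforce
    have c: "c \<in> Ch" "j < len c" using i(1) by (auto simp: e)
    then have "(c, len c - 1 - j) \<in> ?I" by auto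
    then have "cinner (b (c, len c - 1 - j)) y = 0" using y unfolding W_def ocomp_def by blast
    then show "cinner m (J y) = 0"
      using csymD[OF csym_J, of "b i" y] Jb[OF c]
      by (simp add: i(2) e scaleR_scaleC cinner_scaleC_left)
  qed
  \<comment> \<open>Otherwise \<open>W\<close> holds an eigenvector of \<open>J\<close> with nonzero
    value \<mu>. Maximality of \<open>Mp\<close> and \<open>Mn\<close> rules out 1 and -1, and then
    \<open>B\<close> has an eigenvector in \<open>W\<close> with value in (0, 1), against maximality
    of \<open>M\<close>.\<close>
  have zeroW: "J x = 0" if x: "x \<in> W" for x
  proof (rule ccontr)
    assume nz: "J x \<noteq> 0"
    have subW: "csubspace W" "closed W" unfolding W_def by (rule csubspace_ocomp, rule closed_ocomp)
    have "\<exists>u \<mu>. u \<in> W \<and> norm u = 1 \<and> \<mu> \<noteq> 0 \<and> J u = complex_of_real \<mu> *\<^sub>C u"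
    proof (rule finite_rank_csym_bound[OF csym_J finite_rank_PQ])
      fix F K assume K: "0 \<le> K" "\<And>x. norm (J x) \<le> K * norm x"
      show ?thesis
        by (rule compact_csym_eigenvector[OF csym_J K(2,1)
              finite_rank_compact_like[OF csym_J finite_rank_PQ] subW JW x nz]) (assumption, blast)
    qed
    then obtain u \<mu> where u: "u \<in> W" "norm u = 1" "\<mu> \<noteq> 0" and Ju: "J u = \<mu> *\<^sub>R u"
      by (auto simp: scaleR_scaleC)
    have orth: "cinner m y = 0" if "y \<in> W" "m \<in> Mp \<union> Mn \<union> M" for y m
      using that M_b unfolding W_def ocomp_def by blast
    have "\<mu> \<noteq> 1"
    proof
      assume "\<mu> = 1"
      then have "u \<in> Xs 1" using Ju by (simp add: Xs_def)
      then obtain m where "m \<in> Mp" "cinner m u \<noteq> 0" using Mp(4) u(2) by blast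
      then show False using orth[OF u(1), of m] by blast
    qed
    moreover have "\<mu> \<noteq> - 1"
    proof
      assume "\<mu> = - 1"
      then have "u \<in> Xs (- 1)" using Ju by (simp add: Xs_def)
      then obtain m where "m \<in> Mn" "cinner m u \<noteq> 0" using Mn(4) u(2) by blast
      then show False using orth[OF u(1), of m] by blast
    qed
    moreover have BBu: "B (B u) = (1 - \<mu>\<^sup>2) *\<^sub>R u"
      using JJ[of u] by (simp add: Ju linJ scaleR_left_diff_distrib power2_eq_square algebra_simps)
    moreover have "(norm (B u))\<^sup>2 = 1 - \<mu>\<^sup>2"
    proof -
      have "(norm (B u))\<^sup>2 = Re (cinner u (B (B u)))"
        using csymD[OF csym_B, of u "B u"] by (simp flip: Re_cinner_self)
      then show ?thesis
        by (simp add: BBu scaleR_scaleC cinner_scaleC_right cinner_self u(2))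
    qed
    ultimately have lt: "\<mu>\<^sup>2 < 1"
      using zero_le_power2[of "norm (B u)"] by (smt (verit) power2_eq_1_iff)
    define r where "r = sqrt (1 - \<mu>\<^sup>2)"
    have r: "0 < r" "r < 1" "r\<^sup>2 = 1 - \<mu>\<^sup>2" using lt u(3) by (auto simp: r_def)
    \<comment> \<open>Since B^2 u = r^2 u, this is an eigenvector for r unless it vanishes; B u = -
      r u is impossible because \<open>B\<close> anticommutes with \<open>J\<close> and r \<mu> is
      nonzero.\<close>
    define w where "w = r *\<^sub>R u + B u"
    have Bw: "B w = r *\<^sub>R w"
      using r(3) by (simp add: w_def linB BBu scaleR_add_right power2_eq_square add.commute)
    have "w \<noteq> 0"
    proof
      assume "w = 0"
      then have Bu: "B u = - (r *\<^sub>R u)" by (simp add: w_def eq_neg_iff_add_eq_0 add.commute)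
      have "- ((r * \<mu>) *\<^sub>R u) = (r * \<mu>) *\<^sub>R u"
        using BJ[of u] by (simp add: Ju Bu linB linJ mult.commute)
      then have "(r * \<mu>) *\<^sub>R u + (r * \<mu>) *\<^sub>R u = 0" by (metis add.right_inverse)
      then have "r = 0 \<or> \<mu> = 0 \<or> u = 0" by (auto simp flip: scaleR_add_left)
      then show False using r(1) u(2,3) by auto
    qed
    then obtain d where d: "norm (d *\<^sub>C w) = 1" "d \<noteq> 0" by (rule unit_multiple)
    have "w \<in> W" unfolding w_def by (intro csubspaceD[OF subW(1)] BW u(1))
    then have "d *\<^sub>C w \<in> W" by (rule csubspaceD(4)[OF subW(1)])
    moreover have "d *\<^sub>C w \<in> X"
      using r(1,2) by (auto simp: X_def linB Bw scaleR_scaleC scaleC_scaleC mult.commute)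
    ultimately show False using M(4) d(1) orth[of "d *\<^sub>C w"] by blast
  qed
  have ranJ: "J x \<in> cspan (b ` ?I)" for x
  proof -
    let ?p = "\<Sum>i\<in>?I. cinner (b i) x *\<^sub>C b i"
    have "x - ?p \<in> W" using orthonormal_residual[OF ob finI] by (auto simp: W_def ocomp_def)
    then have "J x = J ?p" using zeroW[of "x - ?p"] by (simp add: linJ)
    also have "\<dots> = (\<Sum>i\<in>?I. cinner (b i) x *\<^sub>C J (b i))" by (simp only: linJ)
    also have "\<dots> \<in> cspan (b ` ?I)"
    proof (intro cvec.span_sum cvec.span_scale)
      fix i assume i: "i \<in> ?I"
      obtain c j where e: "i = (c, j)" by fastforce
      have c: "c \<in> Ch" "j < len c" using i by (auto simp: e)
      then have "b (c, len c - 1 - j) \<in> cspan (b ` ?I)"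
        by (intro cvec.span_base imageI) auto
      then show "J (b i) \<in> cspan (b ` ?I)"
        by (simp add: e Jb[OF c] scaleR_scaleC cvec.span_scale)
    qed
    finally show ?thesis .
  qed
  have s0: "fst c \<noteq> 0" if "c \<in> Ch" for c
    using Ch_cases that by (cases c) fastforce
  have lN: "l < CARD('n)" if "(\<sigma>, l) \<in> Ch" for \<sigma> l
    using Ch_cases[OF that] cMp cMn by (auto simp: k_def Ms_def)
  have \<kappa>_inj: "l = l'" if "\<kappa> (\<sigma>, l) = \<kappa> (\<sigma>', l')" "(\<sigma>, l) \<in> Ch" "(\<sigma>', l') \<in> Ch" for \<sigma> l \<sigma>' l'
    using that h lN by (auto simp: \<kappa>_def bij_betw_def inj_on_def)
  have inj: "c = c'" if "c \<in> Ch" "c' \<in> Ch" "\<kappa> c = \<kappa> c'" "fst c = fst c'" for c c'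
    using that \<kappa>_inj by (cases c; cases c') auto
  \<comment> \<open>Scales other than 1 and -1 are positive, so opposite scales occur only between
    chains of length 1.\<close>
  have opp: "len c = 1 \<and> len c' = 1"
    if "c \<in> Ch" "c' \<in> Ch" "\<kappa> c = \<kappa> c'" "fst c = - fst c'" for c c'
  proof -
    obtain \<sigma> l \<sigma>' l' where e: "c = (\<sigma>, l)" "c' = (\<sigma>', l')" by (metis prod.collapse)
    have "\<sigma> = 1 \<or> \<sigma> = - 1" "\<sigma>' = 1 \<or> \<sigma>' = - 1"
      using Ch_cases[of \<sigma> l] Ch_cases[of \<sigma>' l'] that by (auto simp: e)
    then show ?thesis by (auto simp: e len_def)
  qed
  have "\<exists>\<Gamma> :: (complex ^ 'n) ell2 \<Rightarrow> (complex ^ 'n) ell2.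
    block_hankel \<Gamma> \<and> finite_rank \<Gamma> \<and> unitarily_equivalent J \<Gamma>"
    by (rule flip_chains_hankel[OF finCh len1 s0 ob csym_J ranJ Jb inj opp inf S])
  then show ?thesis by (simp only: J_def[abs_def])
qed

end

section \<open>Bound on the multiplicities\<close>

lemma finite_rank_diag_proj:
  fixes e :: "nat \<Rightarrow> 'a::chilbert_space"
  assumes "finite {n. lam n \<in> \<Omega>}"
  shows "finite_rank (diag_proj e lam \<Omega>)"
proof -
  have "diag_proj e lam \<Omega> x = (\<Sum>n\<in>{n. lam n \<in> \<Omega>}. cinner (e n) x *\<^sub>C e n)" for x
  proof -
    have "diag_proj e lam \<Omega> x
        = (\<Sum>n\<in>{n. lam n \<in> \<Omega>}. (if lam n \<in> \<Omega> then cinner (e n) x else 0) *\<^sub>C e n)"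
      unfolding diag_proj_def by (rule suminf_finite[OF assms]) simp
    then show ?thesis by simp
  qed
  then have "diag_proj e lam \<Omega> = (\<lambda>x. \<Sum>n\<in>{n. lam n \<in> \<Omega>}. cinner (e n) x *\<^sub>C e n)" by blast
  then show ?thesis using finite_rank_sum[OF assms, of "\<lambda>n x. cinner (e n) x" e] by simp
qed

text \<open>Taking the form at x gives |x|^2 = |P x|^2 - |Q x|^2 \<le> |x|^2 - |Q x|^2.\<close>

lemma projection_difference_eigenvector:
  assumes P: "orth_projection P" and Q: "orth_projection Q" and x: "P x - Q x = x"
  shows "P x = x" "Q x = 0"
proof -
  have "cinner x (P x) - cinner x (Q x) = cinner x x"
    using x by (metis cinner_diff_right)
  then have "complex_of_real ((norm (P x))\<^sup>2 - (norm (Q x))\<^sup>2) = complex_of_real ((norm x)\<^sup>2)"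
    unfolding orth_projection_form[OF P] orth_projection_form[OF Q] cinner_self by simp
  then have "(norm (P x))\<^sup>2 - (norm (Q x))\<^sup>2 = (norm x)\<^sup>2" unfolding of_real_eq_iff .
  moreover have "(norm (P x))\<^sup>2 \<le> (norm x)\<^sup>2"
    by (intro power_mono orth_projection_norm_le P) simp
  ultimately have "(norm (Q x))\<^sup>2 \<le> 0" by linarith
  then show "Q x = 0" by simp
  then show "P x = x" using x by simp
qed

context
  fixes e :: "nat \<Rightarrow> 'a::chilbert_space" and lam :: "nat \<Rightarrow> real" and D T and l :: real
  assumes e: "onb e" and T: "selfadjoint D T"
    and eig: "\<And>n. e n \<in> D" "\<And>n. T (e n) = lam n *\<^sub>R e n"
begin

lemma diag_proj_0_form_ge:
  assumes x: "x \<in> D" "diag_proj e lam {..<l} x = 0"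
  shows "l * (norm x)\<^sup>2 \<le> Re (cinner x (T x))"
proof (rule sums_le)
  show "(\<lambda>n. l * (cmod (cinner (e n) x))\<^sup>2) sums (l * (norm x)\<^sup>2)"
    by (rule sums_mult[OF onb_parseval_norm[OF e]])
  show "(\<lambda>n. lam n * (cmod (cinner (e n) x))\<^sup>2) sums Re (cinner x (T x))"
    using sums_Re[OF eigen_form_sums[OF T e eig x(1)]] by simp
  show "l * (cmod (cinner (e n) x))\<^sup>2 \<le> lam n * (cmod (cinner (e n) x))\<^sup>2" for n
  proof (cases "lam n < l")
    case True
    then have "cinner (e n) x = 0"
      using diag_proj_coeff[OF e, of n lam "{..<l}" x] x(2) by simp
    then show ?thesis by simp
  next
    case False
    then show ?thesis by (intro mult_right_mono) auto
  qed
qed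

text \<open>Such an x is a finite combination of eigenvectors, hence in \<open>D\<close>. Strictness
  comes from a nonzero coefficient, which belongs to an eigenvalue strictly below
  \<open>l\<close>.\<close>

lemma diag_proj_id_form_less:
  assumes fin: "finite {n. lam n < l}" and x: "diag_proj e lam {..<l} x = x" "x \<noteq> 0"
  shows "x \<in> D" "Re (cinner x (T x)) < l * (norm x)\<^sup>2"
proof -
  have "finite {n. lam n \<in> {..<l}}" using fin by simp
  then have "diag_proj e lam {..<l} x
      = (\<Sum>n\<in>{n. lam n \<in> {..<l}}. (if lam n \<in> {..<l} then cinner (e n) x else 0) *\<^sub>C e n)"
    unfolding diag_proj_def by (rule suminf_finite) simp
  also have "\<dots> \<in> D"
    by (intro cvec.subspace_sum[OF selfadjointD(1)[OF T]] csubspaceD(4)[OF selfadjointD(1)[OF T]] eig(1))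
  finally show xD: "x \<in> D" by (simp add: x(1))
  obtain m where m: "cinner (e m) x \<noteq> 0" using onb_total[OF e, of x] x(2) by blast
  have coeff: "lam n < l" if "cinner (e n) x \<noteq> 0" for n
    using diag_proj_coeff[OF e, of n lam "{..<l}" x] x(1) that by (auto split: if_splits)
  have "(\<lambda>n. (l - lam n) * (cmod (cinner (e n) x))\<^sup>2) sums (l * (norm x)\<^sup>2 - Re (cinner x (T x)))"
    using sums_diff[OF sums_mult[OF onb_parseval_norm[OF e, of x], of l]
        sums_Re[OF eigen_form_sums[OF T e eig xD]]]
    by (simp add: left_diff_distrib)
  moreover have "0 < (\<Sum>n. (l - lam n) * (cmod (cinner (e n) x))\<^sup>2)"
  proof (rule suminf_pos2)
    show "summable (\<lambda>n. (l - lam n) * (cmod (cinner (e n) x))\<^sup>2)" using calculation by (rule sums_summable)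
    show "0 \<le> (l - lam n) * (cmod (cinner (e n) x))\<^sup>2" for n
      using coeff[of n] by (cases "cinner (e n) x = 0") auto
    show "0 < (l - lam m) * (cmod (cinner (e m) x))\<^sup>2" using coeff[OF m] m by simp
  qed
  ultimately show "Re (cinner x (T x)) < l * (norm x)\<^sup>2" by (simp add: sums_iff)
qed

end

text \<open>The fixed vectors of \<open>A\<close> form a subspace that contains the span of the
  \<open>b i\<close> and meets the kernel of \<open>S\<close> only in 0. With P - Q and Q - P for
  \<open>A\<close> this bounds the multiplicities of 1 and -1.\<close>

lemma orthonormal_eigen_card_le:
  fixes S A :: "'a::complex_inner \<Rightarrow> 'a"
  assumes S: "csym S" "finite_rank S" and A: "csym A" and b: "orthonormal I b"
    and fixed: "\<And>i. i \<in> I \<Longrightarrow> A (b i) = b i"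
    and inj: "\<And>x. A x = x \<Longrightarrow> S x = 0 \<Longrightarrow> x = 0"
  shows "card I \<le> cdim (range S)"
proof -
  note lin = clinearD[OF csym_clinear[OF A]]
  have "csubspace {x. A x = x}" by (rule cvec.subspaceI) (simp_all add: lin)
  moreover have "b ` I \<subseteq> {x. A x = x}" using fixed by auto
  ultimately have "cspan (b ` I) \<subseteq> {x. A x = x}" by (rule cvec.span_minimal[rotated])
  then have "x = 0" if "x \<in> cspan (b ` I)" "S x = 0" for x using that inj by blast
  from orthonormal_card_le_rank[OF csym_clinear[OF S(1)] S(2) b this] show ?thesis by simp
qed

text \<open>The number N is the cardinality of the type \<open>'n\<close>, which makes it positive
  and lets the type of \<Gamma> fix the size of the blocks.\<close>

theorem proposition6p6:
  fixes D :: "'a::chilbert_space set" and T S :: "'a \<Rightarrow> 'a" and lam :: real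
  assumes "separable_space (euclidean :: 'a topology)"
    and "\<not> cfinite_dim (UNIV :: 'a set)"
    and "selfadjoint UNIV S" and "finite_rank S" and "cdim (range S) = CARD('n::finite)"
    and "selfadjoint D T" and "bounded_from_below D T" and "purely_discrete_spectrum D T"
  shows "\<exists>\<Gamma> :: (complex ^ 'n) ell2 \<Rightarrow> (complex ^ 'n) ell2.
    block_hankel \<Gamma> \<and> finite_rank \<Gamma> \<and>
    unitarily_equivalent
      (\<lambda>x. spectral_projection D (\<lambda>y. T y + S y) {..<lam} x - spectral_projection D T {..<lam} x) \<Gamma>"
proof -
  define TS where "TS y = T y + S y" for y
  have S: "csym S" using assms(3) by (simp add: selfadjoint_UNIV_iff)
  have sa: "selfadjoint D TS"
    unfolding TS_def by (rule selfadjoint_add_csym[OF assms(6) S])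
  have bb: "bounded_from_below D TS"
    unfolding TS_def by (rule bounded_from_below_add[OF assms(7) S assms(4)])
  have fd: "form_discrete D T" by (rule pure_form_discrete[OF assms(6-8)])
  have fdS: "form_discrete D TS"
    unfolding TS_def by (rule form_discrete_add[OF fd S assms(4)])
  obtain Z :: "'a set" where Z: "countable Z" "ctotal Z"
    using separable_countable_total[OF assms(1)] by metis
  show ?thesis
  proof (rule form_discrete_eigenbasis[OF assms(6,7) fd assms(2) Z],
      rule form_discrete_eigenbasis[OF sa bb fdS assms(2) Z])
    fix e f :: "nat \<Rightarrow> 'a" and le lf :: "nat \<Rightarrow> real"
    assume e: "onb e" "\<And>n. e n \<in> D" "\<And>n. T (e n) = le n *\<^sub>R e n"
        "\<And>l::real. finite {n. le n < l}"
      and f: "onb f" "\<And>n. f n \<in> D" "\<And>n. TS (f n) = lf n *\<^sub>R f n"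
        "\<And>l::real. finite {n. lf n < l}"
    define Q where "Q = diag_proj e le {..<lam}"
    define P where "P = diag_proj f lf {..<lam}"
    have Q_eq: "spectral_projection D T {..<lam} = Q"
      unfolding Q_def by (rule spectral_projection_eigenbasis[OF e(1) assms(6) e(2,3)]) simp
    have P_eq: "spectral_projection D (\<lambda>y. T y + S y) {..<lam} = P"
      unfolding P_def TS_def[symmetric]
      by (rule spectral_projection_eigenbasis[OF f(1) sa f(2,3)]) simp
    have Q: "orth_projection Q" "finite_rank Q"
      unfolding Q_def using e(4)[of lam]
      by (simp_all add: orth_projection_diag_proj[OF e(1)] finite_rank_diag_proj)
    have P: "orth_projection P" "finite_rank P"
      unfolding P_def using f(4)[of lam]
      by (simp_all add: orth_projection_diag_proj[OF f(1)] finite_rank_diag_proj)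
    have csymPQ: "csym (\<lambda>x. P x - Q x)" "csym (\<lambda>x. Q x - P x)"
      using P(1) Q(1)
      by (simp_all add: orth_projection_csym csym_def cinner_diff_left cinner_diff_right)
    \<comment> \<open>On the kernel of \<open>S\<close> the forms of T and T + S agree; a nonzero x
      here would put the latter strictly below lam |x|^2 and the former at or above it.\<close>
    have pos: "x = 0" if x: "P x - Q x = x" "S x = 0" for x
    proof (rule ccontr)
      assume nz: "x \<noteq> 0"
      have *: "P x = x" "Q x = 0"
        using projection_difference_eigenvector[OF P(1) Q(1) x(1)] by auto
      have "x \<in> D" "Re (cinner x (TS x)) < lam * (norm x)\<^sup>2"
        using diag_proj_id_form_less[OF f(1) sa f(2,3) f(4) _ nz] *(1) by (auto simp: P_def)
      moreover have "lam * (norm x)\<^sup>2 \<le> Re (cinner x (T x))"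
        using diag_proj_0_form_ge[OF e(1) assms(6) e(2,3) calculation(1)] *(2) by (simp add: Q_def)
      ultimately show False by (simp add: TS_def x(2))
    qed
    have neg: "x = 0" if x: "Q x - P x = x" "S x = 0" for x
    proof (rule ccontr)
      assume nz: "x \<noteq> 0"
      have *: "Q x = x" "P x = 0"
        using projection_difference_eigenvector[OF Q(1) P(1) x(1)] by auto
      have "x \<in> D" "Re (cinner x (T x)) < lam * (norm x)\<^sup>2"
        using diag_proj_id_form_less[OF e(1) assms(6) e(2,3) e(4) _ nz] *(1) by (auto simp: Q_def)
      moreover have "lam * (norm x)\<^sup>2 \<le> Re (cinner x (TS x))"
        using diag_proj_0_form_ge[OF f(1) sa f(2,3) calculation(1)] *(2) by (simp add: P_def)
      ultimately show False by (simp add: TS_def x(2))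
    qed
    have card_pos: "card I \<le> CARD('n)"
      if "orthonormal I b" "\<And>i. i \<in> I \<Longrightarrow> P (b i) - Q (b i) = b i" for I :: "'a set" and b
      unfolding assms(5)[symmetric]
      by (rule orthonormal_eigen_card_le[OF S assms(4) csymPQ(1) that(1)])
        (erule that(2), erule pos, assumption)
    have card_neg: "card I \<le> CARD('n)"
      if "orthonormal I b" "\<And>i. i \<in> I \<Longrightarrow> P (b i) - Q (b i) = - b i" for I :: "'a set" and b
      unfolding assms(5)[symmetric]
    proof (rule orthonormal_eigen_card_le[OF S assms(4) csymPQ(2) that(1)])
      fix i assume "i \<in> I"
      then have "P (b i) - Q (b i) = - b i" by (rule that(2))
      then show "Q (b i) - P (b i) = b i" by (metis minus_diff_eq minus_minus)
    qed (erule neg, assumption)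
    show ?thesis
      unfolding P_eq Q_eq
      by (rule projection_difference_hankel[OF P Q card_pos card_neg assms(2) Z])
  qed
qed

end
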